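(* Let $\mathcal Z$ denote the scalar middle matrix of the Hessian of a symmetric nc polynomial $p(x)$ in $g$ symmetric variables. (I) If $\mathrm{degree}\,p\ge3$, then $\mu_-(\mathcal Z)=1$ if and only if $$\mathcal Z=\begin{bmatrix}\mathcal Z_{00}&\mathcal Z_{01}&\mathcal Z_{02}\\ \mathcal Z_{10}&\mathcal Z_{11}&0\\ \mathcal Z_{20}&0&0\end{bmatrix}$$ (all other blocks being zero), where (1) $\mathcal Z_{01}=u(u^T\otimes y^T)+uv^T+(uv^T)^{sT}=\mathcal Z_{01}^{sT}$ and $\mathcal Z_{10}=\mathcal Z_{01}^T$; (2) $\mathcal Z_{11}=(u\otimes I_g)A(u\otimes I_g)^T$; (3) $\mathcal Z_{02}=u(u^T\otimes w_A^T)$ and $\mathcal Z_{20}=\mathcal Z_{02}^T$, in which (i) $u,y\in\mathbb{R}^g$ and $u$ is a unit vector; (ii) $v\in\mathbb{R}^{g^2}$ and $(\mathrm{mat}_g\,v)u=0$; (iii) $A=A^T\in\mathbb{R}^{g\times g}$ and $w_A=\mathrm{vec}(A)\in\mathbb{R}^{g^2}$; (iv) the matrix $$E_1=\begin{bmatrix}P\mathcal Z_{00}P&(\mathrm{mat}_g v)^T\\ \mathrm{mat}_g v&A\end{bmatrix}$$ is positive semidefinite, where $P=I_g-uu^T$ (and $A=U^T\mathcal Z_{11}U$ with $U=u\otimes I_g$). Moreover, if $\mathrm{degree}\,p=3$, then in addition to the conditions stated above, $A=0$, $w_A=0$ and $v=0$. (II) If $\mathrm{degree}\,p=2$, then $\mu_-(\mathcal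 Z)=1$ if and only if $\mathcal Z_{ij}=0$ for $i+j\ge1$ and there exists a vector $u\in\mathbb{R}^g$ with $u^Tu=1$ such that $\mathcal Z_{00}u=\lambda u$ with $\lambda<0$ and $P\mathcal Z_{00}P\succeq0$ for $P=I_g-uu^T$. (III) $\mu_-(\mathcal Z)=0$ if and only if $\mathcal Z_{ij}=0$ for $i+j\ge1$ and $\mathcal Z_{00}\succeq0$.
   Context: An nc polynomial is an element of the free algebra $\mathbb{R}\langle x\rangle$ in noncommuting variables $x_1,\dots,x_g$ with real coefficients. The involution $T$ is the linear map with $x_j^T=x_j$ (and $h_j^T=h_j$) that reverses words; $p$ is symmetric if $p^T=p$. For a matrix of nc polynomials, $T$ transposes the matrix and applies the involution to each entry. $\otimes$ is the Kronecker product, $A\otimes B=[a_{ij}B]$. Border vectors: $[x_1\cdots x_g]_j$ denotes the $j$-fold Kronecker product $[x_1\cdots x_g]\otimes\cdots\otimes[x_1\cdots x_g]$, a row of the $g^j$ words of length $j$ in lexicographic order. $V_0^T=[h_1\cdots h_g]$ and $V_j^T=[x_1\cdots x_g]_j\otimes[h_1\cdots h_g]$ for $j\ge1$; so $V_j=V_j(x)[h]$ is a column of height $g^{j+1}$ whose entries have the form $h_k x_{i_j}\cdots x_{i_1}$. Middle matrix: the Hessian $p''(x)[h]=\frac{d^2}{dt^2}p(x+th)|_{t=0}$ of a symmetric nc polynomial $p$ of degree $d\ge 2$ has a unique representation $p''(x)[h]=\sum_{i,j=0}^{d-2}V_i^TZ_{ij}(x)V_j$ with $Z_{ij}(x)$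 a $g^{i+1}\times g^{j+1}$ matrix of nc polynomials in $x$ (of degree at most $d-2-(i+j)$, and $Z_{ij}=0$ if $i+j>d-2$). The scalar middle matrix is $\mathcal Z=[\mathcal Z_{ij}]$, $\mathcal Z_{ij}=Z_{ij}(0)$, a real symmetric matrix; blocks $\mathcal Z_{ij}$ with $i+j>d-2$ are understood to be zero. $\mu_-(\mathcal Z)$ is the number of negative eigenvalues of $\mathcal Z$, counted with multiplicity. Structured transpose: a $g\times g^2$ matrix $C$ is viewed as a $g\times g$ block matrix $[c_{ij}]$ with $c_{ij}\in\mathbb{R}^{1\times g}$; $C^{sT}$ is the $g\times g$ block matrix whose $ij$ block is $c_{ji}$. For a $g\times n$ matrix $A=[a_1\ \cdots\ a_n]$ with columns $a_i$, $\mathrm{vec}(A)\in\mathbb{R}^{gn}$ is the column obtained by stacking $a_1,\dots,a_n$; conversely $\mathrm{mat}_g$ maps a vector in $\mathbb{R}^{gn}$ with stacked subvectors $a_1,\dots,a_n\in\mathbb{R}^g$ to $[a_1\ \cdots\ a_n]$. *)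

theory Defs
  imports
    "HOL-Analysis.Derivative"
    "HOL-Library.Poly_Mapping"
    "Jordan_Normal_Form.Char_Poly"
begin

subsection \<open>Noncommutative polynomials\<close>

text \<open>The free algebra is the monoid algebra of the free monoid, so lists are turned into a monoid
  under concatenation; the product of \<^theory>\<open>HOL-Library.Poly_Mapping\<close> is then
  the product of nc polynomials.\<close>

instantiation list :: (type) monoid_add
begin

definition zero_list :: "'a list" where
  "zero_list = []"

definition plus_list :: "'a list \<Rightarrow> 'a list \<Rightarrow> 'a list" where
  "plus_list v w = v @ w"

instance
  by standard (simp_all add: zero_list_def plus_list_def)

end

text \<open>Indices start at 0: the paper's $x_{j+1}$ and $h_{j+1}$ are \<open>XVar j\<close> and
  \<open>HVar j\<close>.\<close>

datatype var = XVar nat | HVar nat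

type_synonym ncpoly = "var list \<Rightarrow>\<^sub>0 real"

definition nc_var :: "var \<Rightarrow> ncpoly" where
  "nc_var a = Poly_Mapping.single [a] 1"

definition nc_const :: "real \<Rightarrow> ncpoly" where
  "nc_const c = Poly_Mapping.single [] c"

definition nc_polys :: "nat \<Rightarrow> ncpoly set" where
  "nc_polys g = {p. \<forall>w\<in>Poly_Mapping.keys p. set w \<subseteq> XVar ` {..<g}}"

definition nc_degree :: "ncpoly \<Rightarrow> nat" where
  "nc_degree p = Max (insert 0 (length ` Poly_Mapping.keys p))"

definition nc_involution :: "ncpoly \<Rightarrow> ncpoly" where
  "nc_involution p = Poly_Mapping.map_key rev p"

definition nc_symmetric :: "ncpoly \<Rightarrow> bool" where
  "nc_symmetric p \<longleftrightarrow> nc_involution p = p"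

text \<open>Substitution of elements \<open>f\<close> of a ring for the variables; \<open>\<iota>\<close> embeds the
  real coefficients into that ring.\<close>

definition nc_subst :: "(real \<Rightarrow> 'b::semiring_1) \<Rightarrow> (var \<Rightarrow> 'b) \<Rightarrow> ncpoly \<Rightarrow> 'b" where
  "nc_subst \<iota> f p =
     (\<Sum>w\<in>Poly_Mapping.keys p. \<iota> (Poly_Mapping.lookup p w) * prod_list (map f w))"

definition nc_at_zero :: "ncpoly \<Rightarrow> real" where
  "nc_at_zero p = nc_subst (\<lambda>c. c) (\<lambda>_. 0) p"

subsection \<open>The Hessian\<close>

definition nc_shift :: "real \<Rightarrow> ncpoly \<Rightarrow> ncpoly" where
  "nc_shift t p =
     nc_subst nc_const
       (\<lambda>a. case a of XVar j \<Rightarrow> nc_var (XVar j) + nc_const t * nc_var (HVar j)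
                  | HVar j \<Rightarrow> nc_var (HVar j)) p"

text \<open>The derivative in \<open>t\<close> of the nc-polynomial-valued function
  \<open>\<lambda>t. nc_shift t p\<close> is taken coefficientwise;
  its coefficients have finite support, see \<open>lookup_nc_hessian\<close> below.\<close>

definition nc_hessian :: "ncpoly \<Rightarrow> ncpoly" where
  "nc_hessian p =
     Abs_poly_mapping (\<lambda>w. (deriv ^^ 2) (\<lambda>t. Poly_Mapping.lookup (nc_shift t p) w) 0)"

subsection \<open>Kronecker products, border vectors and the middle matrix\<close>

definition kron :: "'a::semiring_0 mat \<Rightarrow> 'a mat \<Rightarrow> 'a mat" where
  "kron A B =
     mat (dim_row A * dim_row B) (dim_col A * dim_col B)
       (\<lambda>(i, j). A $$ (i div dim_row B, j div dim_col B) * B $$ (i mod dim_row B, j mod dim_col B))"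

primrec kron_power :: "'a::semiring_1 mat \<Rightarrow> nat \<Rightarrow> 'a mat" where
  "kron_power A 0 = 1\<^sub>m 1"
| "kron_power A (Suc j) = kron A (kron_power A j)"

definition nc_mat_involution :: "ncpoly mat \<Rightarrow> ncpoly mat" where
  "nc_mat_involution M = transpose_mat (map_mat nc_involution M)"

definition x_row :: "nat \<Rightarrow> ncpoly mat" where
  "x_row g = mat 1 g (\<lambda>(_, k). nc_var (XVar k))"

definition h_row :: "nat \<Rightarrow> ncpoly mat" where
  "h_row g = mat 1 g (\<lambda>(_, k). nc_var (HVar k))"

definition border_row :: "nat \<Rightarrow> nat \<Rightarrow> ncpoly mat" where
  "border_row g j = kron (kron_power (x_row g) j) (h_row g)"

definition border_vec :: "nat \<Rightarrow> nat \<Rightarrow> ncpoly mat" where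
  "border_vec g j = nc_mat_involution (border_row g j)"

text \<open>The defining property of the middle matrix of \<open>p\<close>.  The block indices run over
  $0, \dots, d-2$, where $d$ is the degree of \<open>p\<close>; all blocks outside this range are
  set to zero.\<close>

definition is_middle_matrix :: "nat \<Rightarrow> ncpoly \<Rightarrow> (nat \<Rightarrow> nat \<Rightarrow> ncpoly mat) \<Rightarrow> bool" where
  "is_middle_matrix g p Z \<longleftrightarrow>
     (\<forall>i j. Z i j \<in> carrier_mat (g ^ (i + 1)) (g ^ (j + 1)) \<and> elements_mat (Z i j) \<subseteq> nc_polys g) \<and>
     (\<forall>i j. i > nc_degree p - 2 \<or> j > nc_degree p - 2 \<longrightarrow> Z i j = 0\<^sub>m (g ^ (i + 1)) (g ^ (j + 1))) \<and>
     nc_hessian p =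
       (\<Sum>i\<le>nc_degree p - 2. \<Sum>j\<le>nc_degree p - 2.
          (border_row g i * Z i j * border_vec g j) $$ (0, 0))"

text \<open>The description is proper, by \<open>middle_matrix_ex1\<close> below.\<close>

definition middle_matrix :: "nat \<Rightarrow> ncpoly \<Rightarrow> nat \<Rightarrow> nat \<Rightarrow> ncpoly mat" where
  "middle_matrix g p = (THE Z. is_middle_matrix g p Z)"

definition scalar_middle_block :: "nat \<Rightarrow> ncpoly \<Rightarrow> nat \<Rightarrow> nat \<Rightarrow> real mat" where
  "scalar_middle_block g p i j = map_mat nc_at_zero (middle_matrix g p i j)"

definition append_cols :: "'a::zero mat \<Rightarrow> 'a mat \<Rightarrow> 'a mat" where
  "append_cols A B = four_block_mat A B (0\<^sub>m 0 (dim_col A)) (0\<^sub>m 0 (dim_col B))"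

primrec block_row :: "nat \<Rightarrow> (nat \<Rightarrow> 'a::zero mat) \<Rightarrow> 'a mat" where
  "block_row 0 R = R 0"
| "block_row (Suc n) R = append_cols (block_row n R) (R (Suc n))"

primrec block_rows :: "nat \<Rightarrow> nat \<Rightarrow> (nat \<Rightarrow> nat \<Rightarrow> 'a::zero mat) \<Rightarrow> 'a mat" where
  "block_rows 0 n B = block_row n (B 0)"
| "block_rows (Suc m) n B = append_rows (block_rows m n B) (block_row n (B (Suc m)))"

text \<open>Row and column block indices run over $0, \dots, d-2$.\<close>

definition scalar_middle_matrix :: "nat \<Rightarrow> ncpoly \<Rightarrow> real mat" where
  "scalar_middle_matrix g p =
     block_rows (nc_degree p - 2) (nc_degree p - 2) (scalar_middle_block g p)"

subsection \<open>Real matrices\<close>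

text \<open>For the symmetric matrices considered here the algebraic multiplicity, used below, is also
  the geometric one.\<close>

definition neg_eigenvalue_count :: "real mat \<Rightarrow> nat" where
  "neg_eigenvalue_count M =
     (\<Sum>c\<in>{c. eigenvalue M c \<and> c < 0}. Polynomial.order c (char_poly M))"

definition psd :: "real mat \<Rightarrow> bool" where
  "psd M \<longleftrightarrow> square_mat M \<and> transpose_mat M = M \<and>
     (\<forall>v\<in>carrier_vec (dim_row M). scalar_prod v (M *\<^sub>v v) \<ge> 0)"

definition col_mat :: "'a vec \<Rightarrow> 'a mat" where
  "col_mat v = mat_of_cols (dim_vec v) [v]"

text \<open>The transpose of the block matrix $[c_{ij}]$ with blocks $c_{ij}$ of size $1 \times g$;
  entry $l$ of $c_{ij}$ is the entry of \<open>C\<close> in row $i$ and column $jg+l$.\<close>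

definition structured_transpose :: "nat \<Rightarrow> 'a mat \<Rightarrow> 'a mat" where
  "structured_transpose g C = mat g (g * g) (\<lambda>(i, k). C $$ (k div g, i * g + k mod g))"

definition vec_of_mat :: "'a mat \<Rightarrow> 'a vec" where
  "vec_of_mat A = vec (dim_row A * dim_col A) (\<lambda>k. A $$ (k mod dim_row A, k div dim_row A))"

definition mat_of_vec :: "nat \<Rightarrow> 'a vec \<Rightarrow> 'a mat" where
  "mat_of_vec g v = mat g (dim_vec v div g) (\<lambda>(i, j). v $ (j * g + i))"

definition compl_proj :: "real vec \<Rightarrow> real mat" where
  "compl_proj u = 1\<^sub>m (dim_vec u) - col_mat u * transpose_mat (col_mat u)"

subsection \<open>The block structure for one negative eigenvalue\<close>

definition middle_form ::
  "nat \<Rightarrow> (nat \<Rightarrow> nat \<Rightarrow> real mat) \<Rightarrow> real vec \<Rightarrow> real vec \<Rightarrow> real vec \<Rightarrow> real mat \<Rightarrow> bool"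
where
  "middle_form g Z u y v A \<longleftrightarrow>
     (let u' = col_mat u; y' = col_mat y; v' = col_mat v; w' = col_mat (vec_of_mat A);
          U = kron u' (1\<^sub>m g); P = compl_proj u; V = mat_of_vec g v
      in
        (\<forall>i j. (i, j) \<notin> {(0, 0), (0, 1), (0, 2), (1, 0), (1, 1), (2, 0)} \<longrightarrow>
           Z i j = 0\<^sub>m (g ^ (i + 1)) (g ^ (j + 1))) \<and>
        Z 0 1 = u' * kron (transpose_mat u') (transpose_mat y') + u' * transpose_mat v'
                  + structured_transpose g (u' * transpose_mat v') \<and>
        Z 0 1 = structured_transpose g (Z 0 1) \<and>
        Z 1 0 = transpose_mat (Z 0 1) \<and>
        Z 1 1 = U * A * transpose_mat U \<and>
        Z 0 2 = u' * kron (transpose_mat u') (transpose_mat w') \<and>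
        Z 2 0 = transpose_mat (Z 0 2) \<and>
        u \<in> carrier_vec g \<and> y \<in> carrier_vec g \<and> scalar_prod u u = 1 \<and>
        v \<in> carrier_vec (g * g) \<and> V *\<^sub>v u = 0\<^sub>v g \<and>
        A \<in> carrier_mat g g \<and> A = transpose_mat A \<and>
        psd (four_block_mat (P * Z 0 0 * P) (transpose_mat V) V A) \<and>
        A = transpose_mat U * Z 1 1 * U)"

subsection \<open>Existence and uniqueness of the middle matrix\<close>

abbreviation (input) "lk \<equiv> Poly_Mapping.lookup"

lemma list_zero[simp]: "(0::'a list) = []" by (simp add: zero_list_def)
lemma list_plus[simp]: "(v::'a list) + w = v @ w" by (simp add: plus_list_def)

lemma lookup_single_mult:
  "lk (Poly_Mapping.single u c * z) (k :: 'a list) =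
     (if take (length u) k = u then c * lk z (drop (length u) k) else (0::real))"
proof -
  have inner: "Sum_any (\<lambda>q. lk z q when k = u + q) =
      (if take (length u) k = u then lk z (drop (length u) k) else 0)"
  proof (cases "take (length u) k = u")
    case True
    have "k = u + q \<longleftrightarrow> drop (length u) k = q" for q
      using True by (metis append_take_drop_id append_eq_conv_conj list_plus)
    then show ?thesis using True by simp
  next
    case False
    then have "(\<lambda>q. lk z q when k = u + q) = (\<lambda>q. 0)"
      by (intro ext) (auto simp: when_def)
    then have "Sum_any (\<lambda>q. lk z q when k = u + q) = 0" by (simp only: Sum_any.neutral)
    then show ?thesis using False by simp
  qed
  have "lk (Poly_Mapping.single u c * z) k = Sum_any (\<lambda>l. (c when u = l) * Sum_any (\<lambda>q. lk z q when k = l + q))"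
    by (simp only: lookup_mult lookup_single)
  also have "\<dots> = Sum_any (\<lambda>l. (c * Sum_any (\<lambda>q. lk z q when k = l + q)) when u = l)"
    by (intro arg_cong[of _ _ Sum_any] ext) (simp add: when_def)
  also have "\<dots> = c * Sum_any (\<lambda>q. lk z q when k = u + q)" by simp
  finally show ?thesis unfolding inner by simp
qed

lemma lookup_mult_single:
  "lk (z * Poly_Mapping.single v c) (k :: 'a list) =
     (if \<exists>m. k = m @ v then lk z (take (length k - length v) k) * c else (0::real))"
proof -
  have inner: "Sum_any (\<lambda>q. (c when v = q) when k = l + q) = (c when k = l @ v)" for l
  proof -
    have "(\<lambda>q. (c when v = q) when k = l + q) = (\<lambda>q. (c when k = l @ v) when v = q)"
      by (intro ext) (auto simp: when_def)
    then have "Sum_any (\<lambda>q. (c when v = q) when k = l + q) = Sum_any (\<lambda>q. (c when k = l @ v) when v = q)"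
      by (rule arg_cong)
    then show ?thesis by (simp only: Sum_any_when_equal')
  qed
  have "lk (z * Poly_Mapping.single v c) k = Sum_any (\<lambda>l. lk z l * Sum_any (\<lambda>q. (c when v = q) when k = l + q))"
    by (simp only: lookup_mult lookup_single)
  also have "\<dots> = Sum_any (\<lambda>l. lk z l * c when k = l @ v)"
    unfolding inner by (intro arg_cong[of _ _ Sum_any] ext) (simp add: when_def)
  also have "\<dots> = (if \<exists>m. k = m @ v then lk z (take (length k - length v) k) * c else 0)"
  proof (cases "\<exists>m. k = m @ v")
    case True
    then obtain m where m: "k = m @ v" by blast
    then have "(\<lambda>l. lk z l * c when k = l @ v) = (\<lambda>l. lk z l * c when m = l)" by auto
    then show ?thesis using m by simp
  next
    case False
    then have "(\<lambda>l. lk z l * c when k = l @ v) = (\<lambda>l. 0)"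
      by (intro ext) (auto simp: when_def)
    then show ?thesis using False by simp
  qed
  finally show ?thesis .
qed

lemma lookup_monomial_sandwich:
  "lk (Poly_Mapping.single u 1 * z * Poly_Mapping.single v 1) (u @ m @ v) = lk z (m::'a list) * (1::real)"
  unfolding lookup_mult_single lookup_single_mult by simp

lemma lookup_monomial_sandwich_0:
  assumes "lk (Poly_Mapping.single u 1 * z * Poly_Mapping.single v 1) k \<noteq> (0::real)"
  shows "\<exists>m :: 'a list. k = u @ m @ v \<and> lk z m \<noteq> 0"
proof -
  from assms obtain m where m: "k = m @ v" unfolding lookup_mult_single by (auto split: if_splits)
  have "lk (Poly_Mapping.single u 1 * z) m \<noteq> 0"
    using assms unfolding m lookup_mult_single by auto
  then have "take (length u) m = u" "lk z (drop (length u) m) \<noteq> 0"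
    unfolding lookup_single_mult by (auto split: if_splits)
  then show ?thesis unfolding m by (metis append_take_drop_id append.assoc)
qed

fun is_h :: "var \<Rightarrow> bool" where "is_h (HVar _) = True" | "is_h (XVar _) = False"

fun to_x :: "var \<Rightarrow> var" where "to_x (HVar j) = XVar j" | "to_x (XVar j) = XVar j"

abbreviation (input) "hcount w \<equiv> length (filter is_h w)"

lemma lookup_shift_monomial:
  assumes "set w \<subseteq> range XVar"
  shows "lk (prod_list (map
       (\<lambda>a. case a of XVar j \<Rightarrow> nc_var (XVar j) + nc_const t * nc_var (HVar j)
                  | HVar j \<Rightarrow> nc_var (HVar j)) w)) k = (if map to_x k = w then t ^ hcount k else 0)"
  using assms
proof (induction w arbitrary: k)
  case Nil
  then show ?case by (auto simp: lookup_one when_def)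
next
  case (Cons a w)
  then obtain j where a: "a = XVar j" by auto
  have s: "nc_var (XVar j) + nc_const t * nc_var (HVar j) =
       Poly_Mapping.single [XVar j] 1 + Poly_Mapping.single [HVar j] t"
    by (simp add: nc_var_def nc_const_def mult_single)
  show ?case
  proof (cases k)
    case Nil
    then show ?thesis unfolding a by (simp add: s distrib_right lookup_add lookup_single_mult)
  next
    case (Cons b k')
    show ?thesis unfolding a Cons using Cons.prems Cons.IH
      by (cases b) (auto simp: s distrib_right lookup_add lookup_single_mult)
  qed
qed

lemma lookup_nc_shift:
  assumes "p \<in> nc_polys g"
  shows "lk (nc_shift t p) k = lk p (map to_x k) * t ^ hcount k"
proof -
  have "lk (nc_shift t p) k = (\<Sum>w\<in>Poly_Mapping.keys p. lk p w * (if map to_x k = w then t ^ hcount k else 0))"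
    unfolding nc_shift_def nc_subst_def lookup_sum
  proof (rule sum.cong[OF refl])
    fix w assume "w \<in> Poly_Mapping.keys p"
    then have w: "set w \<subseteq> range XVar" using assms unfolding nc_polys_def by blast
    show "lk (nc_const (lk p w) * prod_list (map (\<lambda>a. case a of XVar j \<Rightarrow> nc_var (XVar j) + nc_const t * nc_var (HVar j)
                  | HVar j \<Rightarrow> nc_var (HVar j)) w)) k = lk p w * (if map to_x k = w then t ^ hcount k else 0)"
      unfolding nc_const_def[of "lk p w"] lookup_single_mult
      by (subst lookup_shift_monomial[OF w]) simp
  qed
  also have "\<dots> = lk p (map to_x k) * t ^ hcount k"
    by (simp add: if_distrib[of "\<lambda>x. _ * x"] sum.delta' in_keys_iff cong: if_cong)
  finally show ?thesis .
qed

lemma deriv2_monomial: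
  "(deriv ^^ 2) (\<lambda>t::real. c * t ^ n) 0 = (if n = 2 then 2 * c else 0)"
proof -
  have d: "deriv (\<lambda>t::real. c * t ^ n) = (\<lambda>t. (c * real n) * t ^ (n - 1))" for c :: real and n :: nat
    by (intro ext DERIV_imp_deriv) (auto intro!: derivative_eq_intros)
  have e: "(deriv ^^ 2) (\<lambda>t::real. c * t ^ n) = (\<lambda>t. (c * real n * real (n - 1)) * t ^ (n - 1 - 1))"
    by (simp add: numeral_2_eq_2 d)
  consider "n = 0" | "n = 1" | "n = 2" | "n > 2" by linarith
  then show ?thesis unfolding e by cases (simp_all add: power_0_left)
qed

lemma finite_to_x: "finite {k. map to_x k \<in> Poly_Mapping.keys p}"
proof -
  have "finite {k. map to_x k = w}" for w
  proof (induction w)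
    case (Cons a w)
    have "{k. map to_x k = a # w} \<subseteq> (\<lambda>(b, k). b # k) ` ({b. to_x b = a} \<times> {k. map to_x k = w})"
      by (auto simp: map_eq_Cons_conv)
    moreover have "{b. to_x b = a} \<subseteq> (case a of XVar j \<Rightarrow> {XVar j, HVar j} | HVar j \<Rightarrow> {})"
    proof
      fix b assume "b \<in> {b. to_x b = a}"
      then show "b \<in> (case a of XVar j \<Rightarrow> {XVar j, HVar j} | HVar j \<Rightarrow> {})" by (cases b) auto
    qed
    then have "finite {b. to_x b = a}" by (rule finite_subset) (auto split: var.split)
    ultimately show ?case using Cons finite_subset by blast
  qed auto
  then have "finite (\<Union>w\<in>Poly_Mapping.keys p. {k. map to_x k = w})" by auto
  moreover have "{k. map to_x k \<in> Poly_Mapping.keys p} = (\<Union>w\<in>Poly_Mapping.keys p. {k. map to_x k = w})"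
    by auto
  ultimately show ?thesis by simp
qed

lemma
  assumes "p \<in> nc_polys g"
  shows lookup_nc_hessian:
      "lk (nc_hessian p) k = (deriv ^^ 2) (\<lambda>t. lk (nc_shift t p) k) 0"
    and lookup_nc_hessian_word:
      "lk (nc_hessian p) k = (if hcount k = 2 then 2 * lk p (map to_x k) else 0)"
proof -
  have e: "(deriv ^^ 2) (\<lambda>t. lk (nc_shift t p) k) 0 = (if hcount k = 2 then 2 * lk p (map to_x k) else 0)" for k
    unfolding lookup_nc_shift[OF assms] deriv2_monomial by simp
  have "{k. (deriv ^^ 2) (\<lambda>t. lk (nc_shift t p) k) 0 \<noteq> 0} \<subseteq> {k. map to_x k \<in> Poly_Mapping.keys p}"
    unfolding e by (auto simp: in_keys_iff)
  then have "finite {k. (deriv ^^ 2) (\<lambda>t. lk (nc_shift t p) k) 0 \<noteq> 0}"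
    using finite_to_x finite_subset by blast
  then show "lk (nc_hessian p) k = (deriv ^^ 2) (\<lambda>t. lk (nc_shift t p) k) 0"
    unfolding nc_hessian_def by (simp add: Abs_poly_mapping_inverse)
  then show "lk (nc_hessian p) k = (if hcount k = 2 then 2 * lk p (map to_x k) else 0)"
    unfolding e .
qed

primrec xword :: "nat \<Rightarrow> nat \<Rightarrow> nat \<Rightarrow> var list" where
  "xword g 0 a = []"
| "xword g (Suc j) a = XVar (a div g ^ j) # xword g j (a mod g ^ j)"

definition bword :: "nat \<Rightarrow> nat \<Rightarrow> nat \<Rightarrow> var list" where
  "bword g j a = xword g j (a div g) @ [HVar (a mod g)]"

lemma digit_bounds:
  fixes a g j :: nat
  assumes "a < g ^ Suc j"
  shows "a div g ^ j < g" "a mod g ^ j < g ^ j"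
proof -
  have "g > 0" using assms by (cases g) auto
  then show "a mod g ^ j < g ^ j" by simp
  show "a div g ^ j < g" using assms by (intro less_mult_imp_div_less) simp
qed

lemma kron_power_x_row:
  "dim_row (kron_power (x_row g) j) = 1" "dim_col (kron_power (x_row g) j) = g ^ j"
  by (induction j) (auto simp: kron_def x_row_def)

lemma kron_power_x_row_entry:
  "a < g ^ j \<Longrightarrow> kron_power (x_row g) j $$ (0, a) = Poly_Mapping.single (xword g j a) 1"
proof (induction j arbitrary: a)
  case 0
  then show ?case by (simp flip: list_zero)
next
  case (Suc j)
  note digit_bounds[OF Suc.prems]
  then have "x_row g $$ (0, a div g ^ j) = Poly_Mapping.single [XVar (a div g ^ j)] 1"
    by (simp add: x_row_def nc_var_def)
  moreover have "kron_power (x_row g) j $$ (0, a mod g ^ j) = Poly_Mapping.single (xword g j (a mod g ^ j)) 1"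
    using Suc.IH digit_bounds(2)[OF Suc.prems] by blast
  moreover have "dim_row (x_row g) = 1" "dim_col (x_row g) = g" by (simp_all add: x_row_def)
  ultimately show ?case using Suc.prems
    by (simp add: kron_def kron_power_x_row mult_single)
qed

lemma border_row_dim: "border_row g j \<in> carrier_mat 1 (g ^ (j + 1))"
  by (auto simp: border_row_def kron_def kron_power_x_row h_row_def)

lemma border_row_entry:
  assumes "a < g ^ (j + 1)"
  shows "border_row g j $$ (0, a) = Poly_Mapping.single (bword g j a) 1"
proof -
  have "g > 0" using assms by (cases g) auto
  moreover have "a div g < g ^ j" using assms by (simp add: less_mult_imp_div_less mult.commute)
  moreover have "a < g ^ j * g" using assms by (simp add: mult.commute)
  ultimately show ?thesis
    by (simp add: border_row_def kron_def kron_power_x_row kron_power_x_row_entry bword_def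
        h_row_def nc_var_def mult_single)
qed

lemma border_vec_entry:
  assumes "a < g ^ (j + 1)"
  shows "border_vec g j $$ (a, 0) = Poly_Mapping.single (rev (bword g j a)) 1"
proof -
  have i: "nc_involution (Poly_Mapping.single w 1) = Poly_Mapping.single (rev w) 1" for w
    unfolding nc_involution_def using map_key_single[of rev "rev w" 1] by simp
  show ?thesis using border_row_dim[of g j] assms border_row_entry[OF assms]
    by (simp add: border_vec_def nc_mat_involution_def i)
qed

lemma border_vec_dim: "border_vec g j \<in> carrier_mat (g ^ (j + 1)) 1"
  using border_row_dim[of g j] by (auto simp: border_vec_def nc_mat_involution_def)

definition xwords :: "nat \<Rightarrow> var list set" where "xwords g = {w. set w \<subseteq> XVar ` {..<g}}"

lemma nc_polysD: "p \<in> nc_polys g \<Longrightarrow> lk p w \<noteq> 0 \<Longrightarrow> w \<in> xwords g"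
  unfolding nc_polys_def xwords_def by (simp add: in_keys_iff)

lemma xword_in: "a < g ^ j \<Longrightarrow> xword g j a \<in> xwords g \<and> length (xword g j a) = j"
proof (induction j arbitrary: a)
  case (Suc j)
  note digit_bounds[OF Suc.prems]
  then show ?case using Suc.IH[of "a mod g ^ j"] by (auto simp: xwords_def)
qed (auto simp: xwords_def)

lemma xword_inj: "a < g ^ j \<Longrightarrow> b < g ^ j \<Longrightarrow> xword g j a = xword g j b \<Longrightarrow> a = b"
proof (induction j arbitrary: a b)
  case (Suc j)
  have "xword g j (a mod g ^ j) = xword g j (b mod g ^ j)" and d: "a div g ^ j = b div g ^ j"
    using Suc.prems(3) by auto
  then have "a mod g ^ j = b mod g ^ j"
    by (intro Suc.IH digit_bounds(2) Suc.prems(1,2))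
  with d
  show ?case by (metis div_mult_mod_eq)
qed auto

lemma xword_surj: "w \<in> xwords g \<Longrightarrow> \<exists>a<g ^ length w. xword g (length w) a = w"
proof (induction w)
  case (Cons x w)
  then obtain i where x: "x = XVar i" "i < g" by (auto simp: xwords_def)
  from Cons obtain a where a: "a < g ^ length w" "xword g (length w) a = w" by (auto simp: xwords_def)
  have "i * g ^ length w + a < (i + 1) * g ^ length w" using a(1) by simp
  also have "\<dots> \<le> g * g ^ length w" using x(2) by (intro mult_right_mono) auto
  finally have "i * g ^ length w + a < g ^ length (x # w)" by simp
  moreover have "xword g (length (x # w)) (i * g ^ length w + a) = x # w" using a x by simp
  ultimately show ?case by blast
qed auto

lemma bword_obtain:
  assumes "w \<in> xwords g" "k < g"
  shows "\<exists>a<g ^ (length w + 1). bword g (length w) a = w @ [HVar k]"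
proof -
  from xword_surj[OF assms(1)] obtain a where a: "a < g ^ length w" "xword g (length w) a = w" by blast
  have "a * g + k < (a + 1) * g" using assms(2) by simp
  also have "\<dots> \<le> g ^ length w * g" using a(1) by (intro mult_right_mono) auto
  finally have "a * g + k < g ^ (length w + 1)" by (simp add: mult.commute)
  moreover have "bword g (length w) (a * g + k) = w @ [HVar k]" using a assms(2) by (simp add: bword_def)
  ultimately show ?thesis by blast
qed

lemma bword_form:
  assumes "a < g ^ (j + 1)"
  obtains w k where "w \<in> xwords g" "length w = j" "k < g" "bword g j a = w @ [HVar k]"
proof -
  have "g > 0" using assms by (cases g) auto
  moreover have "a div g < g ^ j" using assms by (simp add: less_mult_imp_div_less mult.commute)
  ultimately show ?thesis using that[of "xword g j (a div g)" "a mod g"] xword_in[of "a div g" g j]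
    by (simp add: bword_def)
qed

lemma bword_inj:
  assumes "a < g ^ (j + 1)" "b < g ^ (j + 1)" "bword g j a = bword g j b"
  shows "a = b"
proof -
  have "a div g < g ^ j" "b div g < g ^ j"
    using assms by (simp_all add: less_mult_imp_div_less mult.commute)
  with assms(3) xword_inj[of "a div g" g j "b div g"] have "a div g = b div g" "a mod g = b mod g"
    by (auto simp: bword_def)
  then show ?thesis by (metis div_mult_mod_eq)
qed

lemma xwords_prefix_unique:
  assumes "w @ HVar k # r = w' @ HVar k' # r'" "w \<in> xwords g" "w' \<in> xwords g"
  shows "w = w' \<and> k = k' \<and> r = r'"
proof -
  have f: "takeWhile (\<lambda>x. \<not> is_h x) (w @ HVar k # r) = w" if "w \<in> xwords g" for w k r
  proof -
    have "\<not> is_h x" if "x \<in> set w" for x using that \<open>w \<in> xwords g\<close> unfolding xwords_def by auto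
    then show ?thesis by (simp add: takeWhile_append2)
  qed
  have "w = w'" using f[OF assms(2)] f[OF assms(3)] assms(1) by metis
  then show ?thesis using assms(1) by simp
qed

lemma sandwich_unique:
  assumes eq: "bword g i a @ m @ rev (bword g j b) = bword g i' a' @ m' @ rev (bword g j' b')"
    and "m \<in> xwords g" "m' \<in> xwords g" "a < g ^ (i + 1)" "a' < g ^ (i' + 1)"
      "b < g ^ (j + 1)" "b' < g ^ (j' + 1)"
  shows "i = i' \<and> a = a' \<and> m = m' \<and> j = j' \<and> b = b'"
proof -
  obtain w k where w: "w \<in> xwords g" "length w = i" "bword g i a = w @ [HVar k]"
    using assms(4) by (elim bword_form)
  obtain w' k' where w': "w' \<in> xwords g" "length w' = i'" "bword g i' a' = w' @ [HVar k']"
    using assms(5) by (elim bword_form)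
  obtain u l where u: "u \<in> xwords g" "length u = j" "bword g j b = u @ [HVar l]"
    using assms(6) by (elim bword_form)
  obtain u' l' where u': "u' \<in> xwords g" "length u' = j'" "bword g j' b' = u' @ [HVar l']"
    using assms(7) by (elim bword_form)
  have 1: "w = w' \<and> k = k' \<and> m @ HVar l # rev u = m' @ HVar l' # rev u'"
    using eq unfolding w w' u u' by (intro xwords_prefix_unique[OF _ w(1) w'(1)]) auto
  then have 2: "m = m' \<and> l = l' \<and> rev u = rev u'"
    using xwords_prefix_unique[OF _ assms(2,3)] by blast
  show ?thesis using 1 2 w w' u u' bword_inj assms(4-7) by (metis rev_is_rev_conv)
qed

abbreviation (input) mid_sum :: "nat \<Rightarrow> nat \<Rightarrow> (nat \<Rightarrow> nat \<Rightarrow> ncpoly mat) \<Rightarrow> ncpoly" where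
  "mid_sum g n Z \<equiv> \<Sum>i\<le>n. \<Sum>j\<le>n. (border_row g i * Z i j * border_vec g j) $$ (0, 0)"

lemma mid_sum_expand:
  assumes "\<And>i j. Z i j \<in> carrier_mat (g ^ (i + 1)) (g ^ (j + 1))"
  shows "lk (mid_sum g n Z) k =
    (\<Sum>(i,j,a,b)\<in>(SIGMA i:{..n}. SIGMA j:{..n}. {..<g ^ (i + 1)} \<times> {..<g ^ (j + 1)}).
       lk (Poly_Mapping.single (bword g i a) 1 * Z i j $$ (a, b) * Poly_Mapping.single (rev (bword g j b)) 1) k)"
proof -
  have "(border_row g i * Z i j * border_vec g j) $$ (0, 0) =
     (\<Sum>a<g ^ (i + 1). \<Sum>b<g ^ (j + 1). Poly_Mapping.single (bword g i a) 1 * Z i j $$ (a, b)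
         * Poly_Mapping.single (rev (bword g j b)) 1)" for i j
  proof -
    have d: "dim_row (border_row g i) = 1" "dim_col (border_row g i) = g ^ (i + 1)"
      "dim_row (Z i j) = g ^ (i + 1)" "dim_col (Z i j) = g ^ (j + 1)"
      "dim_row (border_vec g j) = g ^ (j + 1)" "dim_col (border_vec g j) = 1"
      using border_row_dim[of g i] border_vec_dim[of g j] assms[of i j] by auto
    have "(border_row g i * Z i j * border_vec g j) $$ (0, 0) =
      (\<Sum>b<g ^ (j + 1). (\<Sum>a<g ^ (i + 1). border_row g i $$ (0, a) * Z i j $$ (a, b)) * border_vec g j $$ (b, 0))"
      using d by (simp add: scalar_prod_def atLeast0LessThan)
    also have "\<dots> = (\<Sum>b<g ^ (j + 1). \<Sum>a<g ^ (i + 1). Poly_Mapping.single (bword g i a) 1 * Z i j $$ (a, b)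
         * Poly_Mapping.single (rev (bword g j b)) 1)"
      unfolding sum_distrib_right
      by (intro sum.cong refl) (simp only: lessThan_iff border_row_entry border_vec_entry)
    finally show ?thesis by (subst sum.swap)
  qed
  then show ?thesis
    by (simp add: lookup_sum sum.cartesian_product sum.Sigma split_def del: power_Suc)
qed

lemma mid_sum_lookup:
  assumes Z: "\<And>i j. Z i j \<in> carrier_mat (g ^ (i + 1)) (g ^ (j + 1))"
      "\<And>i j. elements_mat (Z i j) \<subseteq> nc_polys g"
    and "i \<le> n" "j \<le> n" "a < g ^ (i + 1)" "b < g ^ (j + 1)" "m \<in> xwords g"
  shows "lk (mid_sum g n Z) (bword g i a @ m @ rev (bword g j b)) = lk (Z i j $$ (a, b)) m"
proof -
  let ?k = "bword g i a @ m @ rev (bword g j b)"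
  let ?S = "SIGMA i:{..n}. SIGMA j:{..n}. {..<g ^ (i + 1)} \<times> {..<g ^ (j + 1)}"
  let ?f = "\<lambda>(i,j,a,b). lk (Poly_Mapping.single (bword g i a) 1 * Z i j $$ (a, b) *
       Poly_Mapping.single (rev (bword g j b)) 1) ?k"
  have z: "?f x = 0" if x: "x \<in> ?S" "x \<noteq> (i,j,a,b)" for x
  proof (rule ccontr)
    assume n0: "?f x \<noteq> 0"
    obtain i' j' a' b' where e: "x = (i',j',a',b')" by (metis prod_cases4)
    from n0 obtain m' where m': "?k = bword g i' a' @ m' @ rev (bword g j' b')" "lk (Z i' j' $$ (a', b')) m' \<noteq> 0"
      unfolding e prod.case by (blast dest: lookup_monomial_sandwich_0)
    have "Z i' j' $$ (a', b') \<in> elements_mat (Z i' j')"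
      using x(1) Z(1)[of i' j'] unfolding e by (auto intro!: elements_matI)
    then have "m' \<in> xwords g" using nc_polysD[OF subsetD[OF Z(2)] m'(2)] by blast
    then show False using sandwich_unique[OF m'(1)] assms(5-7) x unfolding e by auto
  qed
  have "(i,j,a,b) \<in> ?S" using assms by auto
  then have "sum ?f ?S = sum ?f {(i,j,a,b)}"
    using z by (intro sum.mono_neutral_right) auto
  then show ?thesis
    unfolding mid_sum_expand[of Z, OF Z(1)] by (simp add: lookup_monomial_sandwich)
qed

lemma mid_sum_lookup_0:
  assumes Z: "\<And>i j. Z i j \<in> carrier_mat (g ^ (i + 1)) (g ^ (j + 1))"
      "\<And>i j. elements_mat (Z i j) \<subseteq> nc_polys g"
    and n0: "lk (mid_sum g n Z) k \<noteq> 0"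
  shows "\<exists>i j a b m. i \<le> n \<and> j \<le> n \<and> a < g ^ (i + 1) \<and> b < g ^ (j + 1) \<and> m \<in> xwords g \<and>
     k = bword g i a @ m @ rev (bword g j b)"
proof -
  from n0[unfolded mid_sum_expand[of Z, OF Z(1)]]
  obtain i j a b where x: "i \<le> n" "j \<le> n" "a < g ^ (i + 1)" "b < g ^ (j + 1)"
    and n: "lk (Poly_Mapping.single (bword g i a) 1 * Z i j $$ (a, b) *
       Poly_Mapping.single (rev (bword g j b)) 1) k \<noteq> 0"
    by (elim sum.not_neutral_contains_not_neutral) auto
  from lookup_monomial_sandwich_0[OF n] obtain m where m: "k = bword g i a @ m @ rev (bword g j b)"
    "lk (Z i j $$ (a, b)) m \<noteq> 0" by blast
  have "Z i j $$ (a, b) \<in> elements_mat (Z i j)"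
    using x Z(1)[of i j] by (auto intro!: elements_matI)
  then have "m \<in> xwords g" using nc_polysD[OF subsetD[OF Z(2)] m(2)] by blast
  then show ?thesis using x m by blast
qed

lemma hcount_two_split:
  assumes "hcount k = 2"
  shows "\<exists>w a m b u. k = w @ HVar a # m @ HVar b # u \<and> hcount w = 0 \<and> hcount m = 0 \<and> hcount u = 0"
proof -
  have f: "\<exists>w a r. k = w @ HVar a # r \<and> hcount w = 0 \<and> hcount r = n" if "hcount k = Suc n" for k n
  proof -
    from that obtain x xs where "filter is_h k = x # xs" "length xs = n"
      by (metis length_Suc_conv)
    then obtain us vs where "k = us @ x # vs" "\<forall>u\<in>set us. \<not> is_h u" "is_h x" "xs = filter is_h vs"
      by (auto simp: filter_eq_Cons_iff)
    moreover then obtain a where "x = HVar a" by (cases x) auto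
    ultimately show ?thesis using \<open>length xs = n\<close> by (auto simp: filter_empty_conv)
  qed
  from f[of k 1] assms obtain w a r where 1: "k = w @ HVar a # r" "hcount w = 0" "hcount r = 1" by auto
  from f[of r 0] 1 obtain m b u where "r = m @ HVar b # u" "hcount m = 0" "hcount u = 0" by auto
  with 1 show ?thesis by blast
qed

lemma xwords_if_hcount:
  assumes "hcount w = 0" "set (map to_x w) \<subseteq> XVar ` {..<g}"
  shows "w \<in> xwords g"
proof -
  have "x \<in> XVar ` {..<g}" if "x \<in> set w" for x
  proof (cases x)
    case (HVar j) then show ?thesis using assms(1) that by (auto simp: filter_empty_conv)
  next
    case (XVar j) then show ?thesis using assms(2) that by force
  qed
  then show ?thesis by (auto simp: xwords_def)
qed

lemma hessian_key_form:
  assumes p: "p \<in> nc_polys g" and n0: "lk (nc_hessian p) k \<noteq> 0"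
  shows "\<exists>i j a b m. i \<le> nc_degree p - 2 \<and> j \<le> nc_degree p - 2 \<and> a < g ^ (i + 1) \<and> b < g ^ (j + 1) \<and>
    m \<in> xwords g \<and> k = bword g i a @ m @ rev (bword g j b)"
proof -
  have h: "hcount k = 2" and key: "map to_x k \<in> Poly_Mapping.keys p"
    using n0 unfolding lookup_nc_hessian_word[OF p] by (auto simp: in_keys_iff split: if_splits)
  from hcount_two_split[OF h] obtain w c m l u where k: "k = w @ HVar c # m @ HVar l # u"
    and c: "hcount w = 0" "hcount m = 0" "hcount u = 0" by blast
  have len: "length k \<le> nc_degree p"
    using key unfolding nc_degree_def by (intro Max_ge) (auto intro!: image_eqI[of _ _ "map to_x k"])
  have s: "set (map to_x k) \<subseteq> XVar ` {..<g}" using key p unfolding nc_polys_def by blast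
  have x: "w \<in> xwords g" "m \<in> xwords g" "u \<in> xwords g"
    by (intro xwords_if_hcount c; use s in \<open>auto simp: k\<close>)+
  then have ru: "rev u \<in> xwords g" by (simp add: xwords_def)
  have cl: "c < g" "l < g" using s by (auto simp: k)
  from bword_obtain[OF x(1) cl(1)] obtain a where
    a: "a < g ^ (length w + 1)" "bword g (length w) a = w @ [HVar c]" by blast
  from bword_obtain[OF ru cl(2)] obtain b where
    b: "b < g ^ (length u + 1)" "bword g (length u) b = rev u @ [HVar l]" by auto
  have "k = bword g (length w) a @ m @ rev (bword g (length u) b)" using a b k by simp
  moreover have "length w \<le> nc_degree p - 2" "length u \<le> nc_degree p - 2" using len k by auto
  ultimately show ?thesis using a(1) b(1) x(2) by blast
qed

lemma middle_matrix_ex1: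
  assumes p: "p \<in> nc_polys g"
  shows "\<exists>!Z. is_middle_matrix g p Z"
proof -
  define n where "n = nc_degree p - 2"
  define q where "q i j a b = Abs_poly_mapping (\<lambda>m. if m \<in> xwords g then
      lk (nc_hessian p) (bword g i a @ m @ rev (bword g j b)) else 0)" for i j a b
  have q: "lk (q i j a b) m = (if m \<in> xwords g then
      lk (nc_hessian p) (bword g i a @ m @ rev (bword g j b)) else 0)" for i j a b m
  proof -
    have "finite ((\<lambda>m. bword g i a @ m @ rev (bword g j b)) -` Poly_Mapping.keys (nc_hessian p))"
      by (intro finite_vimageI) (auto intro: injI)
    then have "finite {m. (if m \<in> xwords g then
      lk (nc_hessian p) (bword g i a @ m @ rev (bword g j b)) else 0) \<noteq> 0}"
      by (rule rev_finite_subset) (auto simp: in_keys_iff)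
    then show ?thesis unfolding q_def by (simp add: Abs_poly_mapping_inverse)
  qed
  define Z where "Z i j = (if i > n \<or> j > n then 0\<^sub>m (g ^ (i + 1)) (g ^ (j + 1)) else
      mat (g ^ (i + 1)) (g ^ (j + 1)) (\<lambda>(a, b). q i j a b))" for i j
  have Zc: "Z i j \<in> carrier_mat (g ^ (i + 1)) (g ^ (j + 1))" for i j by (simp add: Z_def)
  have "q i j a b \<in> nc_polys g" for i j a b
    unfolding nc_polys_def by (auto simp: in_keys_iff q xwords_def split: if_splits)
  moreover have "0 \<in> nc_polys g" by (simp add: nc_polys_def)
  ultimately have Zp: "elements_mat (Z i j) \<subseteq> nc_polys g" for i j
    by (auto simp: Z_def elements_mat_def simp del: power_Suc)
  have "nc_hessian p = mid_sum g n Z"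
  proof (rule poly_mapping_eqI)
    fix k
    show "lk (nc_hessian p) k = lk (mid_sum g n Z) k"
    proof (cases "\<exists>i j a b m. i \<le> n \<and> j \<le> n \<and> a < g ^ (i + 1) \<and> b < g ^ (j + 1) \<and>
        m \<in> xwords g \<and> k = bword g i a @ m @ rev (bword g j b)")
      case True
      then obtain i j a b m where k: "i \<le> n" "j \<le> n" "a < g ^ (i + 1)" "b < g ^ (j + 1)"
        "m \<in> xwords g" "k = bword g i a @ m @ rev (bword g j b)" by blast
      show ?thesis unfolding k(6) mid_sum_lookup[of Z, OF Zc Zp k(1-5)]
        using k by (simp add: Z_def q del: power_Suc)
    next
      case False
      have "lk (nc_hessian p) k = 0"
        by (rule ccontr) (rule notE[OF False hessian_key_form[OF p, of k, folded n_def]])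
      moreover have "lk (mid_sum g n Z) k = 0"
        by (rule ccontr) (rule notE[OF False mid_sum_lookup_0[of Z g n k, OF Zc Zp]])
      ultimately show ?thesis by simp
    qed
  qed
  then have "is_middle_matrix g p Z"
    unfolding is_middle_matrix_def n_def[symmetric] using Zc Zp by (auto simp: Z_def)
  moreover have "Y = Z" if Y: "is_middle_matrix g p Y" for Y
  proof (intro ext)
    fix i j
    have Yc: "Y i j \<in> carrier_mat (g ^ (i + 1)) (g ^ (j + 1))" and Yp: "elements_mat (Y i j) \<subseteq> nc_polys g" for i j
      using Y unfolding is_middle_matrix_def by auto
    show "Y i j = Z i j"
    proof (cases "i > n \<or> j > n")
      case True
      then show ?thesis using Y unfolding is_middle_matrix_def n_def[symmetric] Z_def by auto
    next
      case False
      show ?thesis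
      proof (rule eq_matI)
        fix a b assume "a < dim_row (Z i j)" "b < dim_col (Z i j)"
        then have ab: "a < g ^ (i + 1)" "b < g ^ (j + 1)" using Zc[of i j] by auto
        have mem: "Y i j $$ (a, b) \<in> nc_polys g" "Z i j $$ (a, b) \<in> nc_polys g"
          using subsetD[OF Yp elements_matI[OF Yc ab refl]] subsetD[OF Zp elements_matI[OF Zc ab refl]]
          by blast+
        show "Y i j $$ (a, b) = Z i j $$ (a, b)"
        proof (rule poly_mapping_eqI)
          fix m
          show "lk (Y i j $$ (a, b)) m = lk (Z i j $$ (a, b)) m"
          proof (cases "m \<in> xwords g")
            case True
            have "mid_sum g n Y = mid_sum g n Z"
              using Y \<open>nc_hessian p = mid_sum g n Z\<close> unfolding is_middle_matrix_def n_def[symmetric] by metis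
            then show ?thesis
              using mid_sum_lookup[of Y, OF Yc Yp _ _ ab True, of n]
                mid_sum_lookup[of Z, OF Zc Zp _ _ ab True, of n] \<open>\<not> (i > n \<or> j > n)\<close>
              by (simp only: not_less de_Morgan_disj)
          next
            case False
            then show ?thesis using nc_polysD[OF mem(1)] nc_polysD[OF mem(2)] by metis
          qed
        qed
      qed (use Yc[of i j] Zc[of i j] in auto)
    qed
  qed
  ultimately show ?thesis by blast
qed

lemma is_middle_matrix_middle_matrix:
  "p \<in> nc_polys g \<Longrightarrow> is_middle_matrix g p (middle_matrix g p)"
  unfolding middle_matrix_def by (rule theI'[OF middle_matrix_ex1])

end

theory Submission
  imports Defs
begin

text \<open>Rows and columns of the scalar middle matrix are labelled by the nonempty words of length less
  than $d$, the degree of $p$, and the entry at $(v, w)$ is twice the coefficient in $p$ of $v$ followed by the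
  reversal of $w$: the matrix is a Hankel matrix, whose entries vanish when $|v| + |w| > d$.

  At most one negative eigenvalue means that the form $Q$ of the matrix is nonnegative on some
  hyperplane.  If $d \geq 3$, the words of length $d - 1$ span an isotropic space, which forces
  the hyperplane to be normal to a vector $u$ supported on the words of length one.  On such a
  hyperplane an isotropic vector is mapped to a multiple of $u$; testing this on single words gives
  $d \leq 4$ and $c(i j l k) = u_i A_{jl} u_k$, and testing it on the vectors
  $a \otimes e_k$ with $a \perp u$ gives the form of $Z_{01}$.  What remains of $Q$ on the
  hyperplane is the form of the matrix $E_1$.  Conversely these formulas turn $Q$ on the hyperplane
  into the form of $E_1$, and $Q$ cannot be nonnegative everywhere, since then all words of length
  $d - 1$ would lie in its kernel.\<close>

unbundle no inner_syntax

subsection \<open>Diagonalization of real symmetric matrices\<close>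

text \<open>A negative eigenvector is of little use when d \<ge> 3, since it need not be supported
  on the words of length one. The hyperplane on which Q is nonnegative can be moved, however; u is
  obtained as the normal of a suitable hyperplane and is not an eigenvector in general. A word of
  length d - 1 pairs to zero with every word of length at least two, so its image under the matrix
  lives on the words of length one, and one such image is nonzero because the degree is attained. A
  given hyperplane may contain no such word; a combination of two of them then takes its place. The
  four-letter formula has to precede the three-letter one, because it makes a \<otimes> e_k
  isotropic for a orthogonal to u. Terms of Q with a factor u . x vanish on the hyperplane, which is
  why y is unconstrained and Z_00 enters only through P Z_00 P.\<close>

lemma scalar_prod_adjoint:
  fixes A :: "'a::comm_semiring_0 mat"
  assumes "A \<in> carrier_mat n m" "x \<in> carrier_vec n" "y \<in> carrier_vec m"
  shows "x \<bullet> (A *\<^sub>v y) = (transpose_mat A *\<^sub>v x) \<bullet> y"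
  using assms transpose_vec_mult_scalar[OF assms(1,3,2)] by (simp add: comm_scalar_prod)

text \<open>A complex eigenvector exists by the fundamental theorem of algebra. Symmetry makes its
  eigenvalue real, so its real and imaginary parts are eigenvectors or zero, and a nonzero one is
  normalized.\<close>

lemma real_symmetric_unit_eigenvector:
  fixes A :: "real mat"
  assumes A: "A \<in> carrier_mat n n" and sym: "transpose_mat A = A" and n: "n > 0"
  shows "\<exists>v c. v \<in> carrier_vec n \<and> v \<bullet> v = 1 \<and> A *\<^sub>v v = c \<cdot>\<^sub>v v"
proof -
  let ?C = "map_mat complex_of_real A"
  have C: "?C \<in> carrier_mat n n" using A by simp
  have "degree (char_poly ?C) = n" using degree_monic_char_poly[OF C] by simp
  then have "\<not> constant (poly (char_poly ?C))" using n constant_degree[of "char_poly ?C"] by simp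
  then obtain z where "poly (char_poly ?C) z = 0" using fundamental_theorem_of_algebra by blast
  then have "eigenvalue ?C z" using eigenvalue_root_char_poly[OF C] by simp
  then obtain w where w: "w \<in> carrier_vec n" "w \<noteq> 0\<^sub>v n" "?C *\<^sub>v w = z \<cdot>\<^sub>v w"
    using C unfolding eigenvalue_def eigenvector_def by auto
  define x where "x = map_vec Re w"
  define y where "y = map_vec Im w"
  have xy: "x \<in> carrier_vec n" "y \<in> carrier_vec n" using w by (auto simp: x_def y_def)
  have e: "(\<Sum>j<n. of_real (A $$ (i,j)) * w $ j) = z * w $ i" if "i < n" for i
    using arg_cong[OF w(3), of "\<lambda>v. v $ i"] that A w(1)
    by (simp add: scalar_prod_def atLeast0LessThan)
  have ax: "A *\<^sub>v x = Re z \<cdot>\<^sub>v x - Im z \<cdot>\<^sub>v y"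
  proof (rule eq_vecI)
    fix i assume "i < dim_vec (Re z \<cdot>\<^sub>v x - Im z \<cdot>\<^sub>v y)"
    then have i: "i < n" using xy by simp
    then show "(A *\<^sub>v x) $ i = (Re z \<cdot>\<^sub>v x - Im z \<cdot>\<^sub>v y) $ i"
      using arg_cong[OF e[OF i], of Re] A w(1)
      by (simp add: scalar_prod_def atLeast0LessThan x_def y_def)
  qed (use A xy in auto)
  have ay: "A *\<^sub>v y = Im z \<cdot>\<^sub>v x + Re z \<cdot>\<^sub>v y"
  proof (rule eq_vecI)
    fix i assume "i < dim_vec (Im z \<cdot>\<^sub>v x + Re z \<cdot>\<^sub>v y)"
    then have i: "i < n" using xy by simp
    then show "(A *\<^sub>v y) $ i = (Im z \<cdot>\<^sub>v x + Re z \<cdot>\<^sub>v y) $ i"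
      using arg_cong[OF e[OF i], of Im] A w(1)
      by (simp add: scalar_prod_def atLeast0LessThan x_def y_def algebra_simps)
  qed (use A xy in auto)
  \<comment> \<open>With w = x + i y, the two sides differ, up to sign, by Im z times x . x + y . y,
    which is positive because w is nonzero.\<close>
  have "y \<bullet> (A *\<^sub>v x) = (A *\<^sub>v y) \<bullet> x" using scalar_prod_adjoint[OF A xy(2,1)] sym by simp
  then have "Im z * (x \<bullet> x + y \<bullet> y) = 0"
    unfolding ax ay using xy
    by (simp add: scalar_prod_minus_distrib[of _ n] add_scalar_prod_distrib[of _ n]
        comm_scalar_prod[of x n y] algebra_simps)
  moreover have nz: "x \<noteq> 0\<^sub>v n \<or> y \<noteq> 0\<^sub>v n"
  proof (rule ccontr)
    assume "\<not> ?thesis"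
    then have "\<And>i. i < n \<Longrightarrow> x $ i = 0 \<and> y $ i = 0" by simp
    then have "\<And>i. i < n \<Longrightarrow> w $ i = 0" using w(1) by (simp add: x_def y_def complex_eq_iff)
    then show False using w(1,2) by auto
  qed
  moreover have "x \<bullet> x \<ge> 0" "y \<bullet> y \<ge> 0" "x \<noteq> 0\<^sub>v n \<Longrightarrow> x \<bullet> x > 0" "y \<noteq> 0\<^sub>v n \<Longrightarrow> y \<bullet> y > 0"
    using conjugate_square_greater_0_vec[OF xy(1)] conjugate_square_greater_0_vec[OF xy(2)]
      conjugate_square_ge_0_vec[of x] conjugate_square_ge_0_vec[of y] by simp_all
  ultimately have "Im z = 0" by (metis add_nonneg_pos add_pos_nonneg less_irrefl mult_eq_0_iff)
  then have ev: "A *\<^sub>v x = Re z \<cdot>\<^sub>v x" "A *\<^sub>v y = Re z \<cdot>\<^sub>v y" unfolding ax ay using xy by auto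
  obtain q where q: "q \<in> carrier_vec n" "q \<bullet> q > 0" "A *\<^sub>v q = Re z \<cdot>\<^sub>v q"
    using nz ev xy \<open>x \<noteq> 0\<^sub>v n \<Longrightarrow> x \<bullet> x > 0\<close> \<open>y \<noteq> 0\<^sub>v n \<Longrightarrow> y \<bullet> y > 0\<close> by blast
  define s where "s = 1 / sqrt (q \<bullet> q)"
  have "s * s * (q \<bullet> q) = 1" using q(2) by (simp add: s_def)
  then have "(s \<cdot>\<^sub>v q) \<bullet> (s \<cdot>\<^sub>v q) = 1" using q(1) by simp
  moreover have "A *\<^sub>v (s \<cdot>\<^sub>v q) = Re z \<cdot>\<^sub>v (s \<cdot>\<^sub>v q)"
    using q A by (simp add: mult_mat_vec smult_smult_assoc mult.commute)
  ultimately show ?thesis using q(1) by (intro exI[of _ "s \<cdot>\<^sub>v q"] exI[of _ "Re z"]) auto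
qed

text \<open>The reflection in the hyperplane orthogonal to v - e_0 exchanges the unit vectors e_0
  and v. It is an explicit orthogonal matrix with first column v, so no orthonormal basis has to be
  completed.\<close>

lemma householder:
  fixes v :: "real vec"
  assumes v: "v \<in> carrier_vec n" "v \<bullet> v = 1" and n: "n > 0"
  shows "\<exists>H. H \<in> carrier_mat n n \<and> transpose_mat H = H \<and> H * H = 1\<^sub>m n \<and> H *\<^sub>v unit_vec n 0 = v"
proof (cases "v = unit_vec n 0")
  case True
  then show ?thesis by (intro exI[of _ "1\<^sub>m n"]) auto
next
  case False
  define w where "w = v - unit_vec n 0"
  have w: "w \<in> carrier_vec n" using v by (simp add: w_def)
  define s where "s = w \<bullet> w"
  have "w \<noteq> 0\<^sub>v n" using False v unfolding w_def
    by (metis add.left_neutral carrier_vecD index_unit_vec(3) left_zero_vec minus_add_minus_vec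
        minus_cancel_vec minus_zero_vec unit_vec_carrier vec_eq_iff index_minus_vec(1) index_zero_vec(1)
        eq_iff_diff_eq_0)
  then have s: "s > 0" using conjugate_square_greater_0_vec[OF w] by (simp add: s_def)
  define H where "H = mat n n (\<lambda>(i,j). (if i = j then 1 else 0) - 2 / s * w $ i * w $ j)"
  have ss: "(\<Sum>k<n. w $ k * w $ k) = s" using w by (simp add: s_def scalar_prod_def atLeast0LessThan)
  have "H * H = 1\<^sub>m n"
  proof (rule eq_matI)
    fix i j assume "i < dim_row (1\<^sub>m n :: real mat)" "j < dim_col (1\<^sub>m n :: real mat)"
    then have ij: "i < n" "j < n" by auto
    have "(H * H) $$ (i,j) = (\<Sum>k<n. ((if i = k then 1 else 0) - 2 / s * w $ i * w $ k) *
        ((if k = j then 1 else 0) - 2 / s * w $ k * w $ j))"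
      using ij by (simp add: H_def scalar_prod_def atLeast0LessThan)
    also have "\<dots> = (\<Sum>k<n. (if i = k then (if i = j then 1 else 0) - 2 / s * w $ i * w $ j else 0)
        - (if k = j then 2 / s * w $ i * w $ j else 0) + (2 / s * 2 / s * w $ i * w $ j) * (w $ k * w $ k))"
      by (intro sum.cong) (auto simp: algebra_simps)
    also have "\<dots> = (if i = j then 1 else 0) - 2 / s * w $ i * w $ j - 2 / s * w $ i * w $ j
        + 2 / s * 2 / s * w $ i * w $ j * s"
      using ij by (simp add: sum.distrib sum_subtractf ss del: times_divide_eq_left flip: sum_distrib_left)
    also have "\<dots> = 1\<^sub>m n $$ (i,j)" using s ij by simp
    finally show "(H * H) $$ (i,j) = 1\<^sub>m n $$ (i,j)" .
  qed (simp_all add: H_def)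
  moreover have "H *\<^sub>v unit_vec n 0 = v"
  proof (rule eq_vecI)
    fix i assume "i < dim_vec v"
    then have i: "i < n" using v by simp
    have "s = v \<bullet> v - 2 * v $ 0 + 1"
      using v n unfolding s_def w_def
      by (simp add: minus_scalar_prod_distrib[of _ n] scalar_prod_minus_distrib[of _ n])
    \<comment> \<open>Since v and e_0 are unit vectors, s = 2 - 2 v_0 = - 2 w_0, so the factor 2 / s
      * w_0 below equals -1.\<close>
    then have s2: "s = - 2 * w $ 0" using v n by (simp add: w_def)
    have "(H *\<^sub>v unit_vec n 0) $ i = H $$ (i, 0)" using i n by (simp add: H_def)
    also have "\<dots> = (if i = 0 then 1 else 0) - 2 / s * w $ i * w $ 0" using i n by (simp add: H_def)
    also have "\<dots> = (if i = 0 then 1 else 0) + w $ i" using s unfolding s2 by (simp add: field_simps)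
    also have "\<dots> = v $ i" using i v n by (simp add: w_def)
    finally show "(H *\<^sub>v unit_vec n 0) $ i = v $ i" .
  qed (use v in \<open>simp add: H_def\<close>)
  moreover have "transpose_mat H = H" by (rule eq_matI) (auto simp: H_def)
  ultimately show ?thesis by (intro exI[of _ H]) (simp add: H_def)
qed

text \<open>Induction by deflation: in a basis that begins with a unit eigenvector a 1 by 1 block
  splits off, and the Householder matrix provides such a basis.\<close>

lemma real_symmetric_diagonalization:
  fixes A :: "real mat"
  assumes "A \<in> carrier_mat n n" "transpose_mat A = A"
  shows "\<exists>P d. P \<in> carrier_mat n n \<and> transpose_mat P * P = 1\<^sub>m n \<and>
    transpose_mat P * A * P = mat n n (\<lambda>(i,j). if i = j then d i else 0)"
  using assms
proof (induction n arbitrary: A)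
  case 0
  then show ?case by (intro exI[of _ "1\<^sub>m 0"]) (auto intro!: eq_matI)
next
  case (Suc n)
  note A = Suc.prems(1) and sym = Suc.prems(2)
  obtain v c where v: "v \<in> carrier_vec (Suc n)" "v \<bullet> v = 1" "A *\<^sub>v v = c \<cdot>\<^sub>v v"
    using real_symmetric_unit_eigenvector[OF A sym] by auto
  obtain H where H: "H \<in> carrier_mat (Suc n) (Suc n)" "transpose_mat H = H" "H * H = 1\<^sub>m (Suc n)"
    "H *\<^sub>v unit_vec (Suc n) 0 = v" using householder[OF v(1,2)] by auto
  define B where "B = H * A * H"
  have B: "B \<in> carrier_mat (Suc n) (Suc n)" using H A by (simp add: B_def)
  have Bsym: "transpose_mat B = B"
    unfolding B_def using H A sym by (simp add: transpose_mult[of _ "Suc n" "Suc n" _ "Suc n"] assoc_mult_mat[of _ "Suc n" "Suc n" _ "Suc n" _ "Suc n"])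
  have "B *\<^sub>v unit_vec (Suc n) 0 = H *\<^sub>v (A *\<^sub>v v)"
    unfolding B_def using H A by (simp add: assoc_mult_mat_vec[of _ "Suc n" "Suc n" _ "Suc n"])
  also have "\<dots> = c \<cdot>\<^sub>v (H *\<^sub>v v)" using v H by (simp add: mult_mat_vec)
  also have "H *\<^sub>v v = H * H *\<^sub>v unit_vec (Suc n) 0"
    using H(1,4) by (simp add: assoc_mult_mat_vec[of _ "Suc n" "Suc n" _ "Suc n"])
  also have "\<dots> = unit_vec (Suc n) 0" using H by simp
  finally have Bc: "B *\<^sub>v unit_vec (Suc n) 0 = c \<cdot>\<^sub>v unit_vec (Suc n) 0" .
  have B0: "B $$ (i, 0) = (if i = 0 then c else 0)" if "i < Suc n" for i
    using arg_cong[OF Bc, of "\<lambda>v. v $ i"] that B by simp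
  have B0': "B $$ (0, i) = (if i = 0 then c else 0)" if "i < Suc n" for i
    using B0[OF that] arg_cong[OF Bsym, of "\<lambda>M. M $$ (i, 0)"] that B by simp
  define B3 where "B3 = mat n n (\<lambda>(i,j). B $$ (Suc i, Suc j))"
  have B3: "B3 \<in> carrier_mat n n" by (simp add: B3_def)
  have "transpose_mat B3 = B3"
  proof (rule eq_matI)
    fix i j assume "i < dim_row B3" "j < dim_col B3"
    then show "transpose_mat B3 $$ (i, j) = B3 $$ (i, j)"
      using arg_cong[OF Bsym, of "\<lambda>M. M $$ (Suc i, Suc j)"] B by (simp add: B3_def)
  qed (simp_all add: B3_def)
  from Suc.IH[OF B3 this] obtain P3 d3 where P3: "P3 \<in> carrier_mat n n" "transpose_mat P3 * P3 = 1\<^sub>m n"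
    "transpose_mat P3 * B3 * P3 = mat n n (\<lambda>(i,j). if i = j then d3 i else 0)" by blast
  \<comment> \<open>The eigenvector equation determines column 0, and symmetry then row 0.\<close>
  have Bf: "B = four_block_mat (mat 1 1 (\<lambda>_. c)) (0\<^sub>m 1 n) (0\<^sub>m n 1) B3"
    by (rule eq_matI) (use B B0 B0' in \<open>auto simp: B3_def not_less less_Suc_eq_0_disj\<close>)
  define R where "R = four_block_mat (1\<^sub>m 1) (0\<^sub>m 1 n) (0\<^sub>m n 1) P3"
  have Rt: "transpose_mat R = four_block_mat (1\<^sub>m 1) (0\<^sub>m 1 n) (0\<^sub>m n 1) (transpose_mat P3)"
    unfolding R_def using P3 by (subst transpose_four_block_mat[of _ 1 1 _ n _ n]) auto
  have R: "R \<in> carrier_mat (Suc n) (Suc n)" using P3 by (auto simp: R_def)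
  have RR: "transpose_mat R * R = 1\<^sub>m (Suc n)"
    unfolding Rt unfolding R_def using P3
    by (subst mult_four_block_mat[of _ 1 1 _ n _ n _ _ 1 _ n]) (auto intro!: eq_matI)
  have RBR: "transpose_mat R * B * R = four_block_mat (mat 1 1 (\<lambda>_. c)) (0\<^sub>m 1 n) (0\<^sub>m n 1)
      (transpose_mat P3 * B3 * P3)"
    unfolding Rt unfolding R_def Bf using P3 B3
    by (subst mult_four_block_mat[of _ 1 1 _ n _ n _ _ 1 _ n], simp_all)
      (subst mult_four_block_mat[of _ 1 1 _ n _ n _ _ 1 _ n], simp_all)
  let ?d = "\<lambda>i. if i = 0 then c else d3 (i - 1)"
  have "transpose_mat (H * R) * (H * R) = transpose_mat R * (H * H) * R"
    using H(1,2) R by (simp add: transpose_mult[of _ "Suc n" "Suc n" _ "Suc n"] assoc_mult_mat[of _ "Suc n" "Suc n" _ "Suc n" _ "Suc n"] )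
  then have 1: "transpose_mat (H * R) * (H * R) = 1\<^sub>m (Suc n)" using H RR R by simp
  have "transpose_mat (H * R) * A * (H * R) = transpose_mat R * B * R"
    unfolding B_def using H R A by (simp add: transpose_mult[of _ "Suc n" "Suc n" _ "Suc n"] assoc_mult_mat[of _ "Suc n" "Suc n" _ "Suc n" _ "Suc n"])
  also have "\<dots> = mat (Suc n) (Suc n) (\<lambda>(i,j). if i = j then ?d i else 0)"
    unfolding RBR P3(3) by (rule eq_matI) (auto simp: not_less less_Suc_eq_0_disj split: if_splits)
  finally show ?case using 1 H R by (intro exI[of _ "H * R"] exI[of _ ?d]) simp
qed

section \<open>Counting negative eigenvalues by means of the quadratic form\<close>

lemma order_linear_prod_list:
  "Polynomial.order c (\<Prod>a\<leftarrow>xs. [:- a, 1:]) = count_list xs (c :: 'a::idom)"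
proof (induction xs)
  case (Cons a xs)
  have "(\<Prod>a\<leftarrow>xs. [:- a, 1:]) \<noteq> 0" by (auto simp: prod_list_zero_iff)
  then have "Polynomial.order c (\<Prod>a\<leftarrow>a # xs. [:- a, 1:]) =
      Polynomial.order c [:- a, 1:] + Polynomial.order c (\<Prod>a\<leftarrow>xs. [:- a, 1:])"
    unfolding list.map prod_list.Cons by (intro order_mult no_zero_divisors) auto
  moreover have "Polynomial.order c [:- a, 1:] = (if c = a then 1 else 0)"
    using order_power_n_n[of a 1] by (auto intro: order_0I)
  ultimately show ?case using Cons.IH by auto
qed simp

text \<open>Similarity preserves the characteristic polynomial, and that of a diagonal matrix splits
  into linear factors whose orders count repeated entries. This turns algebraic multiplicities into
  a count of diagonal positions.\<close>

lemma neg_eigenvalue_count_diagonal: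
  assumes A: "A \<in> carrier_mat n n" and P: "P \<in> carrier_mat n n" "transpose_mat P * P = 1\<^sub>m n"
    and D: "transpose_mat P * A * P = mat n n (\<lambda>(i,j). if i = j then d i else 0)"
  shows "neg_eigenvalue_count A = card {i. i < n \<and> d i < 0}"
proof -
  let ?D = "mat n n (\<lambda>(i,j). if i = j then d i else 0)"
  have PP: "P * transpose_mat P = 1\<^sub>m n"
    using mat_mult_left_right_inverse[of "transpose_mat P" n P] P by simp
  have "similar_mat_wit ?D A (transpose_mat P) P"
    using A P PP D by (intro similar_mat_witI[of _ _ n]) auto
  then have "char_poly A = char_poly ?D"
    using char_poly_similar[of ?D A] unfolding similar_mat_def by metis
  also have "\<dots> = (\<Prod>a\<leftarrow>map d [0..<n]. [:- a, 1:])"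
    by (subst char_poly_upper_triangular[of _ n])
      (auto simp: diag_mat_def intro!: arg_cong[of _ _ prod_list])
  finally have cp: "char_poly A = (\<Prod>a\<leftarrow>map d [0..<n]. [:- a, 1:])" .
  have ord: "Polynomial.order c (char_poly A) = card {i. i < n \<and> d i = c}" for c
  proof -
    have "count_list (map d [0..<n]) c = card {i. i < n \<and> d i = c}" for n
    proof (induction n)
      case (Suc n)
      have "{i. i < Suc n \<and> d i = c} = (if d n = c then insert n {i. i < n \<and> d i = c} else {i. i < n \<and> d i = c})"
        by (auto simp: less_Suc_eq)
      then show ?case using Suc by simp
    qed simp
    then show ?thesis unfolding cp order_linear_prod_list .
  qed
  have ev: "eigenvalue A c \<longleftrightarrow> (\<exists>i<n. d i = c)" for c
  proof -
    have "char_poly A \<noteq> 0" unfolding cp by (auto simp: prod_list_zero_iff)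
    then have "eigenvalue A c \<longleftrightarrow> Polynomial.order c (char_poly A) \<noteq> 0"
      unfolding eigenvalue_root_char_poly[OF A] order_root by simp
    then show ?thesis unfolding ord by auto
  qed
  have "neg_eigenvalue_count A = (\<Sum>c\<in>d ` {i. i < n \<and> d i < 0}. card {i. i < n \<and> d i = c})"
    unfolding neg_eigenvalue_count_def ord ev by (intro sum.cong) auto
  also have "\<dots> = card (\<Union>c\<in>d ` {i. i < n \<and> d i < 0}. {i. i < n \<and> d i = c})"
    by (subst card_UN_disjoint) auto
  also have "(\<Union>c\<in>d ` {i. i < n \<and> d i < 0}. {i. i < n \<and> d i = c}) = {i. i < n \<and> d i < 0}" by auto
  finally show ?thesis .
qed

lemma real_symmetric_eigenbasis:
  fixes A :: "real mat"
  assumes A: "A \<in> carrier_mat n n" and sym: "transpose_mat A = A"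
  obtains e d where "\<And>i. i < n \<Longrightarrow> e i \<in> carrier_vec n"
    "\<And>i j. i < n \<Longrightarrow> j < n \<Longrightarrow> e i \<bullet> e j = (if i = j then 1 else 0)"
    "\<And>i. i < n \<Longrightarrow> A *\<^sub>v e i = d i \<cdot>\<^sub>v e i"
    "\<And>x. x \<in> carrier_vec n \<Longrightarrow> x \<bullet> (A *\<^sub>v x) = (\<Sum>i<n. d i * (e i \<bullet> x)\<^sup>2)"
    "neg_eigenvalue_count A = card {i. i < n \<and> d i < 0}"
proof -
  obtain P d where P: "P \<in> carrier_mat n n" "transpose_mat P * P = 1\<^sub>m n"
    and D: "transpose_mat P * A * P = mat n n (\<lambda>(i,j). if i = j then d i else 0)" (is "_ = ?D")
    using real_symmetric_diagonalization[OF A sym] by blast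
  let ?T = "transpose_mat P"
  have T: "?T \<in> carrier_mat n n" using P by simp
  have PP: "P * ?T = 1\<^sub>m n"
    using mat_mult_left_right_inverse[of ?T n P] P by simp
  have "P * ?D = (P * ?T) * (A * P)" unfolding D[symmetric] using A P(1) T
    by (simp add: assoc_mult_mat[of _ n n _ n _ n])
  then have AP: "A * P = P * ?D" using A P unfolding PP by simp
  have "A = A * (P * ?T)" using A unfolding PP by simp
  also have "\<dots> = P * ?D * ?T" using A P(1) T AP by (simp flip: assoc_mult_mat[of _ n n _ n _ n])
  finally have APD: "A = P * ?D * ?T" .
  show ?thesis
  proof (rule that[of "col P" d])
    show "col P i \<in> carrier_vec n" if "i < n" for i using P that by auto
    show "col P i \<bullet> col P j = (if i = j then 1 else 0)" if "i < n" "j < n" for i j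
      using arg_cong[OF P(2), of "\<lambda>M. M $$ (i,j)"] P(1) that by simp
    show "A *\<^sub>v col P i = d i \<cdot>\<^sub>v col P i" if "i < n" for i
    proof (rule eq_vecI)
      fix k assume "k < dim_vec (d i \<cdot>\<^sub>v col P i)"
      then have k: "k < n" using P by simp
      have "(A *\<^sub>v col P i) $ k = (A * P) $$ (k, i)" using A P(1) k that by simp
      also have "\<dots> = (\<Sum>j<n. P $$ (k,j) * (if j = i then d j else 0))"
        unfolding AP using P(1) k that by (simp add: scalar_prod_def atLeast0LessThan)
      also have "\<dots> = (d i \<cdot>\<^sub>v col P i) $ k"
        using P(1) k that by (simp add: if_distrib[of "(*) _"] cong: if_cong)
      finally show "(A *\<^sub>v col P i) $ k = (d i \<cdot>\<^sub>v col P i) $ k" .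
    qed (use A P in simp)
    show "x \<bullet> (A *\<^sub>v x) = (\<Sum>i<n. d i * (col P i \<bullet> x)\<^sup>2)" if x: "x \<in> carrier_vec n" for x
    proof -
      define y where "y = ?T *\<^sub>v x"
      have y: "y \<in> carrier_vec n" using T x by (simp add: y_def)
      have "A *\<^sub>v x = P *\<^sub>v (?D *\<^sub>v y)"
        unfolding y_def by (subst APD) (use P(1) x T in \<open>simp add: assoc_mult_mat_vec[of _ n n _ n]\<close>)
      then have "x \<bullet> (A *\<^sub>v x) = y \<bullet> (?D *\<^sub>v y)"
        using scalar_prod_adjoint[OF P(1) x, of "?D *\<^sub>v y"] mult_mat_vec_carrier[of ?D n n y] y
        unfolding y_def[symmetric] by simp
      also have "\<dots> = (\<Sum>i<n. y $ i * (d i * y $ i))"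
        using y by (simp add: scalar_prod_def atLeast0LessThan if_distrib[of "\<lambda>t. t * _"] cong: if_cong)
      also have "\<dots> = (\<Sum>i<n. d i * (col P i \<bullet> x)\<^sup>2)"
        using P(1) by (intro sum.cong) (auto simp: y_def power2_eq_square)
      finally show ?thesis .
    qed
    show "neg_eigenvalue_count A = card {i. i < n \<and> d i < 0}"
      by (rule neg_eigenvalue_count_diagonal[OF A P D])
  qed
qed

lemma neg_eigenvalue_count_eq_0_iff:
  fixes A :: "real mat"
  assumes A: "A \<in> carrier_mat n n" and sym: "transpose_mat A = A"
  shows "neg_eigenvalue_count A = 0 \<longleftrightarrow> (\<forall>x\<in>carrier_vec n. x \<bullet> (A *\<^sub>v x) \<ge> 0)"
proof -
  obtain e d where e: "\<And>i. i < n \<Longrightarrow> e i \<in> carrier_vec n"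
    "\<And>i j. i < n \<Longrightarrow> j < n \<Longrightarrow> e i \<bullet> e j = (if i = j then 1 else 0)"
    "\<And>i. i < n \<Longrightarrow> A *\<^sub>v e i = d i \<cdot>\<^sub>v e i"
    and q: "\<And>x. x \<in> carrier_vec n \<Longrightarrow> x \<bullet> (A *\<^sub>v x) = (\<Sum>i<n. d i * (e i \<bullet> x)\<^sup>2)"
    and c: "neg_eigenvalue_count A = card {i. i < n \<and> d i < 0}"
    using real_symmetric_eigenbasis[OF A sym] by blast
  have "neg_eigenvalue_count A = 0 \<longleftrightarrow> (\<forall>i<n. d i \<ge> 0)" unfolding c by (auto simp: not_less[symmetric])
  also have "\<dots> \<longleftrightarrow> (\<forall>x\<in>carrier_vec n. x \<bullet> (A *\<^sub>v x) \<ge> 0)"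
  proof
    assume "\<forall>i<n. d i \<ge> 0"
    then show "\<forall>x\<in>carrier_vec n. x \<bullet> (A *\<^sub>v x) \<ge> 0" by (auto simp: q intro!: sum_nonneg)
  next
    assume pos: "\<forall>x\<in>carrier_vec n. x \<bullet> (A *\<^sub>v x) \<ge> 0"
    have "d i = e i \<bullet> (A *\<^sub>v e i)" if "i < n" for i using e that by simp
    then show "\<forall>i<n. d i \<ge> 0" using pos e(1) by metis
  qed
  finally show ?thesis .
qed

lemma neg_eigenvalue_count_1_imp:
  fixes A :: "real mat"
  assumes A: "A \<in> carrier_mat n n" and sym: "transpose_mat A = A" and "neg_eigenvalue_count A = 1"
  obtains u c where "u \<in> carrier_vec n" "u \<bullet> u = 1" "c < 0" "A *\<^sub>v u = c \<cdot>\<^sub>v u"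
    "\<And>x. x \<in> carrier_vec n \<Longrightarrow> u \<bullet> x = 0 \<Longrightarrow> x \<bullet> (A *\<^sub>v x) \<ge> 0"
proof -
  obtain e d where e: "\<And>i. i < n \<Longrightarrow> e i \<in> carrier_vec n"
    "\<And>i j. i < n \<Longrightarrow> j < n \<Longrightarrow> e i \<bullet> e j = (if i = j then 1 else 0)"
    "\<And>i. i < n \<Longrightarrow> A *\<^sub>v e i = d i \<cdot>\<^sub>v e i"
    and q: "\<And>x. x \<in> carrier_vec n \<Longrightarrow> x \<bullet> (A *\<^sub>v x) = (\<Sum>i<n. d i * (e i \<bullet> x)\<^sup>2)"
    and c: "neg_eigenvalue_count A = card {i. i < n \<and> d i < 0}"
    using real_symmetric_eigenbasis[OF A sym] by blast
  from c assms(3) obtain k where k: "{i. i < n \<and> d i < 0} = {k}" by (metis card_1_singletonE)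
  then have kn: "k < n" "d k < 0" by auto
  show ?thesis
  proof (rule that[of "e k" "d k"])
    fix x assume x: "x \<in> carrier_vec n" "e k \<bullet> x = 0"
    have "d i * (e i \<bullet> x)\<^sup>2 \<ge> 0" if "i < n" for i
    proof (cases "i = k")
      case True
      then show ?thesis using x by simp
    next
      case False
      then have "d i \<ge> 0" using k that by (metis (mono_tags, lifting) mem_Collect_eq not_less singletonD)
      then show ?thesis by simp
    qed
    then show "x \<bullet> (A *\<^sub>v x) \<ge> 0" unfolding q[OF x(1)] by (auto intro: sum_nonneg)
  qed (use e kn in auto)
qed

text \<open>Half of the min-max principle: two negative directions of an eigenbasis would span a
  plane, a plane meets the orthogonal complement of u in a nonzero vector, and the form is negative
  there. The vector z excludes the count zero.\<close>

lemma neg_eigenvalue_count_1I: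
  fixes A :: "real mat"
  assumes A: "A \<in> carrier_mat n n" and sym: "transpose_mat A = A" and u: "u \<in> carrier_vec n"
    and pos: "\<And>x. x \<in> carrier_vec n \<Longrightarrow> u \<bullet> x = 0 \<Longrightarrow> x \<bullet> (A *\<^sub>v x) \<ge> 0"
    and neg: "z \<in> carrier_vec n" "z \<bullet> (A *\<^sub>v z) < 0"
  shows "neg_eigenvalue_count A = 1"
proof -
  obtain e d where e: "\<And>i. i < n \<Longrightarrow> e i \<in> carrier_vec n"
    "\<And>i j. i < n \<Longrightarrow> j < n \<Longrightarrow> e i \<bullet> e j = (if i = j then 1 else 0)"
    "\<And>i. i < n \<Longrightarrow> A *\<^sub>v e i = d i \<cdot>\<^sub>v e i"
    and q: "\<And>x. x \<in> carrier_vec n \<Longrightarrow> x \<bullet> (A *\<^sub>v x) = (\<Sum>i<n. d i * (e i \<bullet> x)\<^sup>2)"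
    and c: "neg_eigenvalue_count A = card {i. i < n \<and> d i < 0}"
    using real_symmetric_eigenbasis[OF A sym] by blast
  have "k = l" if kl: "k < n" "d k < 0" "l < n" "d l < 0" for k l
  proof (rule ccontr)
    assume ne: "k \<noteq> l"
    \<comment> \<open>One linear equation in two unknowns, for a nonzero vector of the plane
      orthogonal to u.\<close>
    obtain a b where ab: "a * (u \<bullet> e k) + b * (u \<bullet> e l) = 0" "a \<noteq> 0 \<or> b \<noteq> 0"
    proof (cases "u \<bullet> e k = 0 \<and> u \<bullet> e l = 0")
      case True
      then show ?thesis using that[of 1 0] by simp
    next
      case False
      then show ?thesis using that[of "u \<bullet> e l" "- (u \<bullet> e k)"] by (auto simp: mult.commute)
    qed
    define x where "x = a \<cdot>\<^sub>v e k + b \<cdot>\<^sub>v e l"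
    have x: "x \<in> carrier_vec n" using e kl by (simp add: x_def)
    have ex: "e i \<bullet> x = (if i = k then a else 0) + (if i = l then b else 0)" if "i < n" for i
      unfolding x_def using e that kl
      by (simp add: scalar_prod_add_distrib[of _ n] scalar_prod_smult_distrib[of _ n])
    have "u \<bullet> x = 0" unfolding x_def using e u kl ab
      by (simp add: scalar_prod_add_distrib[of _ n] scalar_prod_smult_distrib[of _ n])
    from pos[OF x this] have "0 \<le> (\<Sum>i<n. d i * (e i \<bullet> x)\<^sup>2)" unfolding q[OF x] .
    also have "\<dots> = (\<Sum>i<n. (if i = k then d k * a\<^sup>2 else 0) + (if i = l then d l * b\<^sup>2 else 0))"
      using ne by (intro sum.cong) (auto simp: ex)
    also have "\<dots> = d k * a\<^sup>2 + d l * b\<^sup>2" using kl by (simp add: sum.distrib)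
    finally have "0 \<le> d k * a\<^sup>2 + d l * b\<^sup>2" .
    moreover have "d k * a\<^sup>2 \<le> 0" "d l * b\<^sup>2 \<le> 0" "a \<noteq> 0 \<Longrightarrow> d k * a\<^sup>2 < 0" "b \<noteq> 0 \<Longrightarrow> d l * b\<^sup>2 < 0"
      using kl by (simp_all add: mult_le_0_iff mult_neg_pos)
    ultimately show False using ab(2) by linarith
  qed
  then have "card {i. i < n \<and> d i < 0} \<le> 1" by (auto simp: card_le_Suc0_iff_eq)
  moreover have "neg_eigenvalue_count A \<noteq> 0"
    using neg_eigenvalue_count_eq_0_iff[OF A sym] neg by (metis not_less)
  ultimately show ?thesis unfolding c by linarith
qed

subsection \<open>Quadratic forms that are nonnegative on a hyperplane\<close>

text \<open>An arbitrary index set lets words, numbers and elements of a disjoint sum serve as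
  indices without being enumerated.\<close>

definition qform :: "'a set \<Rightarrow> ('a \<Rightarrow> 'a \<Rightarrow> real) \<Rightarrow> ('a \<Rightarrow> real) \<Rightarrow> real" where
  "qform S K f = (\<Sum>x\<in>S. \<Sum>y\<in>S. K x y * f x * f y)"

lemma qform_add_smult:
  assumes "\<And>x y. x \<in> S \<Longrightarrow> y \<in> S \<Longrightarrow> K x y = K y x"
  shows "qform S K (\<lambda>x. h x + t * f x) =
    qform S K h + 2 * t * (\<Sum>x\<in>S. h x * (\<Sum>y\<in>S. K x y * f y)) + t\<^sup>2 * qform S K f"
proof -
  have "(\<Sum>x\<in>S. \<Sum>y\<in>S. K x y * f x * h y) = (\<Sum>y\<in>S. \<Sum>x\<in>S. K x y * f x * h y)" by (rule sum.swap)
  also have "\<dots> = (\<Sum>x\<in>S. \<Sum>y\<in>S. K x y * h x * f y)"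
    using assms by (intro sum.cong refl) (simp add: mult_ac)
  finally have "(\<Sum>x\<in>S. \<Sum>y\<in>S. K x y * f x * h y) = (\<Sum>x\<in>S. \<Sum>y\<in>S. K x y * h x * f y)" .
  moreover have "qform S K (\<lambda>x. h x + t * f x) = qform S K h + t * (\<Sum>x\<in>S. \<Sum>y\<in>S. K x y * h x * f y)
      + t * (\<Sum>x\<in>S. \<Sum>y\<in>S. K x y * f x * h y) + t\<^sup>2 * qform S K f"
    by (simp add: qform_def sum_distrib_left algebra_simps power2_eq_square sum.distrib)
  ultimately show ?thesis by (simp add: sum_distrib_left mult_ac)
qed

text \<open>For h in the hyperplane, the form at h + t f is affine in t because f is isotropic;
  being nonnegative, it has slope 0, so h is orthogonal to the image of f. The image is thus
  orthogonal to the whole hyperplane and parallel to its normal. For n = 0 this says that f lies in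
  the kernel.\<close>

lemma isotropic_image_parallel:
  assumes "finite S" and sym: "\<And>x y. x \<in> S \<Longrightarrow> y \<in> S \<Longrightarrow> K x y = K y x"
    and pos: "\<And>f. (\<Sum>x\<in>S. n x * f x) = 0 \<Longrightarrow> qform S K f \<ge> 0"
    and nf: "(\<Sum>x\<in>S. n x * f x) = 0" and f0: "qform S K f = 0"
  shows "\<exists>c. \<forall>x\<in>S. (\<Sum>y\<in>S. K x y * f y) = c * n x"
proof -
  define F where "F x = (\<Sum>y\<in>S. K x y * f y)" for x
  have orth: "(\<Sum>x\<in>S. h x * F x) = 0" if h: "(\<Sum>x\<in>S. n x * h x) = 0" for h
  proof (rule ccontr)
    define b q where "b = (\<Sum>x\<in>S. h x * F x)" and "q = qform S K h"
    assume "(\<Sum>x\<in>S. h x * F x) \<noteq> 0"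
    then have b: "b \<noteq> 0" by (simp add: b_def)
    have "q + 2 * t * b \<ge> 0" for t
    proof -
      have "(\<Sum>x\<in>S. n x * (h x + t * f x)) = (\<Sum>x\<in>S. n x * h x) + t * (\<Sum>x\<in>S. n x * f x)"
        by (simp add: sum_distrib_left algebra_simps sum.distrib)
      then have "qform S K (\<lambda>x. h x + t * f x) \<ge> 0" using h nf by (intro pos) simp
      then show ?thesis using qform_add_smult[of S K h t f, OF sym] f0 unfolding F_def b_def q_def by simp
    qed
    \<comment> \<open>At this t the affine function takes the value -1.\<close>
    from this[of "- (q + 1) / (2 * b)"] b show False by (simp add: field_simps)
  qed
  define N where "N = (\<Sum>x\<in>S. n x * n x)"
  \<comment> \<open>The coefficient of the projection of F onto n; if N = 0, then n vanishes on S
    and any value would do.\<close>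
  define c where "c = (if N = 0 then 0 else (\<Sum>x\<in>S. n x * F x) / N)"
  have nz: "n x = 0" if "N = 0" "x \<in> S" for x
    using that sum_nonneg_eq_0_iff[OF \<open>finite S\<close>, of "\<lambda>x. n x * n x"] by (auto simp: N_def)
  have nh: "(\<Sum>x\<in>S. n x * (F x - c * n x)) = 0"
  proof (cases "N = 0")
    case True
    then show ?thesis using nz by simp
  next
    case False
    have "(\<Sum>x\<in>S. n x * (F x - c * n x)) = (\<Sum>x\<in>S. n x * F x) - c * N"
      by (simp add: N_def sum_distrib_left algebra_simps sum.distrib sum_subtractf)
    then show ?thesis using False by (simp add: c_def)
  qed
  \<comment> \<open>F - c n lies in the hyperplane, so it is orthogonal to F and to n, and hence to
    itself.\<close>
  have "(\<Sum>x\<in>S. (F x - c * n x) * (F x - c * n x)) =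
      (\<Sum>x\<in>S. (F x - c * n x) * F x) - c * (\<Sum>x\<in>S. n x * (F x - c * n x))"
    by (simp add: sum_distrib_left algebra_simps sum.distrib sum_subtractf)
  also have "\<dots> = 0" using orth[OF nh] nh by simp
  finally have "\<forall>x\<in>S. F x - c * n x = 0"
    using sum_nonneg_eq_0_iff[OF \<open>finite S\<close>, of "\<lambda>x. (F x - c * n x) * (F x - c * n x)"] by simp
  then show ?thesis unfolding F_def by (intro exI[of _ c]) simp
qed

text \<open>A combination of unit vectors placed at the points \<open>\<phi> i\<close>. For
  \<open>\<phi> j = [j, k]\<close> it is the vector a \<otimes> e_k.\<close>

definition comb :: "'i set \<Rightarrow> ('i \<Rightarrow> real) \<Rightarrow> ('i \<Rightarrow> 'a) \<Rightarrow> 'a \<Rightarrow> real" where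
  "comb I a \<phi> x = (\<Sum>i\<in>I. a i * of_bool (x = \<phi> i))"

lemma sum_comb:
  assumes "finite S" "\<phi> ` I \<subseteq> S"
  shows "(\<Sum>x\<in>S. h x * comb I a \<phi> x) = (\<Sum>i\<in>I. h (\<phi> i) * a i)"
proof -
  have "(\<Sum>x\<in>S. h x * comb I a \<phi> x) = (\<Sum>i\<in>I. \<Sum>x\<in>S. h x * (a i * of_bool (x = \<phi> i)))"
    unfolding comb_def sum_distrib_left by (rule sum.swap)
  also have "\<dots> = (\<Sum>i\<in>I. h (\<phi> i) * a i)"
    using assms by (intro sum.cong refl) (auto simp: of_bool_def if_distrib[of "(*) _"] cong: if_cong)
  finally show ?thesis .
qed

lemma qform_comb:
  assumes "finite S" "\<phi> ` I \<subseteq> S"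
  shows "qform S K (comb I a \<phi>) = qform I (\<lambda>i j. K (\<phi> i) (\<phi> j)) a"
proof -
  have "qform S K (comb I a \<phi>) = (\<Sum>x\<in>S. (\<Sum>y\<in>S. K x y * comb I a \<phi> y) * comb I a \<phi> x)"
    by (simp add: qform_def sum_distrib_left mult_ac)
  then show ?thesis unfolding sum_comb[OF assms] by (simp add: qform_def sum_distrib_left mult_ac)
qed

text \<open>In matrix notation K = e E e^T + u r^T + r u^T. The last two terms contribute twice the
  product of u . f and r . f, which vanishes on the hyperplane.\<close>

lemma qform_factor:
  assumes "\<And>x y. x \<in> S \<Longrightarrow> y \<in> S \<Longrightarrow>
      K x y = (\<Sum>s\<in>I. \<Sum>t\<in>I. E s t * e x s * e y t) + u x * r y + r x * u y"
    and uf: "(\<Sum>x\<in>S. u x * f x) = 0"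
  shows "qform S K f = qform I E (\<lambda>s. \<Sum>x\<in>S. e x s * f x)"
proof -
  have "qform S K f = (\<Sum>x\<in>S. \<Sum>y\<in>S. (\<Sum>s\<in>I. \<Sum>t\<in>I. E s t * e x s * e y t) * f x * f y)
      + (\<Sum>x\<in>S. \<Sum>y\<in>S. (u x * f x) * (r y * f y)) + (\<Sum>x\<in>S. \<Sum>y\<in>S. (r x * f x) * (u y * f y))"
    unfolding qform_def sum.distrib[symmetric]
    by (intro sum.cong refl) (simp only: assms(1) distrib_left distrib_right mult_ac)
  also have "\<dots> = (\<Sum>x\<in>S. \<Sum>y\<in>S. (\<Sum>s\<in>I. \<Sum>t\<in>I. E s t * e x s * e y t) * f x * f y)"
    using uf unfolding sum_product[symmetric] by simp
  also have "\<dots> = (\<Sum>x\<in>S. \<Sum>y\<in>S. \<Sum>s\<in>I. \<Sum>t\<in>I. E s t * (e x s * f x) * (e y t * f y))"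
    by (intro sum.cong refl) (simp add: sum_distrib_left mult_ac)
  also have "\<dots> = (\<Sum>x\<in>S. \<Sum>s\<in>I. \<Sum>y\<in>S. \<Sum>t\<in>I. E s t * (e x s * f x) * (e y t * f y))"
    by (rule sum.cong[OF refl], rule sum.swap)
  also have "\<dots> = (\<Sum>s\<in>I. \<Sum>x\<in>S. \<Sum>y\<in>S. \<Sum>t\<in>I. E s t * (e x s * f x) * (e y t * f y))"
    by (rule sum.swap)
  also have "\<dots> = (\<Sum>s\<in>I. \<Sum>x\<in>S. \<Sum>t\<in>I. \<Sum>y\<in>S. E s t * (e x s * f x) * (e y t * f y))"
    by (rule sum.cong[OF refl], rule sum.cong[OF refl], rule sum.swap)
  also have "\<dots> = (\<Sum>s\<in>I. \<Sum>t\<in>I. \<Sum>x\<in>S. \<Sum>y\<in>S. E s t * (e x s * f x) * (e y t * f y))"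
    by (rule sum.cong[OF refl], rule sum.swap)
  also have "\<dots> = qform I E (\<lambda>s. \<Sum>x\<in>S. e x s * f x)"
    unfolding qform_def by (intro sum.cong refl) (subst mult.assoc, subst sum_product, simp only: sum_distrib_left mult.assoc)
  finally show ?thesis .
qed

lemma vec_qform:
  assumes "A \<in> carrier_mat n n" "x \<in> carrier_vec n"
  shows "x \<bullet> (A *\<^sub>v x) = qform {..<n} (\<lambda>i j. A $$ (i, j)) (\<lambda>i. x $ i)"
  using assms by (simp add: qform_def scalar_prod_def atLeast0LessThan sum_distrib_left mult_ac)

lemma ball_carrier_vec: "(\<forall>x\<in>carrier_vec n. Q (\<lambda>i. x $ i)) \<longleftrightarrow> (\<forall>f. Q f)"
  if "\<And>f f'. (\<And>i. i < n \<Longrightarrow> f i = f' i) \<Longrightarrow> Q f = Q f'"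
proof
  assume *: "\<forall>x\<in>carrier_vec n. Q (\<lambda>i. x $ i)"
  show "\<forall>f. Q f"
  proof
    fix f
    have "Q (\<lambda>i. vec n f $ i)" using * by auto
    moreover have "Q (\<lambda>i. vec n f $ i) = Q f" by (rule that) simp
    ultimately show "Q f" by simp
  qed
qed simp

lemma psd_iff_qform:
  assumes A: "A \<in> carrier_mat n n"
  shows "psd A \<longleftrightarrow> (\<forall>i<n. \<forall>j<n. A $$ (i, j) = A $$ (j, i)) \<and> (\<forall>f. qform {..<n} (\<lambda>i j. A $$ (i, j)) f \<ge> 0)"
proof -
  have "transpose_mat A = A \<longleftrightarrow> (\<forall>i<n. \<forall>j<n. A $$ (i, j) = A $$ (j, i))"
    using A by (auto simp: mat_eq_iff)
  moreover have "(\<forall>x\<in>carrier_vec n. 0 \<le> x \<bullet> (A *\<^sub>v x)) \<longleftrightarrow>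
      (\<forall>x\<in>carrier_vec n. 0 \<le> qform {..<n} (\<lambda>i j. A $$ (i, j)) (\<lambda>i. x $ i))"
    using vec_qform[OF A] by auto
  moreover have "\<dots> \<longleftrightarrow> (\<forall>f. 0 \<le> qform {..<n} (\<lambda>i j. A $$ (i, j)) f)"
    by (rule ball_carrier_vec) (simp add: qform_def)
  ultimately show ?thesis using A unfolding psd_def by auto
qed

lemma qform_reindex:
  assumes "bij_betw \<psi> S T" "\<And>x y. x \<in> S \<Longrightarrow> y \<in> S \<Longrightarrow> L (\<psi> x) (\<psi> y) = K x y"
  shows "qform T L f = qform S K (\<lambda>x. f (\<psi> x))"
  unfolding qform_def using assms(2)
  by (simp flip: sum.reindex_bij_betw[OF assms(1)])

text \<open>Nonnegativity on a hyperplane allows at most one negative eigenvalue, and a negative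
  value excludes the count zero. The normal m is arbitrary rather than an eigenvector, which leaves
  room to move the hyperplane; the bijection replaces row numbers by labels.\<close>

lemma
  fixes A :: "real mat"
  assumes A: "A \<in> carrier_mat n n" and sym: "transpose_mat A = A"
    and \<psi>: "bij_betw \<psi> S {..<n}" and K: "\<And>x y. x \<in> S \<Longrightarrow> y \<in> S \<Longrightarrow> A $$ (\<psi> x, \<psi> y) = K x y"
  shows neg_eigenvalue_count_eq_0_qform: "neg_eigenvalue_count A = 0 \<longleftrightarrow> (\<forall>f. qform S K f \<ge> 0)"
    and neg_eigenvalue_count_eq_1_qform: "neg_eigenvalue_count A = 1 \<longleftrightarrow>
      (\<exists>m. \<forall>f. (\<Sum>x\<in>S. m x * f x) = 0 \<longrightarrow> qform S K f \<ge> 0) \<and> (\<exists>f. qform S K f < 0)"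
proof -
  have S: "\<psi> x < n" if "x \<in> S" for x using bij_betwE[OF \<psi>] that by auto
  define \<phi> where "\<phi> = inv_into S \<psi>"
  have \<phi>: "\<phi> (\<psi> x) = x" if "x \<in> S" for x
    using \<psi> that unfolding \<phi>_def by (meson bij_betw_def inv_into_f_f)
  have q: "x \<bullet> (A *\<^sub>v x) = qform S K (\<lambda>s. x $ \<psi> s)" if "x \<in> carrier_vec n" for x
    unfolding vec_qform[OF A that] using qform_reindex[where L = "\<lambda>i j. A $$ (i, j)", OF \<psi> K] .
  have q': "qform S K f = vec n (\<lambda>i. f (\<phi> i)) \<bullet> (A *\<^sub>v vec n (\<lambda>i. f (\<phi> i)))" for f
    by (subst q) (auto simp: qform_def \<phi> S)
  have ip: "x \<bullet> y = (\<Sum>s\<in>S. x $ \<psi> s * y $ \<psi> s)" if "y \<in> carrier_vec n" for x y :: "real vec"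
    using that sum.reindex_bij_betw[OF \<psi>, of "\<lambda>i. x $ i * y $ i"]
    by (simp add: scalar_prod_def atLeast0LessThan)
  show z: "neg_eigenvalue_count A = 0 \<longleftrightarrow> (\<forall>f. qform S K f \<ge> 0)"
  proof -
    have "(\<forall>x\<in>carrier_vec n. 0 \<le> x \<bullet> (A *\<^sub>v x)) \<longleftrightarrow> (\<forall>f. qform S K f \<ge> 0)"
    proof
      assume "\<forall>x\<in>carrier_vec n. 0 \<le> x \<bullet> (A *\<^sub>v x)"
      then show "\<forall>f. qform S K f \<ge> 0" unfolding q' by simp
    qed (use q in simp)
    then show ?thesis unfolding neg_eigenvalue_count_eq_0_iff[OF A sym] .
  qed
  show "neg_eigenvalue_count A = 1 \<longleftrightarrow>
      (\<exists>m. \<forall>f. (\<Sum>x\<in>S. m x * f x) = 0 \<longrightarrow> qform S K f \<ge> 0) \<and> (\<exists>f. qform S K f < 0)" (is "?L \<longleftrightarrow> ?R")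
  proof
    assume c1: ?L
    then obtain u where u: "u \<in> carrier_vec n"
      "\<And>x. x \<in> carrier_vec n \<Longrightarrow> u \<bullet> x = 0 \<Longrightarrow> x \<bullet> (A *\<^sub>v x) \<ge> 0"
      using neg_eigenvalue_count_1_imp[OF A sym] by metis
    have "qform S K f \<ge> 0" if "(\<Sum>s\<in>S. u $ \<psi> s * f s) = 0" for f
      unfolding q' using that S \<phi> by (intro u(2)) (auto simp: ip)
    moreover have "\<exists>f. qform S K f < 0" using c1 z by (auto simp: not_le)
    ultimately show ?R by (intro conjI exI[where P = "\<lambda>m. \<forall>f. (\<Sum>x\<in>S. m x * f x) = 0 \<longrightarrow> _ f", of "\<lambda>s. u $ \<psi> s"] allI impI)
  next
    assume ?R
    then obtain m f where m: "\<And>f. (\<Sum>x\<in>S. m x * f x) = 0 \<Longrightarrow> qform S K f \<ge> 0"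
      and f: "qform S K f < 0" by blast
    show ?L
    proof (rule neg_eigenvalue_count_1I[OF A sym])
      show "vec n (\<lambda>i. f (\<phi> i)) \<bullet> (A *\<^sub>v vec n (\<lambda>i. f (\<phi> i))) < 0" using f unfolding q' .
      show "x \<bullet> (A *\<^sub>v x) \<ge> 0" if "x \<in> carrier_vec n" "vec n (\<lambda>i. m (\<phi> i)) \<bullet> x = 0" for x
        unfolding q[OF that(1)] using that S \<phi> by (intro m) (auto simp: ip)
    qed auto
  qed
qed

subsection \<open>Truncated Hankel forms on words\<close>

text \<open>What the argument retains of p: \<open>c\<close> stands for its doubled coefficients,
  which are invariant under reversal by symmetry of p, vanish above the degree, and do not all
  vanish in the degree itself.\<close>

locale truncated_hankel =
  fixes g d :: nat and c :: "nat list \<Rightarrow> real"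
  assumes c_rev: "c (rev w) = c w"
    and c_long: "d < length w \<Longrightarrow> c w = 0"
    and c_top: "\<exists>w. set w \<subseteq> {..<g} \<and> length w = d \<and> c w \<noteq> 0"
    and d_ge_2: "d \<ge> 2"
begin

definition W :: "nat list set" where
  "W = {w. w \<noteq> [] \<and> length w < d \<and> set w \<subseteq> {..<g}}"

definition K :: "nat list \<Rightarrow> nat list \<Rightarrow> real" where
  "K v w = c (v @ rev w)"

text \<open>For x orthogonal to u this is the form of E_1 at (x, b): the constraint on x takes the
  place of the projection P.\<close>

definition block_form :: "(nat \<Rightarrow> nat \<Rightarrow> real) \<Rightarrow> (nat \<Rightarrow> nat \<Rightarrow> real) \<Rightarrow> (nat \<Rightarrow> real) \<Rightarrow> (nat \<Rightarrow> real) \<Rightarrow> real" where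
  "block_form V A x b = (\<Sum>i<g. \<Sum>j<g. c [i, j] * x i * x j) + 2 * (\<Sum>k<g. \<Sum>i<g. V k i * b k * x i)
     + (\<Sum>k<g. \<Sum>l<g. A k l * b k * b l)"

text \<open>\<open>V\<close> stands for $\mathrm{mat}_g v$.  The last two indices of a word are
  reversed against the column index: $Z_{01}$ has the entry \<open>c [i, k, j]\<close> in row \<open>i\<close>
  and column \<open>j * g + k\<close>.\<close>

definition structured :: "(nat \<Rightarrow> real) \<Rightarrow> (nat \<Rightarrow> real) \<Rightarrow> (nat \<Rightarrow> nat \<Rightarrow> real) \<Rightarrow> (nat \<Rightarrow> nat \<Rightarrow> real) \<Rightarrow> bool" where
  "structured u y V A \<longleftrightarrow> d \<le> 4 \<and> (\<Sum>i<g. u i * u i) = 1 \<and> (\<forall>k<g. (\<Sum>j<g. V k j * u j) = 0) \<and>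
     (\<forall>i<g. \<forall>k<g. \<forall>j<g. c [i, k, j] = u i * u j * y k + u i * V k j + u j * V k i) \<and>
     (\<forall>i<g. \<forall>j<g. \<forall>l<g. \<forall>k<g. c [i, j, l, k] = u i * A j l * u k) \<and>
     (\<forall>j<g. \<forall>l<g. A j l = A l j) \<and>
     (\<forall>x b. (\<Sum>i<g. u i * x i) = 0 \<longrightarrow> block_form V A x b \<ge> 0)"

lemma finite_W: "finite W"
  by (rule finite_subset[OF _ finite_lists_length_le[of "{..<g}" d]]) (auto simp: W_def)

lemma K_sym: "K v w = K w v"
  using c_rev[of "v @ rev w"] by (simp add: K_def)

lemma K_eq_0: "d < length v + length w \<Longrightarrow> K v w = 0"
  unfolding K_def by (rule c_long) simp

lemma Cons_in_W: "[i] \<in> W \<longleftrightarrow> i < g"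
  using d_ge_2 by (auto simp: W_def)

lemma Cons2_in_W: "d \<ge> 3 \<Longrightarrow> [i, j] \<in> W \<longleftrightarrow> i < g \<and> j < g"
  by (auto simp: W_def)

lemma Cons3_in_W: "d \<ge> 4 \<Longrightarrow> [i, j, k] \<in> W \<longleftrightarrow> i < g \<and> j < g \<and> k < g"
  by (auto simp: W_def)

lemma sum_W_length_1:
  assumes "\<And>w. w \<in> W \<Longrightarrow> length w \<noteq> 1 \<Longrightarrow> h w = 0"
  shows "(\<Sum>w\<in>W. h w) = (\<Sum>i<g. h [i])"
proof -
  have "(\<Sum>w\<in>W. h w) = (\<Sum>w\<in>(\<lambda>i. [i]) ` {..<g}. h w)"
  proof (intro sum.mono_neutral_right ballI)
    fix w assume w: "w \<in> W - (\<lambda>i. [i]) ` {..<g}"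
    then show "h w = 0" by (intro assms) (auto simp: length_Suc_conv Cons_in_W)
  qed (auto simp: finite_W Cons_in_W)
  then show ?thesis by (simp add: sum.reindex inj_on_def)
qed

text \<open>The leading coefficients fill the block Z_{0,d-2}: cutting a word of length d after its
  first letter gives an entry there. The arguments about the degree start from this nonzero
  entry.\<close>

lemma top_word:
  obtains i w where "i < g" "w \<in> W" "length w = d - 1" "K [i] w \<noteq> 0"
proof -
  obtain v where v: "set v \<subseteq> {..<g}" "length v = d" "c v \<noteq> 0" using c_top by blast
  with d_ge_2 obtain i v' where v': "v = i # v'" by (cases v) auto
  show ?thesis
    by (rule that[of i "rev v'"]) (use v v' d_ge_2 in \<open>auto simp: W_def K_def\<close>)
qed

definition delta :: "nat list \<Rightarrow> nat list \<Rightarrow> real" where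
  "delta w v = of_bool (v = w)"

lemma sum_delta_W: "w \<in> W \<Longrightarrow> (\<Sum>v\<in>W. h v * delta w v) = h w"
  using finite_W by (simp add: delta_def of_bool_def if_distrib[of "(*) _"] cong: if_cong)

lemma qform_delta:
  assumes "w \<in> W"
  shows "qform W K (delta w) = K w w"
proof -
  have "qform W K (delta w) = (\<Sum>x\<in>W. (\<Sum>y\<in>W. K x y * delta w y) * delta w x)"
    unfolding qform_def sum_distrib_right by (intro sum.cong refl) (simp add: mult_ac)
  then show ?thesis using assms by (simp only: sum_delta_W)
qed

text \<open>If the normal vector does not vanish on the words of length \<open>d - 1\<close>, then a
  hyperplane with the required support is the orthogonal complement of the image of one such word
  \<open>w1\<close>: any vector in it can be moved along the isotropic \<open>delta w1\<close> into the original
  hyperplane without changing the form.\<close>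

lemma hyperplane_support:
  assumes d3: "d \<ge> 3" and pos: "\<And>f. (\<Sum>w\<in>W. n w * f w) = 0 \<Longrightarrow> qform W K f \<ge> 0"
  obtains m i where "\<And>w. w \<in> W \<Longrightarrow> length w \<noteq> 1 \<Longrightarrow> m w = 0" "i < g" "m [i] \<noteq> 0"
    "\<And>f. (\<Sum>w\<in>W. m w * f w) = 0 \<Longrightarrow> qform W K f \<ge> 0"
proof -
  obtain i0 w0 where w0: "i0 < g" "w0 \<in> W" "length w0 = d - 1" "K [i0] w0 \<noteq> 0" using top_word .
  \<comment> \<open>The two lengths add up to more than d. As d \<ge> 3, the case v = w is
    included.\<close>
  have top0: "K v w = 0" if "w \<in> W" "length w = d - 1" "v \<in> W" "length v \<noteq> 1" for v w
    using that d3 by (intro K_eq_0) (cases v; auto simp: W_def Suc_le_eq)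
  show ?thesis
  proof (cases "\<exists>w\<in>W. length w = d - 1 \<and> n w \<noteq> 0")
    case False
    \<comment> \<open>Here \<open>w0\<close> lies in the hyperplane, so its image is a nonzero
      multiple of n, and n itself already has the required support.\<close>
    have "\<exists>a. \<forall>v\<in>W. (\<Sum>w\<in>W. K v w * delta w0 w) = a * n v"
      by (rule isotropic_image_parallel[OF finite_W K_sym pos])
        (use w0 False top0[of w0 w0] d3 in \<open>simp_all add: sum_delta_W qform_delta\<close>)
    then obtain a where a: "\<And>v. v \<in> W \<Longrightarrow> K v w0 = a * n v" using w0 by (auto simp: sum_delta_W)
    have "a \<noteq> 0" "n [i0] \<noteq> 0" using a[of "[i0]"] w0 by (auto simp: Cons_in_W)
    moreover have "n w = 0" if "w \<in> W" "length w \<noteq> 1" for w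
      using a[of w] top0[OF w0(2,3) that] \<open>a \<noteq> 0\<close> that by simp
    ultimately show ?thesis using that[of n i0] w0 pos by blast
  next
    case True
    then obtain w1 where w1: "w1 \<in> W" "length w1 = d - 1" "n w1 \<noteq> 0" by blast
    \<comment> \<open>This t puts the combination w0 - t w1 into the hyperplane.\<close>
    define t where "t = n w0 / n w1"
    define f where "f v = delta w0 v + (- t) * delta w1 v" for v
    have sf: "(\<Sum>w\<in>W. h w * f w) = h w0 - t * h w1" for h
    proof -
      have "(\<Sum>w\<in>W. h w * f w) = (\<Sum>w\<in>W. h w * delta w0 w) - t * (\<Sum>w\<in>W. h w * delta w1 w)"
        by (simp add: f_def algebra_simps sum.distrib sum_subtractf sum_distrib_left)
      then show ?thesis using w0 w1 by (simp add: sum_delta_W)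
    qed
    have "qform W K f = (\<Sum>v\<in>W. (K v w0 - t * K v w1) * f v)"
      unfolding qform_def sf[symmetric] sum_distrib_right by (intro sum.cong refl) (simp add: mult_ac)
    also have "\<dots> = 0" unfolding sf using top0 w0 w1 d3 by simp
    finally have "\<exists>a. \<forall>v\<in>W. (\<Sum>w\<in>W. K v w * f w) = a * n v"
      by (intro isotropic_image_parallel[OF finite_W K_sym pos]) (use w1 in \<open>simp_all add: sf t_def\<close>)
    then obtain a where a: "\<And>v. v \<in> W \<Longrightarrow> K v w0 - t * K v w1 = a * n v" unfolding sf by blast
    \<comment> \<open>At \<open>w1\<close> the left side vanishes but n does not. So the combination
      lies in the kernel, and the nonzero entry of \<open>w0\<close> at \<open>[i0]\<close> is t
      times that of \<open>w1\<close>.\<close>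
    have "a = 0" using a[OF w1(1)] top0[OF w0(2,3) w1(1)] top0[OF w1(1,2) w1(1)] w1 d3 by simp
    then have "K [i0] w1 \<noteq> 0" using a[of "[i0]"] w0 by (auto simp: Cons_in_W)
    moreover have "qform W K h \<ge> 0" if h: "(\<Sum>w\<in>W. K w w1 * h w) = 0" for h
    proof -
      define s where "s = - (\<Sum>w\<in>W. n w * h w) / n w1"
      have "(\<Sum>w\<in>W. n w * (h w + s * delta w1 w)) = (\<Sum>w\<in>W. n w * h w) + s * (\<Sum>w\<in>W. n w * delta w1 w)"
        by (simp add: algebra_simps sum.distrib sum_distrib_left)
      also have "\<dots> = 0" using w1 by (simp add: sum_delta_W s_def)
      finally have "0 \<le> qform W K (\<lambda>w. h w + s * delta w1 w)" by (rule pos)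
      also have "\<dots> = qform W K h + 2 * s * (\<Sum>w\<in>W. K w w1 * h w) + s\<^sup>2 * K w1 w1"
        by (subst qform_add_smult[OF K_sym])
          (simp only: sum_delta_W[OF w1(1)] qform_delta[OF w1(1)] mult.commute[of "h _"])
      also have "\<dots> = qform W K h" using h top0[OF w1(1,2) w1(1)] w1(2) d3 by simp
      finally show ?thesis .
    qed
    ultimately show ?thesis using that[of "\<lambda>w. K w w1" i0] top0[OF w1(1,2)] w0(1) by blast
  qed
qed

lemma hyperplane_unit:
  assumes d3: "d \<ge> 3" and pos: "\<And>f. (\<Sum>w\<in>W. n w * f w) = 0 \<Longrightarrow> qform W K f \<ge> 0"
  obtains u where "(\<Sum>i<g. u i * u i) = (1::real)" "\<And>f. (\<Sum>i<g. u i * f [i]) = 0 \<Longrightarrow> qform W K f \<ge> 0"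
proof (rule hyperplane_support[OF d3 pos])
  fix m i
  assume m: "\<And>w. w \<in> W \<Longrightarrow> length w \<noteq> 1 \<Longrightarrow> m w = 0" "i < g" "m [i] \<noteq> 0"
    "\<And>f. (\<Sum>w\<in>W. m w * f w) = 0 \<Longrightarrow> qform W K f \<ge> 0"
  define N where "N = (\<Sum>i<g. m [i] * m [i])"
  have "N > 0" unfolding N_def using m(2,3) by (intro sum_pos2[of _ i]) (auto simp: zero_less_mult_iff)
  define u where "u i = m [i] / sqrt N" for i
  have "(\<Sum>i<g. u i * u i) = N / N"
    using \<open>N > 0\<close> by (simp add: u_def N_def[symmetric] flip: sum_divide_distrib)
  moreover have "qform W K f \<ge> 0" if "(\<Sum>i<g. u i * f [i]) = 0" for f
  proof (rule m(4))
    have "(\<Sum>w\<in>W. m w * f w) = (\<Sum>i<g. m [i] * f [i])" using m(1) by (intro sum_W_length_1) simp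
    also have "\<dots> = sqrt N * (\<Sum>i<g. u i * f [i])" using \<open>N > 0\<close> by (simp add: u_def sum_distrib_left)
    finally show "(\<Sum>w\<in>W. m w * f w) = 0" using that by simp
  qed
  ultimately show ?thesis using that \<open>N > 0\<close> by simp
qed

text \<open>Up to terms that vanish when \<open>f\<close> is orthogonal to \<open>u\<close>, the form factors
  through the map that contracts the first letter of the words of length two with \<open>u\<close>.\<close>

lemma qform_structured:
  assumes d: "3 \<le> d" "d \<le> 4"
    and c3: "\<And>i k j. i < g \<Longrightarrow> k < g \<Longrightarrow> j < g \<Longrightarrow> c [i, k, j] = u i * u j * y k + u i * V k j + u j * V k i"
    and c4: "\<And>i j l k. i < g \<Longrightarrow> j < g \<Longrightarrow> l < g \<Longrightarrow> k < g \<Longrightarrow> c [i, j, l, k] = u i * A j l * u k"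
    and A_sym: "\<And>j l. j < g \<Longrightarrow> l < g \<Longrightarrow> A j l = A l j"
    and uf: "(\<Sum>i<g. u i * f [i]) = 0"
  shows "qform W K f = block_form V A (\<lambda>i. f [i]) (\<lambda>k. \<Sum>j<g. u j * f [j, k])"
proof -
  define I :: "(nat + nat) set" where "I = {..<g} <+> {..<g}"
  define E where "E s t = (case s of
      Inl i \<Rightarrow> (case t of Inl j \<Rightarrow> c [i, j] | Inr k \<Rightarrow> V k i)
    | Inr k \<Rightarrow> (case t of Inl i \<Rightarrow> V k i | Inr l \<Rightarrow> A k l))" for s t :: "nat + nat"
  define coef where "coef w = (case w of [i] \<Rightarrow> 1 | [j, k] \<Rightarrow> u j | _ \<Rightarrow> 0)" for w :: "nat list"
  \<comment> \<open>Only words of length one or two have weight in \<open>coef\<close>, so the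
    default \<open>Inl 0\<close> is harmless; it belongs to \<open>I\<close> because
    \<open>c_top\<close> forces g to be positive.\<close>
  define idx where "idx w = (case w of [i] \<Rightarrow> Inl i | [j, k] \<Rightarrow> Inr k | _ \<Rightarrow> Inl 0)" for w :: "nat list"
  define e where "e w s = coef w * of_bool (s = idx w)" for w s
  define h where "h w = (case w of [i] \<Rightarrow> u i | _ \<Rightarrow> 0)" for w :: "nat list"
  \<comment> \<open>What is left when \<open>h\<close> is split off: c [i, k, j] - u j * V k i = u i
    * (u j * y k + V k j) for the pairs of lengths 1 and 2, and the four-letter formula, with A
    symmetric, for the pairs of lengths 1 and 3.\<close>
  define r where "r w = (case w of [j, k] \<Rightarrow> u j * y k + V k j | [j, k, l] \<Rightarrow> u j * A k l | _ \<Rightarrow> 0)"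
    for w :: "nat list"
  have e_Inl: "e w (Inl i) = delta [i] w" for w i
    by (auto simp: e_def delta_def coef_def idx_def split: list.splits)
  have e_Inr: "e w (Inr k) = comb {..<g} u (\<lambda>j. [j, k]) w" if "w \<in> W" for w k
  proof (cases "\<exists>j. w = [j, k]")
    case True
    then obtain j where w: "w = [j, k]" by blast
    then have "j < g" using that by (auto simp: W_def)
    then show ?thesis using w
      by (simp add: e_def coef_def idx_def comb_def of_bool_def if_distrib[of "(*) _"] eq_commute[of j] cong: if_cong)
  next
    case False
    then have "w \<noteq> [j, k]" for j by blast
    then show ?thesis by (auto simp: e_def coef_def idx_def comb_def split: list.splits)
  qed
  have cases_W: "(\<exists>i<g. w = [i]) \<or> (\<exists>i<g. \<exists>j<g. w = [i, j]) \<or> (\<exists>i<g. \<exists>j<g. \<exists>k<g. w = [i, j, k]) \<or>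
     (\<exists>i j k l w'. w = i # j # k # l # w')" if wW: "w \<in> W" for w
  proof -
    obtain i w1 where w: "w = i # w1" "i < g" "set w1 \<subseteq> {..<g}" using wW by (cases w) (auto simp: W_def)
    show ?thesis
    proof (cases w1)
      case (Cons j w2)
      show ?thesis
      proof (cases w2)
        case (Cons k w3)
        show ?thesis by (cases w3) (use w Cons \<open>w1 = j # w2\<close> in auto)
      qed (use w Cons in auto)
    qed (use w in auto)
  qed
  have "qform W K f = qform I E (\<lambda>s. \<Sum>w\<in>W. e w s * f w)"
  proof (rule qform_factor[where u = h and r = r])
    show "K v w = (\<Sum>s\<in>I. \<Sum>t\<in>I. E s t * e v s * e w t) + h v * r w + r v * h w"
      if vw: "v \<in> W" "w \<in> W" for v w
    proof -
      have idx_I: "idx x \<in> I" if "x \<in> W" for x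
        using that c_top d by (auto simp: W_def idx_def I_def split: list.splits)
      have fin: "finite I" by (simp add: I_def)
      have "(\<Sum>t\<in>I. E s t * e v s * e w t) = E s (idx w) * coef w * e v s" for s
      proof -
        have "(\<Sum>t\<in>I. E s t * e v s * e w t) = (\<Sum>t\<in>{idx w}. E s t * e v s * e w t)"
          using fin idx_I[OF vw(2)] by (intro sum.mono_neutral_right) (auto simp: e_def)
        then show ?thesis by (simp add: e_def)
      qed
      then have "(\<Sum>s\<in>I. \<Sum>t\<in>I. E s t * e v s * e w t) = (\<Sum>s\<in>I. E s (idx w) * coef w * e v s)"
        by simp
      also have "\<dots> = (\<Sum>s\<in>{idx v}. E s (idx w) * coef w * e v s)"
        using fin idx_I[OF vw(1)] by (intro sum.mono_neutral_right) (auto simp: e_def)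
      also have "\<dots> = E (idx v) (idx w) * coef w * coef v" by (simp add: e_def)
      finally have sum_E: "(\<Sum>s\<in>I. \<Sum>t\<in>I. E s t * e v s * e w t) = E (idx v) (idx w) * coef w * coef v" .
      show ?thesis
      proof (cases "length v + length w \<ge> 5")
        case True
        then have "K v w = 0" using d by (intro K_eq_0) simp
        then show ?thesis unfolding sum_E using True cases_W[OF vw(1)] cases_W[OF vw(2)]
          by (elim disjE exE conjE) (simp_all add: coef_def h_def r_def)
      next
        case False
        then show ?thesis unfolding sum_E using cases_W[OF vw(1)] cases_W[OF vw(2)]
          by (elim disjE exE conjE)
            (simp_all add: coef_def idx_def E_def h_def r_def K_def c3 c4 A_sym, simp_all add: algebra_simps)
      qed
    qed
    have "(\<Sum>w\<in>W. h w * f w) = (\<Sum>i<g. h [i] * f [i])"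
      by (rule sum_W_length_1) (auto simp: h_def split: list.splits)
    then show "(\<Sum>w\<in>W. h w * f w) = 0" using uf by (simp add: h_def)
  qed
  moreover have "(\<Sum>w\<in>W. e w (Inl i) * f w) = f [i]" if "i < g" for i
    using sum_delta_W[of "[i]" f] that by (simp add: e_Inl Cons_in_W mult.commute)
  moreover have "(\<Sum>w\<in>W. e w (Inr k) * f w) = (\<Sum>j<g. u j * f [j, k])" if "k < g" for k
  proof -
    have "(\<Sum>w\<in>W. e w (Inr k) * f w) = (\<Sum>w\<in>W. f w * comb {..<g} u (\<lambda>j. [j, k]) w)"
      by (intro sum.cong refl) (simp add: e_Inr)
    also have "\<dots> = (\<Sum>j<g. f [j, k] * u j)"
      using that d by (intro sum_comb finite_W) (auto simp: Cons2_in_W)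
    finally show ?thesis by (simp add: mult.commute)
  qed
  moreover have "qform I E q = block_form V A (\<lambda>i. q (Inl i)) (\<lambda>k. q (Inr k))" for q
  proof -
    have "(\<Sum>i<g. \<Sum>k<g. V k i * q (Inl i) * q (Inr k)) = (\<Sum>k<g. \<Sum>i<g. V k i * q (Inr k) * q (Inl i))"
      by (subst sum.swap) (simp add: mult_ac)
    then show ?thesis
      by (simp add: qform_def I_def sum.Plus sum.distrib E_def block_form_def)
  qed
  ultimately show ?thesis by (simp add: block_form_def)
qed

lemma qform_degree_2:
  assumes "d = 2"
  shows "qform W K f = (\<Sum>i<g. \<Sum>j<g. c [i, j] * f [i] * f [j])"
proof -
  have 1: "(\<Sum>w\<in>W. h w) = (\<Sum>i<g. h [i])" for h :: "nat list \<Rightarrow> real"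
  proof (rule sum_W_length_1)
    fix w assume "w \<in> W" "length w \<noteq> 1"
    then show "h w = 0" using assms unfolding W_def by (auto simp: less_Suc_eq numeral_2_eq_2)
  qed
  show ?thesis by (simp add: qform_def 1 K_def)
qed

lemma qform_nonneg_iff:
  "(\<forall>f. qform W K f \<ge> 0) \<longleftrightarrow> d = 2 \<and> (\<forall>x. (\<Sum>i<g. \<Sum>j<g. c [i, j] * x i * x j) \<ge> 0)"
proof
  assume pos: "\<forall>f. qform W K f \<ge> 0"
  have "d = 2"
  proof (rule ccontr)
    assume "d \<noteq> 2"
    then have d3: "d \<ge> 3" using d_ge_2 by simp
    obtain i w where w: "i < g" "w \<in> W" "length w = d - 1" "K [i] w \<noteq> 0" using top_word .
    \<comment> \<open>The normal vector is 0 here, so the hyperplane is the whole space.\<close>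
    have "\<exists>a. \<forall>v\<in>W. (\<Sum>v'\<in>W. K v v' * delta w v') = a * 0"
    proof (rule isotropic_image_parallel[OF finite_W K_sym])
      show "qform W K (delta w) = 0" using w d3 by (simp add: qform_delta K_eq_0)
    qed (use pos in auto)
    then have "K [i] w = 0" using w by (simp add: sum_delta_W Cons_in_W)
    then show False using w by simp
  qed
  moreover have "(\<Sum>i<g. \<Sum>j<g. c [i, j] * x i * x j) \<ge> 0" for x
    using pos[rule_format, of "\<lambda>w. x (hd w)"] unfolding qform_degree_2[OF \<open>d = 2\<close>] by simp
  ultimately show "d = 2 \<and> (\<forall>x. (\<Sum>i<g. \<Sum>j<g. c [i, j] * x i * x j) \<ge> 0)" by blast
next
  assume pos: "d = 2 \<and> (\<forall>x. (\<Sum>i<g. \<Sum>j<g. c [i, j] * x i * x j) \<ge> 0)"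
  show "\<forall>f. qform W K f \<ge> 0" unfolding qform_degree_2[OF conjunct1[OF pos]] using pos by simp
qed

section \<open>Coefficients forced by a unit normal vector on the words of length one\<close>

context
  fixes u :: "nat \<Rightarrow> real"
  assumes d3: "d \<ge> 3" and unit: "(\<Sum>i<g. u i * u i) = 1"
    and pos: "\<And>f. (\<Sum>i<g. u i * f [i]) = 0 \<Longrightarrow> qform W K f \<ge> 0"
begin

lemma isotropic_image_unit:
  assumes "(\<Sum>i<g. u i * f [i]) = 0" "qform W K f = 0"
  shows "\<exists>a. (\<forall>i<g. (\<Sum>w\<in>W. K [i] w * f w) = a * u i) \<and>
    (\<forall>v\<in>W. length v \<noteq> 1 \<longrightarrow> (\<Sum>w\<in>W. K v w * f w) = 0)"
proof -
  define n where "n w = (if length w = 1 then u (hd w) else 0)" for w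
  have n: "(\<Sum>w\<in>W. n w * h w) = (\<Sum>i<g. u i * h [i])" for h :: "nat list \<Rightarrow> real"
    by (subst sum_W_length_1) (auto simp: n_def)
  have "\<exists>a. \<forall>v\<in>W. (\<Sum>w\<in>W. K v w * f w) = a * n v"
    by (rule isotropic_image_parallel[OF finite_W K_sym]) (use assms pos n in auto)
  then obtain a where "\<And>v. v \<in> W \<Longrightarrow> (\<Sum>w\<in>W. K v w * f w) = a * n v" by blast
  then show ?thesis by (intro exI[of _ a]) (simp add: n_def Cons_in_W)
qed

text \<open>A single word of length other than one has no component along u, so it lies in the
  hyperplane and only its isotropy has to be checked.\<close>

lemma isotropic_word:
  assumes "w \<in> W" "length w \<noteq> 1" "K w w = 0"
  shows "\<exists>a. (\<forall>i<g. K [i] w = a * u i) \<and> (\<forall>v\<in>W. length v \<noteq> 1 \<longrightarrow> K v w = 0)"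
proof -
  have "delta w [i] = 0" for i using assms(2) by (auto simp: delta_def)
  then have "(\<Sum>i<g. u i * delta w [i]) = 0" by simp
  moreover have "qform W K (delta w) = 0" using assms by (simp add: qform_delta)
  ultimately show ?thesis using isotropic_image_unit[of "delta w"] assms(1)
    by (simp add: sum_delta_W)
qed

text \<open>A letter can be moved across the pairing: \<open>K [i, j] w' = K [i] (w' @ [j])\<close>.
  The shortened word w' has length d - 2 and is isotropic as soon as 2 (d - 2) > d, that is d > 4;
  it then pairs to zero with [i, j], against the choice of w.\<close>

lemma degree_le_4: "d \<le> 4"
proof (rule ccontr)
  assume d: "\<not> d \<le> 4"
  obtain i w where w: "i < g" "w \<in> W" "length w = d - 1" "K [i] w \<noteq> 0" using top_word .
  obtain w' j where w': "w = w' @ [j]" using w(3) d by (cases w rule: rev_cases) auto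
  have W: "[i, j] \<in> W" "w' \<in> W" using w w' d by (auto simp: W_def)
  have "K w' w' = 0" by (rule K_eq_0) (use w w' d in simp)
  then have "K [i, j] w' = 0"
    using isotropic_word[OF W(2)] w w' d W(1) by auto
  then show False using w(4) by (simp add: K_def w')
qed

text \<open>Both outer letters contracted with u: this is the matrix U^T Z_11 U for U = u \<otimes>
  I.\<close>

definition "A4 j l = (\<Sum>i<g. \<Sum>k<g. u i * u k * c [i, j, l, k])"

lemma A4_sym: "A4 j l = A4 l j"
proof -
  have "A4 j l = (\<Sum>k<g. \<Sum>i<g. u i * u k * c [i, j, l, k])" unfolding A4_def by (rule sum.swap)
  also have "\<dots> = A4 l j" unfolding A4_def
  proof (intro sum.cong refl)
    fix i k show "u i * u k * c [i, j, l, k] = u k * u i * c [k, l, j, i]"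
      using c_rev[of "[i, j, l, k]"] by simp
  qed
  finally show ?thesis .
qed

text \<open>For d = 4 the word [k, l, j] is isotropic because 6 > 4, so its entries against the
  words of length one are a multiple of u. Contraction with the unit vector u identifies the
  factor.\<close>

lemma c_length_4_left:
  assumes "i < g" "j < g" "l < g" "k < g"
  shows "c [i, j, l, k] = u i * (\<Sum>i'<g. u i' * c [i', j, l, k])"
proof (cases "d = 4")
  case True
  have "[k, l, j] \<in> W" using assms by (subst Cons3_in_W) (auto simp: True)
  moreover have "K [k, l, j] [k, l, j] = 0" by (rule K_eq_0) (simp add: True)
  ultimately obtain a where "\<And>i. i < g \<Longrightarrow> K [i] [k, l, j] = a * u i"
    using isotropic_word[of "[k, l, j]"] by auto
  then have a: "c [i, j, l, k] = a * u i" if "i < g" for i using that by (simp add: K_def)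
  have "(\<Sum>i'<g. u i' * c [i', j, l, k]) = a * (\<Sum>i'<g. u i' * u i')"
    by (simp add: a sum_distrib_left mult_ac)
  then show ?thesis using a[OF assms(1)] unit by simp
next
  case False
  then show ?thesis using degree_le_4 by (simp add: c_long)
qed

text \<open>Reversal carries the splitting of the first letter over to the last one.\<close>

lemma c_length_4:
  assumes "i < g" "j < g" "l < g" "k < g"
  shows "c [i, j, l, k] = u i * A4 j l * u k"
proof -
  have *: "c [i', j, l, k] = u k * (\<Sum>k'<g. u k' * c [i', j, l, k'])" if "i' < g" for i'
  proof -
    have r: "c [i', j, l, k'] = c [k', l, j, i']" for k' using c_rev[of "[i', j, l, k']"] by simp
    show ?thesis unfolding r using c_length_4_left[of k l j i'] assms that by simp
  qed
  have "(\<Sum>i'<g. u i' * c [i', j, l, k]) = u k * A4 j l"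
    unfolding A4_def sum_distrib_left by (intro sum.cong refl) (simp add: * sum_distrib_left mult_ac)
  then show ?thesis using c_length_4_left[OF assms] by simp
qed

text \<open>For fixed k let C be the symmetric matrix with entries c [i, k, j]. Then
  \<open>y3 k\<close> is u^T C u, and \<open>V3 k\<close> is the component of C u orthogonal to
  u.\<close>

definition "y3 k = (\<Sum>i<g. \<Sum>j<g. u i * u j * c [i, k, j])"
definition "V3 k j = (\<Sum>i<g. u i * c [i, k, j]) - y3 k * u j"

lemma V3_orthogonal: "(\<Sum>j<g. V3 k j * u j) = 0"
proof -
  have "(\<Sum>j<g. V3 k j * u j) = (\<Sum>j<g. (\<Sum>i<g. u i * u j * c [i, k, j]) - y3 k * (u j * u j))"
    by (intro sum.cong refl) (simp add: V3_def right_diff_distrib left_diff_distrib sum_distrib_left mult_ac)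
  also have "\<dots> = (\<Sum>j<g. \<Sum>i<g. u i * u j * c [i, k, j]) - y3 k * (\<Sum>j<g. u j * u j)"
    by (simp add: sum_subtractf sum_distrib_left)
  also have "(\<Sum>j<g. \<Sum>i<g. u i * u j * c [i, k, j]) = y3 k" unfolding y3_def by (rule sum.swap)
  finally show ?thesis by (simp add: unit)
qed

text \<open>With C the matrix of the c [i, k, j] for fixed k, C maps the projection of e_j to the
  complement of u to a multiple b u. So C e_j = u_j C u + b u, and the splitting of C u along u
  gives the formula once b is known.\<close>

lemma c_length_3:
  assumes "i < g" "k < g" "j < g"
  shows "c [i, k, j] = u i * u j * y3 k + u i * V3 k j + u j * V3 k i"
proof -
  \<comment> \<open>The projection of e_j onto the orthogonal complement of u.\<close>
  define a where "a j' = of_bool (j' = j) - u j * u j'" for j'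
  define f where "f = comb {..<g} a (\<lambda>j'. [j', k])"
  have au: "(\<Sum>j'<g. u j' * a j') = 0"
  proof -
    have "(\<Sum>j'<g. u j' * a j') = (\<Sum>j'<g. u j' * of_bool (j' = j)) - u j * (\<Sum>j'<g. u j' * u j')"
      by (simp add: a_def right_diff_distrib sum_subtractf sum_distrib_left mult_ac
          del: sum_mult_of_bool_eq sum_of_bool_mult_eq)
    also have "(\<Sum>j'<g. u j' * of_bool (j' = j)) = u j"
      using assms by (simp add: of_bool_def if_distrib[of "(*) _"] cong: if_cong)
    finally show ?thesis by (simp add: unit)
  qed
  have sub: "(\<lambda>j'. [j', k]) ` {..<g} \<subseteq> W" using assms d3 by (auto simp: Cons2_in_W)
  have "(\<Sum>i<g. u i * f [i]) = 0" by (simp add: f_def comb_def)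
  moreover have "qform W K f = 0"
  proof -
    \<comment> \<open>By the four-letter formula the form at a \<otimes> e_k is
      \<open>A4 k k\<close> times the square of u . a.\<close>
    have "qform W K f = (\<Sum>i<g. \<Sum>l<g. (A4 k k * (u i * a i)) * (u l * a l))"
      unfolding f_def qform_comb[OF finite_W sub] unfolding qform_def
      by (intro sum.cong refl) (use assms in \<open>simp add: K_def c_length_4\<close>)
    also have "\<dots> = 0" by (simp add: au flip: sum_distrib_left)
    finally show ?thesis .
  qed
  ultimately obtain b where b: "\<And>i. i < g \<Longrightarrow> (\<Sum>w\<in>W. K [i] w * f w) = b * u i"
    using isotropic_image_unit[of f] by blast
  have cr: "c [i', k, j'] = c [j', k, i']" for i' j' using c_rev[of "[i', k, j']"] by simp
  have s: "(\<Sum>j'<g. c [i', k, j'] * u j') = V3 k i' + y3 k * u i'" for i'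
    by (simp add: V3_def cr[of i'] mult.commute)
  have "c [i', k, j] - u j * (V3 k i' + y3 k * u i') = b * u i'" if "i' < g" for i'
  proof -
    have "(\<Sum>w\<in>W. K [i'] w * f w) = (\<Sum>j'<g. c [i', k, j'] * a j')"
      unfolding f_def sum_comb[OF finite_W sub] by (simp add: K_def)
    also have "\<dots> = (\<Sum>j'<g. c [i', k, j'] * of_bool (j' = j)) - u j * (\<Sum>j'<g. c [i', k, j'] * u j')"
      by (simp add: a_def right_diff_distrib sum_subtractf sum_distrib_left mult_ac
          del: sum_mult_of_bool_eq sum_of_bool_mult_eq)
    also have "(\<Sum>j'<g. c [i', k, j'] * of_bool (j' = j)) = c [i', k, j]"
      using assms by (simp add: of_bool_def if_distrib[of "(*) _"] cong: if_cong)
    finally show ?thesis unfolding s b[OF that] by simp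
  qed
  then have e: "c [i', k, j] = u j * (V3 k i' + y3 k * u i') + b * u i'" if "i' < g" for i'
    using that by (simp add: algebra_simps)
  \<comment> \<open>Contraction with u determines b, as the row \<open>V3 k\<close> is orthogonal to
    u.\<close>
  have "(\<Sum>i'<g. u i' * c [i', k, j]) = (\<Sum>i'<g. u j * (V3 k i' * u i') + (y3 k * u j + b) * (u i' * u i'))"
    by (intro sum.cong refl) (simp add: e algebra_simps)
  also have "\<dots> = u j * (\<Sum>i'<g. V3 k i' * u i') + (y3 k * u j + b) * (\<Sum>i'<g. u i' * u i')"
    by (simp only: sum.distrib sum_distrib_left)
  finally have "b = V3 k j" by (simp add: unit V3_orthogonal V3_def[of k j])
  then show ?thesis using e[OF assms(1)] by (simp add: algebra_simps)
qed

lemma structured_exists: "structured u y3 V3 A4"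
proof -
  have "block_form V3 A4 x b \<ge> 0" if x: "(\<Sum>i<g. u i * x i) = 0" for x b
  proof -
    \<comment> \<open>The two-letter part is u \<otimes> b, whose contraction with the unit vector u
      returns b. Thus every pair (x, b) with x orthogonal to u arises from the hyperplane.\<close>
    define f where "f w = (case w of [i] \<Rightarrow> x i | [j, k] \<Rightarrow> u j * b k | _ \<Rightarrow> 0)" for w :: "nat list"
    have "(\<Sum>j<g. u j * f [j, k]) = b k" for k
      using unit by (simp add: f_def mult.assoc[symmetric] flip: sum_distrib_right)
    moreover have "f [i] = x i" for i by (simp add: f_def)
    moreover have "qform W K f = block_form V3 A4 (\<lambda>i. f [i]) (\<lambda>k. \<Sum>j<g. u j * f [j, k])"
      by (rule qform_structured[OF d3 degree_le_4 c_length_3 c_length_4 A4_sym]) (use x in \<open>simp_all add: f_def\<close>)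
    moreover have "qform W K f \<ge> 0" by (rule pos) (use x in \<open>simp add: f_def\<close>)
    ultimately show ?thesis by simp
  qed
  then show ?thesis
    unfolding structured_def using degree_le_4 unit V3_orthogonal c_length_3 c_length_4 A4_sym by blast
qed

end

lemma one_negative_iff_structured:
  assumes d3: "d \<ge> 3"
  shows "(\<exists>m. \<forall>f. (\<Sum>w\<in>W. m w * f w) = 0 \<longrightarrow> qform W K f \<ge> 0) \<and> (\<exists>f. qform W K f < 0) \<longleftrightarrow>
    (\<exists>u y V A. structured u y V A)"
proof (intro iffI conjI)
  assume "(\<exists>m. \<forall>f. (\<Sum>w\<in>W. m w * f w) = 0 \<longrightarrow> qform W K f \<ge> 0) \<and> (\<exists>f. qform W K f < 0)"
  then obtain m where "\<And>f. (\<Sum>w\<in>W. m w * f w) = 0 \<Longrightarrow> qform W K f \<ge> 0" by blast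
  from hyperplane_unit[OF d3 this] show "\<exists>u y V A. structured u y V A"
    using structured_exists[OF d3] by metis
next
  assume "\<exists>u y V A. structured u y V A"
  then obtain u y V A where S: "structured u y V A" by blast
  define n where "n w = (if length w = 1 then u (hd w) else 0)" for w
  have n: "(\<Sum>w\<in>W. n w * h w) = (\<Sum>i<g. u i * h [i])" for h :: "nat list \<Rightarrow> real"
    by (subst sum_W_length_1) (auto simp: n_def)
  have "qform W K f \<ge> 0" if "(\<Sum>w\<in>W. n w * f w) = 0" for f
  proof -
    have uf: "(\<Sum>i<g. u i * f [i]) = 0" using that n by simp
    have "qform W K f = block_form V A (\<lambda>i. f [i]) (\<lambda>k. \<Sum>j<g. u j * f [j, k])"
      by (rule qform_structured[OF d3 _ _ _ _ uf]) (use S in \<open>auto simp: structured_def\<close>)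
    then show ?thesis using S uf unfolding structured_def by simp
  qed
  then show "\<exists>m. \<forall>f. (\<Sum>w\<in>W. m w * f w) = 0 \<longrightarrow> qform W K f \<ge> 0" by blast
next
  show "\<exists>f. qform W K f < 0" using qform_nonneg_iff d3 by (auto simp: not_le)
qed

end

subsection \<open>The scalar middle matrix as a Hankel matrix\<close>

definition var_index :: "var \<Rightarrow> nat" where
  "var_index a = (case a of XVar i \<Rightarrow> i | HVar i \<Rightarrow> i)"

text \<open>The word labelling row a of block j. The final h of the border word is identified with
  the x of the same index, since the Hessian coefficients are read off from those of p.\<close>

definition digits :: "nat \<Rightarrow> nat \<Rightarrow> nat \<Rightarrow> nat list" where
  "digits g j a = map var_index (bword g j a)"

text \<open>The factor 2 is the second derivative of t^2: the Hessian replaces two letters of a word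
  of p by h.\<close>

definition hessian_coeff :: "ncpoly \<Rightarrow> nat list \<Rightarrow> real" where
  "hessian_coeff p w = 2 * lk p (map XVar w)"

lemma map_XVar_var_index: "map XVar (map var_index w) = map to_x w"
  by (auto simp: var_index_def split: var.split)

lemma nc_at_zero_eq: "nc_at_zero p = lk p []"
proof -
  have "prod_list (map (\<lambda>_. 0 :: real) w) = of_bool (w = [])" for w :: "var list"
    by (cases w) auto
  then have "nc_at_zero p = (\<Sum>w\<in>Poly_Mapping.keys p. lk p w * of_bool (w = []))"
    unfolding nc_at_zero_def nc_subst_def by simp
  also have "\<dots> = (\<Sum>w\<in>Poly_Mapping.keys p. if w = [] then lk p w else 0)"
    by (intro sum.cong) auto
  also have "\<dots> = lk p []" by (simp add: in_keys_iff)
  finally show ?thesis .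
qed

lemma lookup_above_degree: "nc_degree p < length w \<Longrightarrow> lk p w = 0"
proof (rule ccontr)
  assume "nc_degree p < length w" "lk p w \<noteq> 0"
  moreover from this have "length w \<le> nc_degree p"
    unfolding nc_degree_def by (intro Max_ge) (auto simp: in_keys_iff)
  ultimately show False by simp
qed

lemma length_digits: "a < g ^ (j + 1) \<Longrightarrow> length (digits g j a) = j + 1"
  by (erule bword_form) (simp add: digits_def)

lemma scalar_middle_block_carrier:
  assumes "p \<in> nc_polys g"
  shows "scalar_middle_block g p i j \<in> carrier_mat (g ^ (i + 1)) (g ^ (j + 1))"
  using is_middle_matrix_middle_matrix[OF assms]
  unfolding scalar_middle_block_def is_middle_matrix_def by simp

text \<open>The constant term of an entry of Z_ij belongs to the Hessian word whose middle part is
  empty, so that the two letters h are adjacent.\<close>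

lemma scalar_middle_block_entry:
  assumes p: "p \<in> nc_polys g" and d2: "nc_degree p \<ge> 2" and a: "a < g ^ (i + 1)" and b: "b < g ^ (j + 1)"
  shows "scalar_middle_block g p i j $$ (a, b) = hessian_coeff p (digits g i a @ rev (digits g j b))"
proof -
  let ?Z = "middle_matrix g p"
  have Z: "?Z i j \<in> carrier_mat (g ^ (i + 1)) (g ^ (j + 1))" "elements_mat (?Z i j) \<subseteq> nc_polys g" for i j
    using is_middle_matrix_middle_matrix[OF p] unfolding is_middle_matrix_def by auto
  have lhs: "scalar_middle_block g p i j $$ (a, b) = lk (?Z i j $$ (a, b)) []"
    using Z(1)[of i j] a b unfolding scalar_middle_block_def by (simp add: nc_at_zero_eq)
  show ?thesis
  proof (cases "i \<le> nc_degree p - 2 \<and> j \<le> nc_degree p - 2")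
    case True
    have "lk (?Z i j $$ (a, b)) [] = lk (mid_sum g (nc_degree p - 2) ?Z) (bword g i a @ [] @ rev (bword g j b))"
      by (subst mid_sum_lookup[OF Z]) (use True a b in \<open>auto simp: xwords_def\<close>)
    also have "mid_sum g (nc_degree p - 2) ?Z = nc_hessian p"
      using is_middle_matrix_middle_matrix[OF p] unfolding is_middle_matrix_def by simp
    finally have e: "lk (?Z i j $$ (a, b)) [] = lk (nc_hessian p) (bword g i a @ rev (bword g j b))" by simp
    have h: "hcount (bword g i a) = 1" if "a < g ^ (i + 1)" for i a
    proof -
      obtain w k where w: "w \<in> xwords g" "bword g i a = w @ [HVar k]" using bword_form[OF \<open>a < g ^ (i + 1)\<close>] by metis
      have "filter is_h w = []" using w(1) by (auto simp: xwords_def filter_empty_conv)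
      then show ?thesis using w(2) by simp
    qed
    have "lk (nc_hessian p) (bword g i a @ rev (bword g j b)) = 2 * lk p (map to_x (bword g i a @ rev (bword g j b)))"
      unfolding lookup_nc_hessian_word[OF p] using h[OF a] h[OF b] by (simp add: rev_filter[symmetric])
    then show ?thesis unfolding lhs e hessian_coeff_def digits_def
      by (simp add: map_XVar_var_index[unfolded map_map] rev_map)
  next
    case False
    \<comment> \<open>Outside the index range the block is zero by convention, and the word is
      longer than the degree.\<close>
    then have "?Z i j = 0\<^sub>m (g ^ (i + 1)) (g ^ (j + 1))"
      using is_middle_matrix_middle_matrix[OF p] unfolding is_middle_matrix_def by auto
    then have "lk (?Z i j $$ (a, b)) [] = 0" using a b by simp
    moreover have "hessian_coeff p (digits g i a @ rev (digits g j b)) = 0"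
      unfolding hessian_coeff_def using False d2
      by (subst lookup_above_degree) (auto simp: length_digits[OF a] length_digits[OF b])
    ultimately show ?thesis unfolding lhs by simp
  qed
qed

lemma truncated_hankel_hessian:
  assumes p: "p \<in> nc_polys g" and sym: "nc_symmetric p" and d2: "nc_degree p \<ge> 2"
  shows "truncated_hankel g (nc_degree p) (hessian_coeff p)"
proof
  show "hessian_coeff p (rev w) = hessian_coeff p w" for w
  proof -
    have "lk (nc_involution p) v = lk p (rev v)" for v
      unfolding nc_involution_def by (simp add: map_key.rep_eq)
    from this[of "map XVar w"] show ?thesis
      using sym unfolding nc_symmetric_def hessian_coeff_def by (simp add: rev_map)
  qed
  show "hessian_coeff p w = 0" if "nc_degree p < length w" for w
    using that by (simp add: hessian_coeff_def lookup_above_degree)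
  show "\<exists>w. set w \<subseteq> {..<g} \<and> length w = nc_degree p \<and> hessian_coeff p w \<noteq> 0"
  proof -
    have "nc_degree p \<in> insert 0 (length ` Poly_Mapping.keys p)"
      unfolding nc_degree_def by (intro Max_in) auto
    then obtain v where v: "v \<in> Poly_Mapping.keys p" "length v = nc_degree p" using d2 by auto
    have sv: "set v \<subseteq> XVar ` {..<g}" using p v(1) by (auto simp: nc_polys_def)
    then have "map XVar (map var_index v) = v"
      unfolding map_map by (intro map_idI) (auto simp: var_index_def)
    moreover have "set (map var_index v) \<subseteq> {..<g}" using sv by (auto simp: var_index_def)
    ultimately show ?thesis using v
      by (intro exI[of _ "map var_index v"]) (simp add: hessian_coeff_def in_keys_iff del: map_map)
  qed
qed (rule d2)

text \<open>The length of a word determines its block, and within the block its letters are the base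
  g digits of the row number.\<close>

lemma bij_betw_digits:
  assumes "d \<ge> 2"
  shows "bij_betw (\<lambda>(i, a). digits g i a) (SIGMA i:{..d - 2}. {..<g ^ (i + 1)})
    {w. w \<noteq> [] \<and> length w < d \<and> set w \<subseteq> {..<g}}"
  unfolding bij_betw_def
proof
  show "inj_on (\<lambda>(i, a). digits g i a) (SIGMA i:{..d - 2}. {..<g ^ (i + 1)})"
  proof (rule inj_onI)
    fix x y assume xy: "x \<in> (SIGMA i:{..d - 2}. {..<g ^ (i + 1)})" "y \<in> (SIGMA i:{..d - 2}. {..<g ^ (i + 1)})"
      "(case x of (i, a) \<Rightarrow> digits g i a) = (case y of (i, a) \<Rightarrow> digits g i a)"
    obtain i a j b where x: "x = (i, a)" and y: "y = (j, b)" by (cases x, cases y)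
    have a: "a < g ^ (i + 1)" and b: "b < g ^ (j + 1)" and e: "digits g i a = digits g j b"
      using xy unfolding x y by auto
    have ij: "i = j" using e length_digits[OF a] length_digits[OF b] by simp
    obtain w k where w: "w \<in> xwords g" "length w = i" "k < g" "bword g i a = w @ [HVar k]"
      using bword_form[OF a] .
    obtain v l where v: "v \<in> xwords g" "length v = j" "l < g" "bword g j b = v @ [HVar l]"
      using bword_form[OF b] .
    have id: "map XVar (map var_index w) = w" if "w \<in> xwords g" for w
      using that unfolding map_map by (intro map_idI) (auto simp: var_index_def xwords_def)
    have "map var_index w = map var_index v" and kl: "k = l"
      using e unfolding digits_def w(4) v(4) by (simp_all add: var_index_def)
    then have "w = v" using id[OF w(1)] id[OF v(1)] by simp
    then have "bword g i a = bword g j b" using w v kl by simp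
    then show "x = y" using bword_inj[OF a] b ij unfolding x y by simp
  qed
  show "(\<lambda>(i, a). digits g i a) ` (SIGMA i:{..d - 2}. {..<g ^ (i + 1)}) =
    {w. w \<noteq> [] \<and> length w < d \<and> set w \<subseteq> {..<g}}"
  proof (intro equalityI subsetI)
    fix w assume "w \<in> (\<lambda>(i, a). digits g i a) ` (SIGMA i:{..d - 2}. {..<g ^ (i + 1)})"
    then obtain i a where ia: "i \<le> d - 2" "a < g ^ (i + 1)" "w = digits g i a" by auto
    obtain v k where v: "v \<in> xwords g" "length v = i" "k < g" "bword g i a = v @ [HVar k]"
      using bword_form[OF ia(2)] .
    have "set w \<subseteq> {..<g}" using v by (auto simp: ia(3) digits_def xwords_def var_index_def)
    then show "w \<in> {w. w \<noteq> [] \<and> length w < d \<and> set w \<subseteq> {..<g}}"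
      using ia assms length_digits[OF ia(2)] by auto
  next
    fix w assume "w \<in> {w. w \<noteq> [] \<and> length w < d \<and> set w \<subseteq> {..<g}}"
    then obtain v k where w: "w = v @ [k]" "length v \<le> d - 2" "set v \<subseteq> {..<g}" "k < g"
      by (cases w rule: rev_cases) auto
    have "map XVar v \<in> xwords g" using w by (auto simp: xwords_def)
    from bword_obtain[OF this w(4)] obtain a where
      a: "a < g ^ (length v + 1)" "bword g (length v) a = map XVar v @ [HVar k]" by auto
    have "digits g (length v) a = w" unfolding digits_def a(2) w(1)
      by (auto simp: var_index_def intro!: map_idI)
    then show "w \<in> (\<lambda>(i, a). digits g i a) ` (SIGMA i:{..d - 2}. {..<g ^ (i + 1)})"
      using a(1) w(2) by (intro image_eqI[of _ _ "(length v, a)"]) auto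
  qed
qed

section \<open>Positions in the assembled block matrix\<close>

definition block_offset :: "nat \<Rightarrow> nat \<Rightarrow> nat" where
  "block_offset g i = (\<Sum>k<i. g ^ (k + 1))"

lemma block_offset_Suc: "block_offset g (Suc i) = block_offset g i + g ^ (i + 1)"
  by (simp add: block_offset_def)

lemma block_offset_mono: "i \<le> j \<Longrightarrow> block_offset g i \<le> block_offset g j"
  unfolding block_offset_def by (intro sum_mono2) auto

lemma bij_betw_block_offset:
  "bij_betw (\<lambda>(i, a). block_offset g i + a) (SIGMA i:{..n}. {..<g ^ (i + 1)}) {..<block_offset g (Suc n)}"
proof (induction n)
  case 0
  show ?case by (intro bij_betwI'[of]) (auto simp: block_offset_def)
next
  case (Suc n)
  have "bij_betw (\<lambda>(i, a). block_offset g i + a) ({Suc n} \<times> {..<g ^ (Suc n + 1)})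
      {block_offset g (Suc n)..<block_offset g (Suc (Suc n))}"
    unfolding block_offset_Suc[of g "Suc n"]
  proof (rule bij_betwI'[of])
    fix y assume "y \<in> {block_offset g (Suc n)..<block_offset g (Suc n) + g ^ (Suc n + 1)}"
    then show "\<exists>x\<in>{Suc n} \<times> {..<g ^ (Suc n + 1)}. y = (case x of (i, a) \<Rightarrow> block_offset g i + a)"
      by (intro bexI[of _ "(Suc n, y - block_offset g (Suc n))"]) auto
  qed auto
  from bij_betw_combine[OF Suc this ivl_disj_int_one(2)]
  have "bij_betw (\<lambda>(i, a). block_offset g i + a)
     ((SIGMA i:{..n}. {..<g ^ (i + 1)}) \<union> {Suc n} \<times> {..<g ^ (Suc n + 1)})
     ({..<block_offset g (Suc n)} \<union> {block_offset g (Suc n)..<block_offset g (Suc (Suc n))})" .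
  moreover have "(SIGMA i:{..n}. {..<g ^ (i + 1)}) \<union> {Suc n} \<times> {..<g ^ (Suc n + 1)} = (SIGMA i:{..Suc n}. {..<g ^ (i + 1)})"
    by (auto simp: le_Suc_eq)
  moreover have "{..<block_offset g (Suc n)} \<union> {block_offset g (Suc n)..<block_offset g (Suc (Suc n))} =
      {..<block_offset g (Suc (Suc n))}"
    using block_offset_mono[of "Suc n" "Suc (Suc n)" g] by auto
  ultimately show ?case by simp
qed

lemma block_index_less: "i \<le> n \<Longrightarrow> a < g ^ (i + 1) \<Longrightarrow> block_offset g i + a < block_offset g (Suc n)"
  using block_offset_mono[of "Suc i" "Suc n" g] by (simp add: block_offset_Suc)

lemma block_row:
  assumes "\<And>j. R j \<in> carrier_mat r (g ^ (j + 1))"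
  shows "block_row n R \<in> carrier_mat r (block_offset g (Suc n))"
    and "j \<le> n \<Longrightarrow> x < r \<Longrightarrow> b < g ^ (j + 1) \<Longrightarrow> block_row n R $$ (x, block_offset g j + b) = R j $$ (x, b)"
proof (induction n)
  case 0
  {
    case 1
    show ?case using assms[of 0] by (simp add: block_offset_def)
  next
    case 2
    then show ?case by (simp add: block_offset_def)
  }
next
  case (Suc n)
  note IH = Suc
  {
    case 1
    show ?case using IH(1) assms[of "Suc n"] by (auto simp: append_cols_def block_offset_Suc[of g "Suc n"])
  next
    case 2
    show ?case
    proof (cases "j = Suc n")
      case True
      then show ?thesis using 2 IH(1) assms[of "Suc n"] by (auto simp: append_cols_def)
    next
      case False
      then have j: "j \<le> n" using 2 by simp
      then show ?thesis using 2 IH(1) IH(2)[OF j 2(2,3)] assms[of "Suc n"] block_index_less[OF j 2(3)]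
        by (auto simp: append_cols_def)
    qed
  }
qed

lemma block_rows:
  assumes B: "\<And>i j. B i j \<in> carrier_mat (g ^ (i + 1)) (g ^ (j + 1))"
  shows "block_rows m n B \<in> carrier_mat (block_offset g (Suc m)) (block_offset g (Suc n))"
    and "i \<le> m \<Longrightarrow> j \<le> n \<Longrightarrow> a < g ^ (i + 1) \<Longrightarrow> b < g ^ (j + 1) \<Longrightarrow>
      block_rows m n B $$ (block_offset g i + a, block_offset g j + b) = B i j $$ (a, b)"
proof (induction m)
  case 0
  {
    case 1
    show ?case using block_row(1)[of "B 0" "g ^ (0 + 1)" g n, OF B] by (simp add: block_offset_def)
  next
    case 2
    then show ?case using block_row(2)[of "B 0" "g ^ (0 + 1)" g, OF B] by (simp add: block_offset_def)
  }
next
  case (Suc m)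
  note IH = Suc
  let ?R = "block_row n (B (Suc m))"
  note R = block_row[of "B (Suc m)" "g ^ (Suc m + 1)" g, OF B]
  {
    case 1
    show ?case using IH(1) R(1)[of n] unfolding block_rows.simps block_offset_Suc[of g "Suc m"]
      by (rule carrier_append_rows)
  next
    case 2
    have jb: "block_offset g j + b < block_offset g (Suc n)" by (rule block_index_less) (use 2 in auto)
    have c: "dim_row (block_rows m n B) = block_offset g (Suc m)" "dim_col (block_rows m n B) = block_offset g (Suc n)"
      "dim_row ?R = g ^ (Suc m + 1)" "dim_col ?R = block_offset g (Suc n)"
      using IH(1) R(1)[of n] by auto
    show ?case
    proof (cases "i = Suc m")
      case True
      then show ?thesis using 2 c jb R(2)[of j n a b] by (simp add: append_rows_def)
    next
      case False
      then have i: "i \<le> m" using 2 by simp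
      then show ?thesis using 2 c jb IH(2)[OF i 2(2-4)] block_index_less[OF i 2(3)]
        by (simp add: append_rows_def)
    qed
  }
qed

lemma scalar_middle_matrix_index:
  assumes p: "p \<in> nc_polys g" and sym: "nc_symmetric p" and d2: "nc_degree p \<ge> 2"
  obtains \<psi> n where "scalar_middle_matrix g p \<in> carrier_mat n n"
    "transpose_mat (scalar_middle_matrix g p) = scalar_middle_matrix g p"
    "bij_betw \<psi> (truncated_hankel.W g (nc_degree p)) {..<n}"
    "\<And>v w. v \<in> truncated_hankel.W g (nc_degree p) \<Longrightarrow> w \<in> truncated_hankel.W g (nc_degree p) \<Longrightarrow>
      scalar_middle_matrix g p $$ (\<psi> v, \<psi> w) = truncated_hankel.K (hessian_coeff p) v w"
proof -
  interpret truncated_hankel g "nc_degree p" "hessian_coeff p"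
    by (rule truncated_hankel_hessian[OF assms])
  let ?M = "scalar_middle_matrix g p"
  define m where "m = nc_degree p - 2"
  define S where "S = (SIGMA i:{..m}. {..<g ^ (i + 1)})"
  define \<phi> where "\<phi> = (\<lambda>(i, a). digits g i a)"
  define \<theta> where "\<theta> = (\<lambda>(i, a). block_offset g i + a)"
  \<comment> \<open>From a word to its block and row, and from there to its position in the
    assembled matrix.\<close>
  define \<psi> where "\<psi> = \<theta> \<circ> inv_into S \<phi>"
  have \<phi>: "bij_betw \<phi> S W" unfolding \<phi>_def S_def m_def W_def by (rule bij_betw_digits[OF d2])
  have \<theta>: "bij_betw \<theta> S {..<block_offset g (Suc m)}" unfolding \<theta>_def S_def by (rule bij_betw_block_offset)
  have \<psi>: "bij_betw \<psi> W {..<block_offset g (Suc m)}"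
    unfolding \<psi>_def using bij_betw_trans[OF bij_betw_inv_into[OF \<phi>] \<theta>] .
  have M: "?M \<in> carrier_mat (block_offset g (Suc m)) (block_offset g (Suc m))"
    unfolding scalar_middle_matrix_def m_def by (rule block_rows(1)) (rule scalar_middle_block_carrier[OF p])
  have e: "?M $$ (\<psi> v, \<psi> w) = K v w" if vw: "v \<in> W" "w \<in> W" for v w
  proof -
    obtain i a where v: "inv_into S \<phi> v = (i, a)" by fastforce
    obtain j b where w: "inv_into S \<phi> w = (j, b)" by fastforce
    have "(i, a) \<in> S" "(j, b) \<in> S" "\<phi> (i, a) = v" "\<phi> (j, b) = w"
      using \<phi> vw v w by (metis bij_betw_def inv_into_into f_inv_into_f)+
    then have ij: "i \<le> m" "a < g ^ (i + 1)" "j \<le> m" "b < g ^ (j + 1)" "digits g i a = v" "digits g j b = w"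
      by (auto simp: S_def \<phi>_def)
    have "?M $$ (\<psi> v, \<psi> w) = scalar_middle_block g p i j $$ (a, b)"
      unfolding \<psi>_def comp_def v w \<theta>_def prod.case scalar_middle_matrix_def m_def[symmetric]
      by (rule block_rows(2)) (use ij scalar_middle_block_carrier[OF p] in auto)
    then show ?thesis using scalar_middle_block_entry[OF p d2 ij(2,4)] ij(5,6) by (simp add: K_def)
  qed
  have "transpose_mat ?M = ?M"
  proof (rule eq_matI)
    fix x y assume "x < dim_row ?M" "y < dim_col ?M"
    then have xy: "x < block_offset g (Suc m)" "y < block_offset g (Suc m)" using M by auto
    then obtain v w where "v \<in> W" "w \<in> W" "x = \<psi> v" "y = \<psi> w"
      using \<psi> unfolding bij_betw_def by (metis imageE lessThan_iff)
    then show "transpose_mat ?M $$ (x, y) = ?M $$ (x, y)" using e xy M K_sym by auto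
  qed (use M in auto)
  then show ?thesis using that M \<psi> e by blast
qed

subsection \<open>The block conditions\<close>

lemma col_mat_carrier: "u \<in> carrier_vec n \<Longrightarrow> col_mat u \<in> carrier_mat n 1"
  by (auto simp: col_mat_def)

lemma col_mat_index: "i < dim_vec u \<Longrightarrow> col_mat u $$ (i, 0) = u $ i"
  by (simp add: col_mat_def mat_of_cols_index)

lemma kron_carrier:
  "A \<in> carrier_mat m n \<Longrightarrow> B \<in> carrier_mat k l \<Longrightarrow> kron A B \<in> carrier_mat (m * k) (n * l)"
  by (auto simp: kron_def)

lemma outer_prod_carrier:
  assumes "u \<in> carrier_vec m" "v \<in> carrier_vec n"
  shows "col_mat u * transpose_mat (col_mat v) \<in> carrier_mat m n"
  using col_mat_carrier[OF assms(1)] col_mat_carrier[OF assms(2)] by simp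

lemma outer_prod_index:
  assumes "u \<in> carrier_vec m" "v \<in> carrier_vec n" "i < m" "j < n"
  shows "(col_mat u * transpose_mat (col_mat v)) $$ (i, j) = u $ i * v $ j"
  using col_mat_carrier[OF assms(1)] col_mat_carrier[OF assms(2)] assms
  by (simp add: scalar_prod_def col_mat_index)

lemma outer_kron_carrier:
  assumes "u \<in> carrier_vec m" "x \<in> carrier_vec n" "w \<in> carrier_vec k"
  shows "col_mat u * kron (transpose_mat (col_mat x)) (transpose_mat (col_mat w)) \<in> carrier_mat m (n * k)"
  using col_mat_carrier[OF assms(1)] kron_carrier[of "transpose_mat (col_mat x)" 1 n "transpose_mat (col_mat w)" 1 k]
    col_mat_carrier[OF assms(2)] col_mat_carrier[OF assms(3)] by simp

lemma outer_kron_index: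
  assumes "u \<in> carrier_vec m" "x \<in> carrier_vec n" "w \<in> carrier_vec k" "i < m" "q < n * k"
  shows "(col_mat u * kron (transpose_mat (col_mat x)) (transpose_mat (col_mat w))) $$ (i, q) =
    u $ i * (x $ (q div k) * w $ (q mod k))"
proof -
  have q: "q div k < n" "q mod k < k"
    using assms(5) by (simp_all add: less_mult_imp_div_less) (metis mult_0_right mod_less_divisor gr0I not_less0)
  show ?thesis
    using col_mat_carrier[OF assms(1)] col_mat_carrier[OF assms(2)] col_mat_carrier[OF assms(3)] assms q
    by (simp add: scalar_prod_def col_mat_index kron_def)
qed

lemma kron_one_carrier:
  "u \<in> carrier_vec g \<Longrightarrow> kron (col_mat u) (1\<^sub>m g) \<in> carrier_mat (g * g) g"
  using kron_carrier[of "col_mat u" g 1 "1\<^sub>m g" g g] col_mat_carrier[of u g] by simp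

lemma div_mod_less_square:
  fixes q g :: nat
  assumes "q < g * g"
  shows "q div g < g" "q mod g < g"
  using assms by (simp_all add: less_mult_imp_div_less) (cases g; simp)

lemma kron_one_index:
  assumes "u \<in> carrier_vec g" "q < g * g" "l < g"
  shows "kron (col_mat u) (1\<^sub>m g) $$ (q, l) = u $ (q div g) * of_bool (q mod g = l)"
  using assms col_mat_carrier[OF assms(1)] div_mod_less_square[OF assms(2)] by (simp add: kron_def col_mat_index)

text \<open>The product U A U^T is the Kronecker product of u u^T with A.\<close>

lemma kron_one_sandwich_index:
  fixes u :: "real vec"
  assumes u: "u \<in> carrier_vec g" and A: "A \<in> carrier_mat g g" and qr: "q < g * g" "r < g * g"
  shows "(kron (col_mat u) (1\<^sub>m g) * A * transpose_mat (kron (col_mat u) (1\<^sub>m g))) $$ (q, r) =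
    u $ (q div g) * A $$ (q mod g, r mod g) * u $ (r div g)"
proof -
  let ?U = "kron (col_mat u) (1\<^sub>m g)"
  note U = kron_one_carrier[OF u]
  have UA: "(?U * A) $$ (q, l) = u $ (q div g) * A $$ (q mod g, l)" if "l < g" for l
  proof -
    have "(?U * A) $$ (q, l) = (\<Sum>m<g. ?U $$ (q, m) * A $$ (m, l))"
      using U A qr that by (simp add: scalar_prod_def atLeast0LessThan)
    also have "\<dots> = (\<Sum>m<g. if q mod g = m then u $ (q div g) * A $$ (m, l) else 0)"
      by (intro sum.cong refl) (use qr in \<open>simp add: kron_one_index[OF u]\<close>)
    finally show ?thesis using div_mod_less_square[OF qr(1)] by simp
  qed
  have "(?U * A * transpose_mat ?U) $$ (q, r) = (\<Sum>l<g. (?U * A) $$ (q, l) * ?U $$ (r, l))"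
    using U A qr by (simp add: scalar_prod_def atLeast0LessThan del: assoc_mult_mat)
  also have "\<dots> = (\<Sum>l<g. if r mod g = l then u $ (q div g) * A $$ (q mod g, l) * u $ (r div g) else 0)"
    by (intro sum.cong refl) (use qr in \<open>simp add: UA kron_one_index[OF u]\<close>)
  finally show ?thesis using div_mod_less_square[OF qr(2)] by simp
qed

lemma sum_div_mod:
  fixes f :: "nat \<Rightarrow> 'a::comm_monoid_add"
  shows "(\<Sum>q<m * n. f q) = (\<Sum>i<m. \<Sum>j<n. f (i * n + j))"
  by (simp flip: sum.nat_group add: sum.atLeastLessThan_shift_0[of _ "_ * n"] atLeast0LessThan)

text \<open>U^T U = (u . u) I. This is what recovers A from U A U^T.\<close>

lemma kron_one_orthonormal:
  fixes u :: "real vec"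
  assumes u: "u \<in> carrier_vec g" and unit: "u \<bullet> u = 1"
  shows "transpose_mat (kron (col_mat u) (1\<^sub>m g)) * kron (col_mat u) (1\<^sub>m g) = 1\<^sub>m g"
proof (rule eq_matI)
  let ?U = "kron (col_mat u) (1\<^sub>m g)"
  note U = kron_one_carrier[OF u]
  fix l l' assume "l < dim_row (1\<^sub>m g :: real mat)" "l' < dim_col (1\<^sub>m g :: real mat)"
  then have l: "l < g" "l' < g" by auto
  have "(transpose_mat ?U * ?U) $$ (l, l') = (\<Sum>q<g * g. ?U $$ (q, l) * ?U $$ (q, l'))"
    using U l by (simp add: scalar_prod_def atLeast0LessThan)
  also have "\<dots> = (\<Sum>i<g. \<Sum>j<g. ?U $$ (i * g + j, l) * ?U $$ (i * g + j, l'))" by (rule sum_div_mod)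
  also have "\<dots> = (\<Sum>i<g. \<Sum>j<g. if j = l then u $ i * u $ i * of_bool (l = l') else 0)"
  proof (intro sum.cong refl)
    fix i j assume "i \<in> {..<g}" "j \<in> {..<g}"
    then have ij: "i < g" "j < g" by auto
    have "i * g + j < (i + 1) * g" using ij by simp
    also have "\<dots> \<le> g * g" using ij by (intro mult_right_mono) auto
    finally have "i * g + j < g * g" .
    then show "?U $$ (i * g + j, l) * ?U $$ (i * g + j, l') = (if j = l then u $ i * u $ i * of_bool (l = l') else 0)"
      using ij l by (simp add: kron_one_index[OF u])
  qed
  also have "\<dots> = (\<Sum>i<g. u $ i * u $ i) * of_bool (l = l')" using l by (simp add: sum_distrib_right)
  also have "(\<Sum>i<g. u $ i * u $ i) = 1" using unit u by (simp add: scalar_prod_def atLeast0LessThan)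
  finally show "(transpose_mat ?U * ?U) $$ (l, l') = 1\<^sub>m g $$ (l, l')" using l by simp
qed (use kron_one_carrier[OF u] in auto)

section \<open>The projection orthogonal to u and compressions by it\<close>

lemma compl_proj_carrier:
  assumes "u \<in> carrier_vec g"
  shows "compl_proj u \<in> carrier_mat g g"
  unfolding compl_proj_def by (rule minus_carrier_mat) (rule outer_prod_carrier[OF assms assms])

lemma compl_proj_index:
  assumes u: "u \<in> carrier_vec g" and ij: "i < g" "j < g"
  shows "compl_proj u $$ (i, j) = of_bool (i = j) - u $ i * u $ j"
proof -
  have "compl_proj u $$ (i, j) = 1\<^sub>m (dim_vec u) $$ (i, j) - (col_mat u * transpose_mat (col_mat u)) $$ (i, j)"
    unfolding compl_proj_def by (rule index_minus_mat) (use outer_prod_carrier[OF u u] ij in auto)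
  then show ?thesis using outer_prod_index[OF u u ij] u ij by simp
qed

lemma compl_proj_sym:
  assumes u: "u \<in> carrier_vec g"
  shows "transpose_mat (compl_proj u) = compl_proj u"
  by (rule eq_matI) (use compl_proj_carrier[OF u] in \<open>auto simp: compl_proj_index[OF u]\<close>)

lemma compl_proj_mult_vec:
  assumes u: "u \<in> carrier_vec g" and x: "x \<in> carrier_vec g"
  shows "compl_proj u *\<^sub>v x = x - (u \<bullet> x) \<cdot>\<^sub>v u"
proof (rule eq_vecI)
  fix i assume "i < dim_vec (x - (u \<bullet> x) \<cdot>\<^sub>v u)"
  then have i: "i < g" using u x by simp
  have "(compl_proj u *\<^sub>v x) $ i = (\<Sum>j<g. (of_bool (i = j) - u $ i * u $ j) * x $ j)"
    using i x compl_proj_carrier[OF u]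
    by (simp add: scalar_prod_def atLeast0LessThan compl_proj_index[OF u])
  also have "\<dots> = (\<Sum>j<g. if i = j then x $ j else 0) - (\<Sum>j<g. u $ j * x $ j) * u $ i"
    unfolding sum_distrib_right sum_subtractf[symmetric] by (intro sum.cong refl) (auto simp: algebra_simps)
  also have "\<dots> = (x - (u \<bullet> x) \<cdot>\<^sub>v u) $ i"
    using i x u by (simp add: scalar_prod_def atLeast0LessThan)
  finally show "(compl_proj u *\<^sub>v x) $ i = (x - (u \<bullet> x) \<cdot>\<^sub>v u) $ i" .
qed (use compl_proj_carrier[OF u] x u in auto)

lemma compl_proj_orthogonal:
  assumes "u \<in> carrier_vec g" "x \<in> carrier_vec g" "u \<bullet> u = 1"
  shows "u \<bullet> (compl_proj u *\<^sub>v x) = 0"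
  unfolding compl_proj_mult_vec[OF assms(1,2)] using assms
  by (simp add: scalar_prod_minus_distrib[of _ g] scalar_prod_smult_distrib[of _ g])

lemma compl_proj_fixes:
  assumes "u \<in> carrier_vec g" "x \<in> carrier_vec g" "u \<bullet> x = 0"
  shows "compl_proj u *\<^sub>v x = x"
  unfolding compl_proj_mult_vec[OF assms(1,2)] using assms by (intro eq_vecI) auto

lemma compl_proj_sandwich_carrier:
  "u \<in> carrier_vec g \<Longrightarrow> B \<in> carrier_mat g g \<Longrightarrow> compl_proj u * B * compl_proj u \<in> carrier_mat g g"
  using compl_proj_carrier[of u g] by simp

lemma compl_proj_sandwich_sym:
  assumes u: "u \<in> carrier_vec g" and B: "B \<in> carrier_mat g g" "transpose_mat B = B"
  shows "transpose_mat (compl_proj u * B * compl_proj u) = compl_proj u * B * compl_proj u"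
  using compl_proj_carrier[OF u] B compl_proj_sym[OF u]
  by (simp add: transpose_mult[of _ g g _ g] assoc_mult_mat[of _ g g _ g _ g])

lemma compl_proj_sandwich_form:
  fixes B :: "real mat"
  assumes u: "u \<in> carrier_vec g" and B: "B \<in> carrier_mat g g" and x: "x \<in> carrier_vec g"
  shows "x \<bullet> (compl_proj u * B * compl_proj u *\<^sub>v x) = (compl_proj u *\<^sub>v x) \<bullet> (B *\<^sub>v (compl_proj u *\<^sub>v x))"
proof -
  let ?P = "compl_proj u"
  note P = compl_proj_carrier[OF u]
  have "?P * B * ?P *\<^sub>v x = ?P *\<^sub>v (B *\<^sub>v (?P *\<^sub>v x))"
    using P B x by (simp add: assoc_mult_mat_vec[of _ g g _ g])
  then show ?thesis
    using scalar_prod_adjoint[OF P x, of "B *\<^sub>v (?P *\<^sub>v x)"] P B x compl_proj_sym[OF u] by simp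
qed

text \<open>P maps onto the orthogonal complement of u and fixes it pointwise, so testing P B P on
  all vectors is testing B on that complement.\<close>

lemma psd_compl_proj_sandwich_iff:
  fixes B :: "real mat"
  assumes u: "u \<in> carrier_vec g" "u \<bullet> u = 1" and B: "B \<in> carrier_mat g g" "transpose_mat B = B"
  shows "psd (compl_proj u * B * compl_proj u) \<longleftrightarrow> (\<forall>x\<in>carrier_vec g. u \<bullet> x = 0 \<longrightarrow> x \<bullet> (B *\<^sub>v x) \<ge> 0)"
proof -
  let ?P = "compl_proj u"
  have "psd (?P * B * ?P) \<longleftrightarrow> (\<forall>x\<in>carrier_vec g. (?P *\<^sub>v x) \<bullet> (B *\<^sub>v (?P *\<^sub>v x)) \<ge> 0)"
    using compl_proj_sandwich_carrier[OF u(1) B(1)] compl_proj_sandwich_sym[OF u(1) B]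
      compl_proj_sandwich_form[OF u(1) B(1)] compl_proj_carrier[OF u(1)] by (auto simp: psd_def)
  also have "\<dots> \<longleftrightarrow> (\<forall>x\<in>carrier_vec g. u \<bullet> x = 0 \<longrightarrow> x \<bullet> (B *\<^sub>v x) \<ge> 0)"
    using compl_proj_orthogonal[OF u(1) _ u(2)] compl_proj_fixes[OF u(1)] compl_proj_carrier[OF u(1)]
    by (metis mult_mat_vec_carrier)
  finally show ?thesis .
qed

lemma sum_lessThan_add:
  fixes f :: "nat \<Rightarrow> 'a::comm_monoid_add"
  shows "(\<Sum>i<m + n. f i) = (\<Sum>i<m. f i) + (\<Sum>i<n. f (m + i))"
  by (induction n) (simp_all add: add.assoc)

lemma qform_four_block:
  fixes A :: "real mat"
  assumes "A \<in> carrier_mat m m" "B \<in> carrier_mat m n" "C \<in> carrier_mat n m" "D \<in> carrier_mat n n"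
  shows "qform {..<m + n} (\<lambda>i j. four_block_mat A B C D $$ (i, j)) f =
    (\<Sum>i<m. \<Sum>j<m. A $$ (i, j) * f i * f j) + (\<Sum>i<m. \<Sum>k<n. B $$ (i, k) * f i * f (m + k))
    + (\<Sum>k<n. \<Sum>i<m. C $$ (k, i) * f (m + k) * f i) + (\<Sum>k<n. \<Sum>l<n. D $$ (k, l) * f (m + k) * f (m + l))"
  using assms by (simp add: qform_def sum_lessThan_add sum.distrib add.assoc)

lemma digits_simps:
  "a < g \<Longrightarrow> digits g 0 a = [a]"
  "digits g 1 a = [a div g, a mod g]"
  "digits g 2 a = [a div g div g, a div g mod g, a mod g]"
  by (simp_all add: digits_def bword_def var_index_def numeral_2_eq_2)

lemma forall_div_mod:
  fixes g :: nat
  shows "(\<forall>q<g * g. Q (q div g) (q mod g)) \<longleftrightarrow> (\<forall>j<g. \<forall>k<g. Q j k)"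
proof (intro iffI allI impI)
  fix j k assume *: "\<forall>q<g * g. Q (q div g) (q mod g)" and jk: "j < g" "k < g"
  have "j * g + k < (j + 1) * g" using jk by simp
  also have "\<dots> \<le> g * g" using jk by (intro mult_right_mono) auto
  finally show "Q j k" using *[rule_format, of "j * g + k"] jk by simp
qed (use div_mod_less_square in auto)

text \<open>From V u = 0 follows V P = V. So E_1 is the compression by diag(P, I) of the block
  matrix with B in place of P B P, and only the first component x is restricted to the complement of
  u.\<close>

lemma psd_four_block_compl_proj_iff:
  fixes B :: "real mat"
  assumes u: "u \<in> carrier_vec g" "u \<bullet> u = 1" and B: "B \<in> carrier_mat g g" "transpose_mat B = B"
    and V: "V \<in> carrier_mat g g" "V *\<^sub>v u = 0\<^sub>v g" and A: "A \<in> carrier_mat g g" "transpose_mat A = A"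
  shows "psd (four_block_mat (compl_proj u * B * compl_proj u) (transpose_mat V) V A) \<longleftrightarrow>
    (\<forall>x b. (\<Sum>i<g. u $ i * x i) = 0 \<longrightarrow>
      (\<Sum>i<g. \<Sum>j<g. B $$ (i, j) * x i * x j) + 2 * (\<Sum>k<g. \<Sum>i<g. V $$ (k, i) * b k * x i)
        + (\<Sum>k<g. \<Sum>l<g. A $$ (k, l) * b k * b l) \<ge> 0)"
    (is "psd ?E \<longleftrightarrow> (\<forall>x b. _ \<longrightarrow> ?F x b \<ge> 0)")
proof -
  let ?P = "compl_proj u"
  let ?S = "?P * B * ?P"
  note S = compl_proj_sandwich_carrier[OF u(1) B(1)]
  have E: "?E \<in> carrier_mat (g + g) (g + g)" using S A by auto
  have Esym: "?E $$ (i, j) = ?E $$ (j, i)" if "i < g + g" "j < g + g" for i j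
  proof -
    have "transpose_mat ?E = ?E"
      using S V A B by (simp add: transpose_four_block_mat[of _ g g _ g _ g] compl_proj_sandwich_sym[OF u(1) B])
    moreover have "transpose_mat ?E $$ (i, j) = ?E $$ (j, i)"
      by (rule index_transpose_mat(1)) (simp_all only: carrier_matD[OF E] that)
    ultimately show ?thesis by metis
  qed
  have F: "qform {..<g + g} (\<lambda>i j. ?E $$ (i, j)) f = ?F (\<lambda>i. (?P *\<^sub>v vec g f) $ i) (\<lambda>k. f (g + k))" for f
  proof -
    let ?x = "vec g f"
    let ?y = "?P *\<^sub>v ?x"
    have y: "?y \<in> carrier_vec g" using compl_proj_carrier[OF u(1)] by simp
    have "(\<Sum>i<g. \<Sum>j<g. ?S $$ (i, j) * f i * f j) = ?x \<bullet> (?S *\<^sub>v ?x)"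
      by (subst vec_qform[OF S]) (simp_all add: qform_def)
    also have "\<dots> = ?y \<bullet> (B *\<^sub>v ?y)" by (rule compl_proj_sandwich_form[OF u(1) B(1)]) simp
    also have "\<dots> = (\<Sum>i<g. \<Sum>j<g. B $$ (i, j) * ?y $ i * ?y $ j)"
      by (subst vec_qform[OF B(1) y]) (simp add: qform_def)
    finally have 1: "(\<Sum>i<g. \<Sum>j<g. ?S $$ (i, j) * f i * f j) = (\<Sum>i<g. \<Sum>j<g. B $$ (i, j) * ?y $ i * ?y $ j)" .
    \<comment> \<open>V does not see the difference between a vector and its projection, because V u
      = 0.\<close>
    have "V *\<^sub>v ?y = V *\<^sub>v ?x - V *\<^sub>v ((u \<bullet> ?x) \<cdot>\<^sub>v u)"
      unfolding compl_proj_mult_vec[OF u(1) vec_carrier]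
      by (rule mult_minus_distrib_mat_vec[OF V(1)]) (use u in auto)
    also have "\<dots> = V *\<^sub>v ?x" using V u by (auto simp: mult_mat_vec)
    finally have Vx: "V *\<^sub>v ?y = V *\<^sub>v ?x" .
    have Vy: "(\<Sum>i<g. V $$ (k, i) * ?y $ i) = (\<Sum>i<g. V $$ (k, i) * f i)" if "k < g" for k
    proof -
      have "(V *\<^sub>v z) $ k = (\<Sum>i<g. V $$ (k, i) * z $ i)" if "z \<in> carrier_vec g" for z
        using that \<open>k < g\<close> V(1) by (simp add: scalar_prod_def atLeast0LessThan)
      from this[OF y] this[of ?x] Vx show ?thesis by simp
    qed
    have 2: "(\<Sum>k<g. \<Sum>i<g. V $$ (k, i) * f (g + k) * f i) = (\<Sum>k<g. \<Sum>i<g. V $$ (k, i) * f (g + k) * ?y $ i)"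
    proof (rule sum.cong[OF refl])
      fix k assume "k \<in> {..<g}"
      then have "f (g + k) * (\<Sum>i<g. V $$ (k, i) * f i) = f (g + k) * (\<Sum>i<g. V $$ (k, i) * ?y $ i)"
        using Vy by simp
      then show "(\<Sum>i<g. V $$ (k, i) * f (g + k) * f i) = (\<Sum>i<g. V $$ (k, i) * f (g + k) * ?y $ i)"
        by (simp add: sum_distrib_left mult_ac)
    qed
    have 3: "(\<Sum>i<g. \<Sum>k<g. transpose_mat V $$ (i, k) * f i * f (g + k)) = (\<Sum>k<g. \<Sum>i<g. V $$ (k, i) * f (g + k) * f i)"
      by (subst sum.swap) (use V in \<open>simp add: mult_ac\<close>)
    show ?thesis
      unfolding qform_four_block[OF S transpose_carrier_mat[THEN iffD2, OF V(1)] V(1) A(1)] 1 3 2 by simp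
  qed
  have orth: "(\<Sum>i<g. u $ i * x $ i) = u \<bullet> x" if "x \<in> carrier_vec g" for x
    using that by (simp add: scalar_prod_def atLeast0LessThan)
  show ?thesis
  proof
    assume psd: "psd ?E"
    show "\<forall>x b. (\<Sum>i<g. u $ i * x i) = 0 \<longrightarrow> ?F x b \<ge> 0"
    proof (intro allI impI)
      fix x b assume x: "(\<Sum>i<g. u $ i * x i) = 0"
      define f where "f i = (if i < g then x i else b (i - g))" for i
      have fx: "vec g f = vec g x" by (auto simp: f_def)
      have "?P *\<^sub>v vec g f = vec g x"
        unfolding fx by (rule compl_proj_fixes[OF u(1)]) (use x orth[of "vec g x"] in auto)
      then have "qform {..<g + g} (\<lambda>i j. ?E $$ (i, j)) f = ?F x b"
        unfolding F by (simp add: f_def)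
      then show "?F x b \<ge> 0" using psd psd_iff_qform[OF E] by metis
    qed
  next
    assume pos: "\<forall>x b. (\<Sum>i<g. u $ i * x i) = 0 \<longrightarrow> ?F x b \<ge> 0"
    have "qform {..<g + g} (\<lambda>i j. ?E $$ (i, j)) f \<ge> 0" for f
      unfolding F using compl_proj_orthogonal[OF u(1) _ u(2), of "vec g f"] orth[of "?P *\<^sub>v vec g f"]
        compl_proj_carrier[OF u(1)] by (intro pos[rule_format]) simp
    then show "psd ?E" using psd_iff_qform[OF E] Esym by blast
  qed
qed

section \<open>Blocks of the Hankel matrix\<close>

locale hankel_blocks = truncated_hankel +
  fixes Z :: "nat \<Rightarrow> nat \<Rightarrow> real mat"
  assumes Z_carrier: "Z i j \<in> carrier_mat (g ^ (i + 1)) (g ^ (j + 1))"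
    and Z_index: "a < g ^ (i + 1) \<Longrightarrow> b < g ^ (j + 1) \<Longrightarrow> Z i j $$ (a, b) = c (digits g i a @ rev (digits g j b))"
begin

lemma Z_carriers:
  "Z 0 0 \<in> carrier_mat g g" "Z 0 1 \<in> carrier_mat g (g * g)" "Z 1 0 \<in> carrier_mat (g * g) g"
  "Z 1 1 \<in> carrier_mat (g * g) (g * g)" "Z 0 2 \<in> carrier_mat g (g * (g * g))" "Z 2 0 \<in> carrier_mat (g * (g * g)) g"
  using Z_carrier[of 0 0] Z_carrier[of 0 1] Z_carrier[of 1 0] Z_carrier[of 1 1] Z_carrier[of 0 2] Z_carrier[of 2 0]
  by (simp_all add: numeral_2_eq_2)

lemma Z_00: "i < g \<Longrightarrow> j < g \<Longrightarrow> Z 0 0 $$ (i, j) = c [i, j]"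
  using Z_index[of i 0 j 0] by (simp add: digits_simps)

lemma Z_01: "i < g \<Longrightarrow> q < g * g \<Longrightarrow> Z 0 1 $$ (i, q) = c [i, q mod g, q div g]"
  using Z_index[of i 0 q 1] digits_simps(2)[of g] by (simp add: digits_simps)

lemma Z_11: "q < g * g \<Longrightarrow> r < g * g \<Longrightarrow> Z 1 1 $$ (q, r) = c [q div g, q mod g, r mod g, r div g]"
  using Z_index[of q 1 r 1] digits_simps(2)[of g] by simp

lemma Z_02: "i < g \<Longrightarrow> q < g * (g * g) \<Longrightarrow> Z 0 2 $$ (i, q) = c [i, q mod g, q div g mod g, q div g div g]"
  using Z_index[of i 0 q 2] by (simp add: digits_simps numeral_2_eq_2 digits_simps(3)[unfolded numeral_2_eq_2])

lemma Z_transpose: "Z j i = transpose_mat (Z i j)"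
proof (rule eq_matI)
  fix a b assume "a < dim_row (transpose_mat (Z i j))" "b < dim_col (transpose_mat (Z i j))"
  then have ab: "a < g ^ (j + 1)" "b < g ^ (i + 1)" using Z_carrier[of i j] by auto
  then show "Z j i $$ (a, b) = transpose_mat (Z i j) $$ (a, b)"
    using Z_index[OF ab] Z_index[OF ab(2,1)] Z_carrier[of i j] c_rev[of "digits g j a @ rev (digits g i b)"]
    by (auto simp del: power_Suc)
qed (use Z_carrier[of i j] Z_carrier[of j i] in auto)

text \<open>Entries of Z_ij are coefficients of words of length i + j + 2, and the leading
  coefficients occur already in row block 0. The case n = 1 characterizes degree 2, and n = 3
  characterizes degree at most 4.\<close>

lemma Z_eq_0_iff:
  assumes "n \<ge> 1"
  shows "(\<forall>i j. i + j \<ge> n \<longrightarrow> Z i j = 0\<^sub>m (g ^ (i + 1)) (g ^ (j + 1))) \<longleftrightarrow> d \<le> n + 1"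
proof
  assume 0: "\<forall>i j. i + j \<ge> n \<longrightarrow> Z i j = 0\<^sub>m (g ^ (i + 1)) (g ^ (j + 1))"
  show "d \<le> n + 1"
  proof (rule ccontr)
    assume d: "\<not> d \<le> n + 1"
    obtain i w where w: "i < g" "w \<in> W" "length w = d - 1" "K [i] w \<noteq> 0" using top_word .
    have "w \<in> (\<lambda>(i, a). digits g i a) ` (SIGMA i:{..d - 2}. {..<g ^ (i + 1)})"
      using w(2) bij_betw_digits[OF d_ge_2, of g] unfolding W_def bij_betw_def by blast
    then obtain j b where jb: "b < g ^ (j + 1)" "w = digits g j b" by auto
    have "length w = j + 1" using length_digits[OF jb(1)] jb(2) by simp
    then have "n \<le> 0 + j" using w(3) d by simp
    then have "Z 0 j = 0\<^sub>m (g ^ (0 + 1)) (g ^ (j + 1))" using 0 by blast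
    then have "Z 0 j $$ (i, b) = 0" using w(1) jb(1) by simp
    moreover have "Z 0 j $$ (i, b) = K [i] w"
      using Z_index[of i 0 b j] w(1) jb by (simp add: K_def digits_simps)
    ultimately show False using w(4) by simp
  qed
next
  assume d: "d \<le> n + 1"
  show "\<forall>i j. i + j \<ge> n \<longrightarrow> Z i j = 0\<^sub>m (g ^ (i + 1)) (g ^ (j + 1))"
  proof (intro allI impI eq_matI)
    fix i j a b
    assume ij: "n \<le> i + j" and "a < dim_row (0\<^sub>m (g ^ (i + 1)) (g ^ (j + 1)) :: real mat)"
      "b < dim_col (0\<^sub>m (g ^ (i + 1)) (g ^ (j + 1)) :: real mat)"
    then have ab: "a < g ^ (i + 1)" "b < g ^ (j + 1)" by auto
    have "c (digits g i a @ rev (digits g j b)) = 0"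
      by (rule c_long) (use length_digits[OF ab(1)] length_digits[OF ab(2)] ij d in simp)
    then show "Z i j $$ (a, b) = 0\<^sub>m (g ^ (i + 1)) (g ^ (j + 1)) $$ (a, b)"
      using Z_index[OF ab] ab by simp
  qed (use Z_carrier in auto)
qed

text \<open>Four-letter coefficients vanish in degree 3, which kills A. A positive semidefinite
  block matrix with a zero diagonal block has zero blocks beside it, which kills V.\<close>

lemma structured_degree_3:
  assumes S: "structured u y V A" and d: "d = 3"
  shows "j < g \<Longrightarrow> l < g \<Longrightarrow> A j l = 0" "k < g \<Longrightarrow> i < g \<Longrightarrow> V k i = 0"
proof -
  have A0: "A j l = 0" if "j < g" "l < g" for j l
  proof -
    have "u i * A j l * u i = 0" if "i < g" for i
      using S \<open>j < g\<close> \<open>l < g\<close> that d c_long[of "[i, j, l, i]"] unfolding structured_def by auto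
    then have "(\<Sum>i<g. u i * u i) * A j l = 0"
      unfolding sum_distrib_right by (intro sum.neutral) (auto simp: mult_ac)
    then show ?thesis using S unfolding structured_def by simp
  qed
  then show "j < g \<Longrightarrow> l < g \<Longrightarrow> A j l = 0" .
  assume k: "k < g" and i: "i < g"
  define N where "N = (\<Sum>i<g. V k i * V k i)"
  define q where "q = (\<Sum>i<g. \<Sum>j<g. c [i, j] * V k i * V k j)"
  have nonneg: "q + 2 * t * N \<ge> 0" for t
  proof -
    have "(\<Sum>i<g. u i * V k i) = 0" using S k unfolding structured_def by (simp add: mult.commute)
    \<comment> \<open>The test vector is (x, b) with x row k of V, which is orthogonal to u, and b =
      t e_k. As A = 0, the form is affine in t with slope twice the squared norm of that
      row.\<close>
    then have "block_form V A (V k) (\<lambda>k'. if k' = k then t else 0) \<ge> 0" using S unfolding structured_def by blast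
    moreover have "(\<Sum>k'<g. \<Sum>i<g. V k' i * (if k' = k then t else 0) * V k i) = t * N"
    proof -
      have "(\<Sum>k'<g. \<Sum>i<g. V k' i * (if k' = k then t else 0) * V k i) =
          (\<Sum>k'<g. if k' = k then \<Sum>i<g. V k i * t * V k i else 0)"
        by (intro sum.cong) auto
      then show ?thesis using k by (simp add: N_def sum_distrib_left mult_ac)
    qed
    ultimately show ?thesis by (simp add: block_form_def A0 q_def)
  qed
  have "N = 0"
  proof (rule ccontr)
    assume "N \<noteq> 0"
    \<comment> \<open>This t would make the form -1.\<close>
    then show False using nonneg[of "- (q + 1) / (2 * N)"] by (simp add: field_simps)
  qed
  then show "V k i = 0"
    using i sum_nonneg_eq_0_iff[of "{..<g}" "\<lambda>i. V k i * V k i"] by (simp add: N_def)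
qed

end

lemma mat_eq_index_iff:
  "A \<in> carrier_mat m n \<Longrightarrow> B \<in> carrier_mat m n \<Longrightarrow>
    A = B \<longleftrightarrow> (\<forall>i<m. \<forall>j<n. A $$ (i, j) = B $$ (i, j))"
  by (auto intro: eq_matI)

section \<open>The conditions of \<open>middle_form\<close> in terms of coefficients\<close>

context hankel_blocks begin

lemma Z_support_iff:
  "(\<forall>i j. (i, j) \<notin> {(0, 0), (0, 1), (0, 2), (1, 0), (1, 1), (2, 0)} \<longrightarrow>
     Z i j = 0\<^sub>m (g ^ (i + 1)) (g ^ (j + 1))) \<longleftrightarrow> d \<le> 4"
proof -
  have "(i, j) \<notin> {(0, 0), (0, 1), (0, 2), (1, 0), (1, 1), (2, 0)} \<longleftrightarrow> i + j \<ge> 3" for i j :: nat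
    by auto
  then show ?thesis using Z_eq_0_iff[of 3] by simp
qed

lemma Z_01_eq_iff:
  assumes u: "u \<in> carrier_vec g" and y: "y \<in> carrier_vec g" and v: "v \<in> carrier_vec (g * g)"
  shows "Z 0 1 = col_mat u * kron (transpose_mat (col_mat u)) (transpose_mat (col_mat y))
      + col_mat u * transpose_mat (col_mat v) + structured_transpose g (col_mat u * transpose_mat (col_mat v)) \<longleftrightarrow>
    (\<forall>i<g. \<forall>k<g. \<forall>j<g. c [i, k, j] = u $ i * u $ j * y $ k + u $ i * v $ (j * g + k) + u $ j * v $ (i * g + k))"
    (is "_ = ?R \<longleftrightarrow> ?C")
proof -
  have R: "?R \<in> carrier_mat g (g * g)"
    using outer_kron_carrier[OF u u y] outer_prod_carrier[OF u v] by (simp add: structured_transpose_def)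
  have Ri: "?R $$ (i, q) = u $ i * u $ (q div g) * y $ (q mod g) + u $ i * v $ (q div g * g + q mod g)
      + u $ (q div g) * v $ (i * g + q mod g)" if iq: "i < g" "q < g * g" for i q
  proof -
    have "i * g + q mod g < (i + 1) * g" using div_mod_less_square[OF iq(2)] by simp
    also have "\<dots> \<le> g * g" using iq by (intro mult_right_mono) auto
    finally have q': "i * g + q mod g < g * g" .
    show ?thesis
      using iq q' div_mod_less_square[OF iq(2)] outer_kron_index[OF u u y iq] outer_kron_carrier[OF u u y]
        outer_prod_carrier[OF u v] outer_prod_index[OF u v]
      by (simp add: structured_transpose_def)
  qed
  have "Z 0 1 = ?R \<longleftrightarrow> (\<forall>i<g. \<forall>q<g * g. Z 0 1 $$ (i, q) = ?R $$ (i, q))"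
    by (rule mat_eq_index_iff[OF Z_carriers(2) R])
  also have "\<dots> \<longleftrightarrow> (\<forall>i<g. \<forall>q<g * g. c [i, q mod g, q div g] =
      u $ i * u $ (q div g) * y $ (q mod g) + u $ i * v $ (q div g * g + q mod g)
      + u $ (q div g) * v $ (i * g + q mod g))"
    by (simp add: Z_01 Ri del: One_nat_def)
  also have "\<dots> \<longleftrightarrow> (\<forall>i<g. \<forall>j<g. \<forall>k<g. c [i, k, j] = u $ i * u $ j * y $ k + u $ i * v $ (j * g + k) + u $ j * v $ (i * g + k))"
    by (rule all_cong1, rule imp_cong[OF refl],
        rule forall_div_mod[where Q = "\<lambda>j k. c [_, k, j] = u $ _ * u $ j * y $ k + u $ _ * v $ (j * g + k) + u $ j * v $ (_ * g + k)"])
  finally show ?thesis by blast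
qed

text \<open>The structured transpose exchanges the outer letters of a three-letter word, and this is
  reversal.\<close>

lemma Z_01_structured_transpose: "Z 0 1 = structured_transpose g (Z 0 1)"
proof (rule eq_matI)
  fix i q assume "i < dim_row (structured_transpose g (Z 0 1))" "q < dim_col (structured_transpose g (Z 0 1))"
  then have iq: "i < g" "q < g * g" by (auto simp: structured_transpose_def)
  have "i * g + q mod g < (i + 1) * g" using div_mod_less_square[OF iq(2)] by simp
  also have "\<dots> \<le> g * g" using iq by (intro mult_right_mono) auto
  finally have "i * g + q mod g < g * g" .
  then have "structured_transpose g (Z 0 1) $$ (i, q) = c [q div g, q mod g, i]"
    using iq div_mod_less_square[OF iq(2)] Z_01[of "q div g" "i * g + q mod g"]
    by (simp add: structured_transpose_def)
  also have "\<dots> = c [i, q mod g, q div g]" using c_rev[of "[i, q mod g, q div g]"] by simp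
  finally show "Z 0 1 $$ (i, q) = structured_transpose g (Z 0 1) $$ (i, q)" using Z_01[OF iq] by simp
qed (use Z_carriers(2) in \<open>auto simp: structured_transpose_def\<close>)

lemma Z_11_eq_iff:
  assumes u: "u \<in> carrier_vec g" and A: "A \<in> carrier_mat g g"
  shows "Z 1 1 = kron (col_mat u) (1\<^sub>m g) * A * transpose_mat (kron (col_mat u) (1\<^sub>m g)) \<longleftrightarrow>
    (\<forall>i<g. \<forall>j<g. \<forall>l<g. \<forall>k<g. c [i, j, l, k] = u $ i * A $$ (j, l) * u $ k)" (is "_ = ?R \<longleftrightarrow> _")
proof -
  have R: "?R \<in> carrier_mat (g * g) (g * g)" using kron_one_carrier[OF u] A by simp
  have "Z 1 1 = ?R \<longleftrightarrow> (\<forall>q<g * g. \<forall>r<g * g. Z 1 1 $$ (q, r) = ?R $$ (q, r))"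
    by (rule mat_eq_index_iff[OF Z_carriers(4) R])
  also have "\<dots> \<longleftrightarrow> (\<forall>q<g * g. \<forall>r<g * g. c [q div g, q mod g, r mod g, r div g] =
      u $ (q div g) * A $$ (q mod g, r mod g) * u $ (r div g))"
    by (simp add: Z_11 kron_one_sandwich_index[OF u A] del: assoc_mult_mat One_nat_def)
  also have "\<dots> \<longleftrightarrow> (\<forall>q<g * g. \<forall>k<g. \<forall>l<g. c [q div g, q mod g, l, k] = u $ (q div g) * A $$ (q mod g, l) * u $ k)"
    by (rule all_cong1, rule imp_cong[OF refl],
        rule forall_div_mod[where Q = "\<lambda>k l. c [_ div g, _ mod g, l, k] = u $ (_ div g) * A $$ (_ mod g, l) * u $ k"])
  also have "\<dots> \<longleftrightarrow> (\<forall>i<g. \<forall>j<g. \<forall>k<g. \<forall>l<g. c [i, j, l, k] = u $ i * A $$ (j, l) * u $ k)"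
    by (rule forall_div_mod[where Q = "\<lambda>i j. \<forall>k<g. \<forall>l<g. c [i, j, l, k] = u $ i * A $$ (j, l) * u $ k"])
  finally show ?thesis by blast
qed

text \<open>Z_02 and Z_11 both consist of the four-letter coefficients, cut after the first or after
  the second letter, so the formula for one block gives that for the other.\<close>

lemma Z_02_eq:
  assumes u: "u \<in> carrier_vec g" and A: "A \<in> carrier_mat g g"
    and c4: "\<forall>i<g. \<forall>j<g. \<forall>l<g. \<forall>k<g. c [i, j, l, k] = u $ i * A $$ (j, l) * u $ k"
  shows "Z 0 2 = col_mat u * kron (transpose_mat (col_mat u)) (transpose_mat (col_mat (vec_of_mat A)))" (is "_ = ?R")
proof -
  have w: "vec_of_mat A \<in> carrier_vec (g * g)" using A by (auto simp: vec_of_mat_def)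
  show ?thesis
  proof (rule eq_matI)
    fix i q assume "i < dim_row ?R" "q < dim_col ?R"
    then have iq: "i < g" "q < g * (g * g)" using outer_kron_carrier[OF u u w] by auto
    have g: "g > 0" using iq by (cases g) auto
    have m: "q mod (g * g) div g = q div g mod g" "q mod (g * g) mod g = q mod g" "q div (g * g) = q div g div g"
      using g by (simp_all add: mod_mult2_eq div_mult2_eq)
    have q: "q div g div g < g" using iq(2) by (simp add: less_mult_imp_div_less flip: div_mult2_eq)
    have qq: "q mod (g * g) < g * g" using g by simp
    have "?R $$ (i, q) = u $ i * (u $ (q div g div g) * A $$ (q mod g, q div g mod g))"
      using outer_kron_index[OF u u w iq] A qq by (simp add: vec_of_mat_def m)
    also have "\<dots> = c [i, q mod g, q div g mod g, q div g div g]"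
      using c4 iq g q by simp
    finally show "Z 0 2 $$ (i, q) = ?R $$ (i, q)" using Z_02[OF iq] by simp
  qed (use Z_carriers(5) outer_kron_carrier[OF u u w] in auto)
qed

lemma middle_form_carrier:
  assumes "middle_form g Z u y v A"
  shows "u \<in> carrier_vec g \<and> y \<in> carrier_vec g \<and> v \<in> carrier_vec (g * g) \<and> A \<in> carrier_mat g g"
  by (insert assms, unfold middle_form_def Let_def, elim conjE, intro conjI; assumption)

text \<open>On coefficients, Z_11 and Z_02 express one formula, the transposed blocks and the
  structured transpose express reversal, and U^T U = I returns A. The rest corresponds to
  \<open>structured\<close> clause by clause.\<close>

lemma middle_form_iff_structured:
  assumes u: "u \<in> carrier_vec g" and y: "y \<in> carrier_vec g" and v: "v \<in> carrier_vec (g * g)"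
    and A: "A \<in> carrier_mat g g"
  shows "middle_form g Z u y v A \<longleftrightarrow>
    structured (\<lambda>i. u $ i) (\<lambda>k. y $ k) (\<lambda>k j. v $ (j * g + k)) (\<lambda>j l. A $$ (j, l))"
proof -
  let ?U = "kron (col_mat u) (1\<^sub>m g)"
  let ?V = "mat_of_vec g v"
  define c3 where "c3 \<longleftrightarrow> (\<forall>i<g. \<forall>k<g. \<forall>j<g. c [i, k, j] = u $ i * u $ j * y $ k + u $ i * v $ (j * g + k) + u $ j * v $ (i * g + k))"
  define c4 where "c4 \<longleftrightarrow> (\<forall>i<g. \<forall>j<g. \<forall>l<g. \<forall>k<g. c [i, j, l, k] = u $ i * A $$ (j, l) * u $ k)"
  define psd1 where "psd1 \<longleftrightarrow> psd (four_block_mat (compl_proj u * Z 0 0 * compl_proj u) (transpose_mat ?V) ?V A)"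
  define form where "form \<longleftrightarrow> (\<forall>x b. (\<Sum>i<g. u $ i * x i) = 0 \<longrightarrow>
    block_form (\<lambda>k j. v $ (j * g + k)) (\<lambda>j l. A $$ (j, l)) x b \<ge> 0)"
  have V: "?V \<in> carrier_mat g g"
    using v by (cases "g = 0") (auto simp: mat_of_vec_def)
  have V_index: "?V $$ (k, i) = v $ (i * g + k)" if "k < g" "i < g" for k i
    using that V by (auto simp: mat_of_vec_def)
  have unit: "u \<bullet> u = 1 \<longleftrightarrow> (\<Sum>i<g. u $ i * u $ i) = 1"
    using u by (simp add: scalar_prod_def atLeast0LessThan)
  have Vu: "?V *\<^sub>v u = 0\<^sub>v g \<longleftrightarrow> (\<forall>k<g. (\<Sum>j<g. v $ (j * g + k) * u $ j) = 0)"
    using V u by (auto simp: vec_eq_iff scalar_prod_def atLeast0LessThan V_index)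
  have A_sym: "A = transpose_mat A \<longleftrightarrow> (\<forall>j<g. \<forall>l<g. A $$ (j, l) = A $$ (l, j))"
    using A by (auto simp: mat_eq_iff)
  have psd: "psd1 \<longleftrightarrow> form" if "u \<bullet> u = 1" "?V *\<^sub>v u = 0\<^sub>v g" "A = transpose_mat A"
    using psd_four_block_compl_proj_iff[OF u that(1) Z_carriers(1) Z_transpose[symmetric] V that(2) A that(3)[symmetric]]
    unfolding psd1_def form_def block_form_def by (simp add: Z_00 V_index)
  have AU: "A = transpose_mat ?U * Z 1 1 * ?U" if "u \<bullet> u = 1" c4
  proof -
    have U: "?U \<in> carrier_mat (g * g) g" by (rule kron_one_carrier[OF u])
    have T: "transpose_mat ?U \<in> carrier_mat g (g * g)" using U by simp
    have UA: "?U * A \<in> carrier_mat (g * g) g" using U A by simp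
    have "transpose_mat ?U * Z 1 1 * ?U = transpose_mat ?U * (?U * A * transpose_mat ?U * ?U)"
      unfolding Z_11_eq_iff[OF u A, THEN iffD2, OF that(2)[unfolded c4_def]]
      by (rule assoc_mult_mat[OF T _ U]) (rule mult_carrier_mat[OF UA T])
    also have "?U * A * transpose_mat ?U * ?U = ?U * A * (transpose_mat ?U * ?U)"
      by (rule assoc_mult_mat[OF UA T U])
    also have "\<dots> = ?U * A" unfolding kron_one_orthonormal[OF u that(1)] by (rule right_mult_one_mat[OF UA])
    also have "transpose_mat ?U * (?U * A) = transpose_mat ?U * ?U * A"
      by (rule assoc_mult_mat[OF T U A, symmetric])
    also have "\<dots> = A" unfolding kron_one_orthonormal[OF u that(1)] by (rule left_mult_one_mat[OF A])
    finally show ?thesis by simp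
  qed
  have "middle_form g Z u y v A \<longleftrightarrow> d \<le> 4 \<and> c3 \<and> c4 \<and> u \<bullet> u = 1 \<and> ?V *\<^sub>v u = 0\<^sub>v g \<and> A = transpose_mat A \<and> psd1"
    unfolding middle_form_def Let_def Z_support_iff Z_01_eq_iff[OF u y v, folded c3_def] psd1_def[symmetric]
      Z_11_eq_iff[OF u A, folded c4_def]
  proof (rule iffI, elim conjE, intro conjI; assumption?)
    assume h: "d \<le> 4 \<and> c3 \<and> c4 \<and> u \<bullet> u = 1 \<and> ?V *\<^sub>v u = 0\<^sub>v g \<and> A = transpose_mat A \<and> psd1"
    then have hs: "d \<le> 4" c3 c4 "u \<bullet> u = 1" "?V *\<^sub>v u = 0\<^sub>v g" "A = transpose_mat A" psd1
      by blast+
    note facts = hs u y v A Z_01_structured_transpose Z_transpose[of 1 0] Z_transpose[of 2 0]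
      AU[OF hs(4,3)] Z_02_eq[OF u A, folded c4_def, OF hs(3)]
    show "d \<le> 4 \<and> c3 \<and> Z 0 1 = structured_transpose g (Z 0 1) \<and> Z 1 0 = transpose_mat (Z 0 1) \<and> c4 \<and>
      Z 0 2 = col_mat u * kron (transpose_mat (col_mat u)) (transpose_mat (col_mat (vec_of_mat A))) \<and>
      Z 2 0 = transpose_mat (Z 0 2) \<and> u \<in> carrier_vec g \<and> y \<in> carrier_vec g \<and> u \<bullet> u = 1 \<and>
      v \<in> carrier_vec (g * g) \<and> ?V *\<^sub>v u = 0\<^sub>v g \<and> A \<in> carrier_mat g g \<and> A = transpose_mat A \<and> psd1 \<and>
      A = transpose_mat ?U * Z 1 1 * ?U"
      by (intro conjI; fact facts)
  qed
  also have "\<dots> \<longleftrightarrow> d \<le> 4 \<and> c3 \<and> c4 \<and> u \<bullet> u = 1 \<and> ?V *\<^sub>v u = 0\<^sub>v g \<and> A = transpose_mat A \<and> form"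
    \<comment> \<open>The equivalence \<open>psd\<close> needs the unit vector, V u = 0 and the
      symmetry of A; \<open>conj_cong\<close> supplies them from the preceding conjuncts.\<close>
    by (intro conj_cong refl) (rule psd)
  also have "\<dots> \<longleftrightarrow> structured (\<lambda>i. u $ i) (\<lambda>k. y $ k) (\<lambda>k j. v $ (j * g + k)) (\<lambda>j l. A $$ (j, l))"
    unfolding structured_def unit Vu A_sym form_def c3_def c4_def by (simp only: conj_ac)
  finally show ?thesis .
qed

text \<open>Needed because vectors and matrices reproduce the given functions only on indices below
  g.\<close>

lemma structured_cong:
  assumes "\<And>i. i < g \<Longrightarrow> u i = u' i" "\<And>i. i < g \<Longrightarrow> y i = y' i"
    "\<And>i j. i < g \<Longrightarrow> j < g \<Longrightarrow> V i j = V' i j" "\<And>i j. i < g \<Longrightarrow> j < g \<Longrightarrow> A i j = A' i j"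
  shows "structured u y V A = structured u' y' V' A'"
  unfolding structured_def block_form_def using assms by simp

lemma ex_middle_form_iff: "(\<exists>u y v A. middle_form g Z u y v A) \<longleftrightarrow> (\<exists>u y V A. structured u y V A)"
proof
  assume "\<exists>u y v A. middle_form g Z u y v A"
  then obtain u y v A where m: "middle_form g Z u y v A" by blast
  then show "\<exists>u y V A. structured u y V A"
    using middle_form_iff_structured[of u y v A] middle_form_carrier[OF m] by blast
next
  assume "\<exists>u y V A. structured u y V A"
  then obtain u y V A where S: "structured u y V A" by blast
  \<comment> \<open>The columns of V stacked, so that mat_g of this vector is V.\<close>
  let ?v = "vec (g * g) (\<lambda>q. V (q mod g) (q div g))"
  have v: "?v $ (j * g + k) = V k j" if "k < g" "j < g" for k j
  proof -
    have "j * g + k < (j + 1) * g" using that by simp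
    also have "\<dots> \<le> g * g" using that by (intro mult_right_mono) auto
    finally show ?thesis using that by simp
  qed
  have "middle_form g Z (vec g u) (vec g y) ?v (mat g g (\<lambda>(j, l). A j l)) \<longleftrightarrow> structured u y V A"
    by (subst middle_form_iff_structured, simp, simp, simp, simp, rule structured_cong) (simp_all add: v)
  then show "\<exists>u y v A. middle_form g Z u y v A" using S by blast
qed

lemma middle_form_degree_3:
  assumes m: "middle_form g Z u y v A" and d: "d = 3"
  shows "A = 0\<^sub>m g g \<and> vec_of_mat A = 0\<^sub>v (g * g) \<and> v = 0\<^sub>v (g * g)"
proof -
  note car = middle_form_carrier[OF m]
  then have S: "structured (\<lambda>i. u $ i) (\<lambda>k. y $ k) (\<lambda>k j. v $ (j * g + k)) (\<lambda>j l. A $$ (j, l))"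
    using middle_form_iff_structured[of u y v A] m by blast
  have A: "A = 0\<^sub>m g g" using structured_degree_3(1)[OF S d] car by (intro eq_matI) auto
  moreover have "vec_of_mat (0\<^sub>m g g :: real mat) = 0\<^sub>v (g * g)"
    unfolding vec_of_mat_def by (intro eq_vecI) (auto simp: div_mod_less_square)
  moreover have "v = 0\<^sub>v (g * g)"
  proof (rule eq_vecI)
    fix q assume "q < dim_vec (0\<^sub>v (g * g) :: real vec)"
    then have q: "q < g * g" by simp
    then show "v $ q = 0\<^sub>v (g * g) $ q"
      using structured_degree_3(2)[OF S d div_mod_less_square(2)[OF q] div_mod_less_square(1)[OF q]] by simp
  qed (use car in simp)
  ultimately show ?thesis by simp
qed

lemma psd_Z_00_iff: "psd (Z 0 0) \<longleftrightarrow> (\<forall>x. (\<Sum>i<g. \<Sum>j<g. c [i, j] * x i * x j) \<ge> 0)"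
proof -
  have "Z 0 0 $$ (i, j) = Z 0 0 $$ (j, i)" if "i < g" "j < g" for i j
    using that c_rev[of "[i, j]"] by (simp add: Z_00)
  then show ?thesis unfolding psd_iff_qform[OF Z_carriers(1)] qform_def by (simp add: Z_00)
qed

end

text \<open>In degree 2 only Z_00 is left, and the hyperplane can be taken orthogonal to the
  negative eigenvector u itself. Conversely u is also the vector at which the form is
  negative.\<close>

lemma neg_eigenvalue_count_eq_1_iff_compl_proj:
  fixes B :: "real mat"
  assumes B: "B \<in> carrier_mat g g" "transpose_mat B = B"
  shows "neg_eigenvalue_count B = 1 \<longleftrightarrow> (\<exists>u\<in>carrier_vec g. \<exists>a<0. u \<bullet> u = 1 \<and> B *\<^sub>v u = a \<cdot>\<^sub>v u \<and>
    psd (compl_proj u * B * compl_proj u))"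
proof
  assume "neg_eigenvalue_count B = 1"
  from neg_eigenvalue_count_1_imp[OF B this] obtain u a where u: "u \<in> carrier_vec g" "u \<bullet> u = 1" "a < 0"
      "B *\<^sub>v u = a \<cdot>\<^sub>v u"
    "\<And>x. x \<in> carrier_vec g \<Longrightarrow> u \<bullet> x = 0 \<Longrightarrow> x \<bullet> (B *\<^sub>v x) \<ge> 0"
    by metis
  then show "\<exists>u\<in>carrier_vec g. \<exists>a<0. u \<bullet> u = 1 \<and> B *\<^sub>v u = a \<cdot>\<^sub>v u \<and> psd (compl_proj u * B * compl_proj u)"
    using psd_compl_proj_sandwich_iff[OF u(1,2) B] by blast
next
  assume "\<exists>u\<in>carrier_vec g. \<exists>a<0. u \<bullet> u = 1 \<and> B *\<^sub>v u = a \<cdot>\<^sub>v u \<and> psd (compl_proj u * B * compl_proj u)"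
  then obtain u a where u: "u \<in> carrier_vec g" "u \<bullet> u = 1" "a < 0" "B *\<^sub>v u = a \<cdot>\<^sub>v u"
    and psd: "psd (compl_proj u * B * compl_proj u)" by blast
  have "u \<bullet> (B *\<^sub>v u) < 0" using u by simp
  then show "neg_eigenvalue_count B = 1"
    using neg_eigenvalue_count_1I[OF B u(1) _ u(1)] psd psd_compl_proj_sandwich_iff[OF u(1,2) B] by blast
qed

theorem theorem1p10:
  fixes g :: nat and p :: ncpoly and Z :: "nat \<Rightarrow> nat \<Rightarrow> real mat"
  assumes "p \<in> nc_polys g" and "nc_symmetric p" and "nc_degree p \<ge> 2"
    and "Z = scalar_middle_block g p"
  shows
    "(nc_degree p \<ge> 3 \<longrightarrow>
        (neg_eigenvalue_count (scalar_middle_matrix g p) = 1 \<longleftrightarrow>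
           (\<exists>u y v A. middle_form g Z u y v A)) \<and>
        (nc_degree p = 3 \<longrightarrow>
           (\<forall>u y v A. middle_form g Z u y v A \<longrightarrow>
              A = 0\<^sub>m g g \<and> vec_of_mat A = 0\<^sub>v (g * g) \<and> v = 0\<^sub>v (g * g)))) \<and>
     (nc_degree p = 2 \<longrightarrow>
        (neg_eigenvalue_count (scalar_middle_matrix g p) = 1 \<longleftrightarrow>
           (\<forall>i j. i + j \<ge> 1 \<longrightarrow> Z i j = 0\<^sub>m (g ^ (i + 1)) (g ^ (j + 1))) \<and>
           (\<exists>u\<in>carrier_vec g. \<exists>c<0. scalar_prod u u = 1 \<and> Z 0 0 *\<^sub>v u = c \<cdot>\<^sub>v u \<and>
              psd (compl_proj u * Z 0 0 * compl_proj u)))) \<and>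
     (neg_eigenvalue_count (scalar_middle_matrix g p) = 0 \<longleftrightarrow>
        (\<forall>i j. i + j \<ge> 1 \<longrightarrow> Z i j = 0\<^sub>m (g ^ (i + 1)) (g ^ (j + 1))) \<and> psd (Z 0 0))"
proof -
  let ?M = "scalar_middle_matrix g p"
  interpret truncated_hankel g "nc_degree p" "hessian_coeff p"
    by (rule truncated_hankel_hessian[OF assms(1-3)])
  interpret hankel_blocks g "nc_degree p" "hessian_coeff p" Z
    by unfold_locales
      (use assms scalar_middle_block_carrier scalar_middle_block_entry in \<open>auto simp del: power_Suc\<close>)
  obtain n \<psi> where M: "?M \<in> carrier_mat n n" "transpose_mat ?M = ?M" "bij_betw \<psi> W {..<n}"
    "\<And>v w. v \<in> W \<Longrightarrow> w \<in> W \<Longrightarrow> ?M $$ (\<psi> v, \<psi> w) = K v w"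
    by (rule scalar_middle_matrix_index[OF assms(1-3)]) (rule that)
  have count0: "neg_eigenvalue_count ?M = 0 \<longleftrightarrow> (\<forall>f. qform W K f \<ge> 0)"
    by (rule neg_eigenvalue_count_eq_0_qform[OF M(1-3)]) (rule M(4))
  have count1: "neg_eigenvalue_count ?M = 1 \<longleftrightarrow>
      (\<exists>m. \<forall>f. (\<Sum>w\<in>W. m w * f w) = 0 \<longrightarrow> qform W K f \<ge> 0) \<and> (\<exists>f. qform W K f < 0)"
    by (rule neg_eigenvalue_count_eq_1_qform[OF M(1-3)]) (rule M(4))
  \<comment> \<open>By \<open>Z_eq_0_iff\<close> with n = 1, the vanishing of all blocks other than
    Z_00 means degree 2.\<close>
  have zero: "neg_eigenvalue_count ?M = 0 \<longleftrightarrow>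
      (\<forall>i j. i + j \<ge> 1 \<longrightarrow> Z i j = 0\<^sub>m (g ^ (i + 1)) (g ^ (j + 1))) \<and> psd (Z 0 0)"
    unfolding count0 qform_nonneg_iff psd_Z_00_iff
    using Z_eq_0_iff[of 1] d_ge_2 by auto
  have one: "neg_eigenvalue_count ?M = 1 \<longleftrightarrow> (\<exists>u y v A. middle_form g Z u y v A)" if "nc_degree p \<ge> 3"
    unfolding count1 ex_middle_form_iff by (rule one_negative_iff_structured[OF that])
  have two: "neg_eigenvalue_count ?M = 1 \<longleftrightarrow>
      (\<forall>i j. i + j \<ge> 1 \<longrightarrow> Z i j = 0\<^sub>m (g ^ (i + 1)) (g ^ (j + 1))) \<and>
      (\<exists>u\<in>carrier_vec g. \<exists>c<0. scalar_prod u u = 1 \<and> Z 0 0 *\<^sub>v u = c \<cdot>\<^sub>v u \<and>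
         psd (compl_proj u * Z 0 0 * compl_proj u))" if d: "nc_degree p = 2"
  proof -
    \<comment> \<open>For degree 2 the block indices take only the value 0.\<close>
    have "?M = Z 0 0" unfolding scalar_middle_matrix_def by (simp add: d assms(4))
    moreover have "\<forall>i j. i + j \<ge> 1 \<longrightarrow> Z i j = 0\<^sub>m (g ^ (i + 1)) (g ^ (j + 1))"
      using Z_eq_0_iff[of 1] d by simp
    ultimately show ?thesis
      using neg_eigenvalue_count_eq_1_iff_compl_proj[OF Z_carriers(1) Z_transpose[symmetric]] by simp
  qed
  show ?thesis using zero one two middle_form_degree_3 by blast
qed

end
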